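(* Let $M$ be a smooth manifold of dimension $m$ and let $\mathcal{T}^n=TM\oplus\wedge^nT^*M$, with pairing $(\cdot,\cdot)$, higher-order Dorfman bracket $\{\cdot,\cdot\}$ and projection $\rho:\mathcal{T}^n\to TM$. (1) For all $e_1,e_2\in\Gamma(\mathcal{T}^n)$ and $f\in C^\infty(M)$, $$\{e_1,fe_2\}=f\{e_1,e_2\}+\rho(e_1)(f)\,e_2,$$ $$\{fe_1,e_2\}=f\{e_1,e_2\}-\rho(e_2)(f)\,e_1+df\wedge 2(e_1,e_2).$$ (2) The bracket $\{\cdot,\cdot\}$ is a Leibniz bracket, i.e. for all $e_1,e_2,e_3\in\Gamma(\mathcal{T}^n)$, $$\{e_1,\{e_2,e_3\}\}=\{\{e_1,e_2\},e_3\}+\{e_2,\{e_1,e_3\}\}.$$ Consequently, $(\mathcal{T}^n,\{\cdot,\cdot\},\rho)$ is a Leibniz algebroid. (3) The pairing and the higher-order Dorfman bracket are compatible in the sense that, for all $e_1,e_2,e_3\in\Gamma(\mathcal{T}^n)$, $$L_{\rho(e_1)}(e_2,e_3)=(\{e_1,e_2\},e_3)+(e_2,\{e_1,e_3\}).$$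
   Context: $M$ is a smooth $m$-dimensional manifold and $n\ge 0$ an integer (with the convention $\wedge^{-1}T^*M=0$). Sections of $\mathcal{T}^n=TM\oplus\wedge^nT^*M$ are written $X+\alpha$ with $X$ a vector field and $\alpha\in\Omega^n(M)$. The $\wedge^{n-1}T^*M$-valued symmetric pairing is $(X+\alpha,Y+\beta)=\frac12(i_X\beta+i_Y\alpha)$. The higher-order Dorfman bracket is $$\{X+\alpha,Y+\beta\}=[X,Y]+L_X\beta-L_Y\alpha+d\,i_Y\alpha.$$ The map $\rho$ is $\rho(X+\alpha)=X$. An $n$-form is regarded as a section of $\mathcal{T}^n$ with zero vector field component. A Leibniz algebroid structure on a vector bundle $E\to M$ is a pair consisting of an $\mathbb{R}$-bilinear bracket $\{\cdot,\cdot\}$ on $\Gamma(E)$ making it a Leibniz algebra, i.e. $\{a,\{b,c\}\}=\{\{a,b\},c\}+\{b,\{a,c\}\}$, and a vector bundle morphism $\rho:E\to TM$ (the anchor) such that $\rho\{a,b\}=[\rho(a),\rho(b)]$ and $\{a,fb\}=f\{a,b\}+\rho(a)(f)\,b$ for all $a,b,c\in\Gamma(E)$, $f\in C^\infty(M)$. *)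

theory Defs
  imports "HOL-Analysis.Analysis" "HOL-Library.Function_Algebras"
begin

section \<open>Functions into a real vector space\<close>

text \<open>Pointwise scalar multiplication. The additive structure on functions is the one of
  \<^theory>\<open>HOL-Library.Function_Algebras\<close>.\<close>

instantiation "fun" :: (type, real_vector) real_vector
begin

definition scaleR_fun :: "real \<Rightarrow> ('a \<Rightarrow> 'b) \<Rightarrow> 'a \<Rightarrow> 'b"
  where "scaleR_fun r f = (\<lambda>x. r *\<^sub>R f x)"

instance
  by standard
    (auto simp: scaleR_fun_def plus_fun_def fun_eq_iff scaleR_add_right scaleR_add_left)

end


section \<open>Smooth functions on open subsets of Euclidean space\<close>

text \<open>The model space of dimension \<open>m\<close> is the library topology \<^const>\<open>Euclidean_space\<close>, whose
  points are the sequences vanishing from index \<open>m\<close> on. This allows every dimension, including 0.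
  The definitions below are meaningful for sets \<open>U\<close> that are open in \<open>Euclidean_space m\<close>.\<close>

definition partial :: "nat \<Rightarrow> ((nat \<Rightarrow> real) \<Rightarrow> real) \<Rightarrow> (nat \<Rightarrow> real) \<Rightarrow> real"
  where "partial i f x = deriv (\<lambda>t. f (x(i := t))) (x i)"

fun Ck_on :: "nat \<Rightarrow> nat \<Rightarrow> (nat \<Rightarrow> real) set \<Rightarrow> ((nat \<Rightarrow> real) \<Rightarrow> real) \<Rightarrow> bool"
  where
    "Ck_on m 0 U f \<longleftrightarrow> continuous_on U f"
  | "Ck_on m (Suc k) U f \<longleftrightarrow> continuous_on U f \<and>
       (\<forall>i<m. (\<forall>x\<in>U. (\<lambda>t. f (x(i := t))) differentiable (at (x i))) \<and>
              Ck_on m k U (partial i f))"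

definition smooth_on :: "nat \<Rightarrow> (nat \<Rightarrow> real) set \<Rightarrow> ((nat \<Rightarrow> real) \<Rightarrow> real) \<Rightarrow> bool"
  where "smooth_on m U f \<longleftrightarrow> (\<forall>k. Ck_on m k U f)"


section \<open>Smooth manifolds\<close>

text \<open>A chart is a pair of its domain and its coordinate map. The atlas need not be maximal.\<close>

type_synonym 'p chart = "'p set \<times> ('p \<Rightarrow> nat \<Rightarrow> real)"

record 'p manifold =
  mdim :: nat
  mtop :: "'p topology"
  atlas :: "'p chart set"

definition smooth_manifold :: "'p manifold \<Rightarrow> bool"
  where "smooth_manifold M \<longleftrightarrow>
    Hausdorff_space (mtop M) \<and> second_countable (mtop M) \<and>
    (\<Union>(U, \<phi>)\<in>atlas M. U) = topspace (mtop M) \<and>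
    (\<forall>(U, \<phi>)\<in>atlas M.
       openin (mtop M) U \<and>
       openin (Euclidean_space (mdim M)) (\<phi> ` U) \<and>
       homeomorphic_map (subtopology (mtop M) U)
         (subtopology (Euclidean_space (mdim M)) (\<phi> ` U)) \<phi>) \<and>
    (\<forall>(U, \<phi>)\<in>atlas M. \<forall>(V, \<psi>)\<in>atlas M. \<forall>i<mdim M.
       smooth_on (mdim M) (\<phi> ` (U \<inter> V)) (\<lambda>x. \<psi> (inv_into U \<phi> x) i))"

definition smooth_fun_on :: "'p manifold \<Rightarrow> 'p set \<Rightarrow> ('p \<Rightarrow> real) \<Rightarrow> bool"
  where "smooth_fun_on M W f \<longleftrightarrow>
    (\<forall>(U, \<phi>)\<in>atlas M. smooth_on (mdim M) (\<phi> ` (U \<inter> W)) (f \<circ> inv_into U \<phi>))"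

text \<open>Values of a function outside the manifold are irrelevant.\<close>

definition smooth_functions :: "'p manifold \<Rightarrow> ('p \<Rightarrow> real) set"
  where "smooth_functions M = {f. smooth_fun_on M (topspace (mtop M)) f}"

definition smooth_near :: "'p manifold \<Rightarrow> 'p \<Rightarrow> ('p \<Rightarrow> real) \<Rightarrow> bool"
  where "smooth_near M p f \<longleftrightarrow> (\<exists>W. openin (mtop M) W \<and> p \<in> W \<and> smooth_fun_on M W f)"


section \<open>Tangent spaces\<close>

text \<open>A tangent vector at \<open>p\<close> is a derivation on germs at \<open>p\<close> of smooth functions. It is
  represented by a functional on all functions that depends only on the germ at \<open>p\<close>, with the value
  0 at functions not smooth near \<open>p\<close>; with this convention equality of tangent vectors is equality
  of functionals, and the tangent space at a point outside the manifold is \<open>{0}\<close>.\<close>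

type_synonym 'p tvec = "('p \<Rightarrow> real) \<Rightarrow> real"

definition tangent_space :: "'p manifold \<Rightarrow> 'p \<Rightarrow> 'p tvec set"
  where "tangent_space M p = {v.
    (\<forall>f. \<not> smooth_near M p f \<longrightarrow> v f = 0) \<and>
    (\<forall>f g. smooth_near M p f \<and> smooth_near M p g \<and>
       (\<exists>W. openin (mtop M) W \<and> p \<in> W \<and> (\<forall>q\<in>W. f q = g q)) \<longrightarrow> v f = v g) \<and>
    (\<forall>f g. smooth_near M p f \<and> smooth_near M p g \<longrightarrow> v (\<lambda>q. f q + g q) = v f + v g) \<and>
    (\<forall>c f. smooth_near M p f \<longrightarrow> v (\<lambda>q. c * f q) = c * v f) \<and>
    (\<forall>f g. smooth_near M p f \<and> smooth_near M p g \<longrightarrow>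
       v (\<lambda>q. f q * g q) = f p * v g + g p * v f)}"

definition coord_vec :: "'p manifold \<Rightarrow> 'p chart \<Rightarrow> nat \<Rightarrow> 'p \<Rightarrow> 'p tvec"
  where "coord_vec M c i p =
    (\<lambda>f. if smooth_near M p f then partial i (f \<circ> inv_into (fst c) (snd c)) (snd c p) else 0)"


section \<open>Alternating forms\<close>

text \<open>A form on a vector space \<open>V\<close> of tangent vectors is a function of the list of its arguments,
  with value 0 at lists of the wrong length or with entries outside \<open>V\<close>. Inserting a vector into a
  form of degree 0 therefore gives 0, which is the convention that forms of degree \<open>-1\<close> vanish;
  interior product, wedge product and the derivatives below need no degree argument.\<close>

type_synonym 'p form = "'p tvec list \<Rightarrow> real"

definition alt_forms :: "'p tvec set \<Rightarrow> nat \<Rightarrow> 'p form set"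
  where "alt_forms V k = {\<omega>.
    (\<forall>vs. \<omega> vs \<noteq> 0 \<longrightarrow> length vs = k \<and> set vs \<subseteq> V) \<and>
    (\<forall>us x y ws. set us \<subseteq> V \<and> x \<in> V \<and> y \<in> V \<and> set ws \<subseteq> V \<longrightarrow>
       \<omega> (us @ (x + y) # ws) = \<omega> (us @ x # ws) + \<omega> (us @ y # ws)) \<and>
    (\<forall>c us x ws. set us \<subseteq> V \<and> x \<in> V \<and> set ws \<subseteq> V \<longrightarrow>
       \<omega> (us @ (c *\<^sub>R x) # ws) = c * \<omega> (us @ x # ws)) \<and>
    (\<forall>vs. \<not> distinct vs \<longrightarrow> \<omega> vs = 0)}"

text \<open>The normalisation is the one for which
  \<open>(\<alpha>\<^sub>1 \<and> \<dots> \<and> \<alpha>\<^sub>k) (v\<^sub>1, \<dots>, v\<^sub>k) = det (\<alpha>\<^sub>i (v\<^sub>j))\<close> for 1-forms \<open>\<alpha>\<^sub>i\<close>. In the sum over \<open>k\<close>, forms of degrees \<open>a\<close> and \<open>b\<close>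
  only contribute for \<open>k = a\<close> at lists of length \<open>a + b\<close>.\<close>

definition wedge :: "'p form \<Rightarrow> 'p form \<Rightarrow> 'p form"
  where "wedge \<alpha> \<beta> vs =
    (\<Sum>k\<le>length vs. 1 / (fact k * fact (length vs - k)) *
      (\<Sum>\<sigma> | \<sigma> permutes {..<length vs}. of_int (sign \<sigma>) *
        \<alpha> (map (\<lambda>i. vs ! \<sigma> i) [0..<k]) * \<beta> (map (\<lambda>i. vs ! \<sigma> i) [k..<length vs])))"

text \<open>The form \<open>dx\<^sup>I\<close> at \<open>p\<close> in the chart \<open>c\<close>, as a determinant.\<close>

definition coord_form :: "'p manifold \<Rightarrow> 'p chart \<Rightarrow> nat list \<Rightarrow> 'p \<Rightarrow> 'p form"
  where "coord_form M c I p vs =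
    (if length vs = length I \<and> set vs \<subseteq> tangent_space M p
     then \<Sum>\<sigma> | \<sigma> permutes {..<length I}. of_int (sign \<sigma>) *
            (\<Prod>j<length I. (vs ! j) (\<lambda>q. snd c q (I ! \<sigma> j)))
     else 0)"


section \<open>Vector bundles\<close>

text \<open>A vector bundle is given by its fibres, which are subspaces of one ambient vector space, and
  by local frames, all indexed by the same finite set, which cover the base and are related by smooth
  transition functions. A local frame amounts to a local trivialisation, so that these data determine
  the smooth structure of the total space.\<close>

record ('p, 'i, 'v) vbundle =
  fibre :: "'p \<Rightarrow> 'v set"
  fidx :: "'i set"
  frames :: "('p set \<times> ('i \<Rightarrow> 'p \<Rightarrow> 'v)) set"

definition smooth_in_frame ::
    "'p manifold \<Rightarrow> 'i set \<Rightarrow> ('i \<Rightarrow> 'p \<Rightarrow> 'v::real_vector) \<Rightarrow> 'p set \<Rightarrow> ('p \<Rightarrow> 'v) \<Rightarrow> bool"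
  where "smooth_in_frame M I e W s \<longleftrightarrow>
    (\<exists>c. (\<forall>i\<in>I. smooth_fun_on M W (c i)) \<and> (\<forall>p\<in>W. s p = (\<Sum>i\<in>I. c i p *\<^sub>R e i p)))"

definition vector_bundle :: "'p manifold \<Rightarrow> ('p, 'i, 'v::real_vector) vbundle \<Rightarrow> bool"
  where "vector_bundle M E \<longleftrightarrow>
    finite (fidx E) \<and>
    (\<forall>p\<in>topspace (mtop M). subspace (fibre E p)) \<and>
    (\<Union>(U, e)\<in>frames E. U) = topspace (mtop M) \<and>
    (\<forall>(U, e)\<in>frames E. openin (mtop M) U \<and>
       (\<forall>p\<in>U. inj_on (\<lambda>i. e i p) (fidx E) \<and> independent ((\<lambda>i. e i p) ` fidx E) \<and>
          span ((\<lambda>i. e i p) ` fidx E) = fibre E p)) \<and>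
    (\<forall>(U, e)\<in>frames E. \<forall>(V, e')\<in>frames E. \<forall>i\<in>fidx E.
       smooth_in_frame M (fidx E) e' (U \<inter> V) (e i))"

definition smooth_section_on ::
    "'p manifold \<Rightarrow> ('p, 'i, 'v::real_vector) vbundle \<Rightarrow> 'p set \<Rightarrow> ('p \<Rightarrow> 'v) \<Rightarrow> bool"
  where "smooth_section_on M E W s \<longleftrightarrow>
    (\<forall>p\<in>W. s p \<in> fibre E p) \<and>
    (\<forall>(U, e)\<in>frames E. smooth_in_frame M (fidx E) e (U \<inter> W) s)"

text \<open>Global sections are extended by 0 outside the manifold, so that equality of sections is
  equality of functions.\<close>

definition sections :: "'p manifold \<Rightarrow> ('p, 'i, 'v::real_vector) vbundle \<Rightarrow> ('p \<Rightarrow> 'v) set"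
  where "sections M E =
    {s. smooth_section_on M E (topspace (mtop M)) s \<and> (\<forall>p. p \<notin> topspace (mtop M) \<longrightarrow> s p = 0)}"

text \<open>Morphisms are over the identity of the base. Smoothness is tested on local frames.\<close>

definition bundle_morphism ::
    "'p manifold \<Rightarrow> ('p, 'i, 'v::real_vector) vbundle \<Rightarrow> ('p, 'j, 'w::real_vector) vbundle \<Rightarrow>
      ('p \<Rightarrow> 'v \<Rightarrow> 'w) \<Rightarrow> bool"
  where "bundle_morphism M E F \<rho> \<longleftrightarrow>
    (\<forall>p\<in>topspace (mtop M).
       (\<forall>x\<in>fibre E p. \<rho> p x \<in> fibre F p) \<and>
       (\<forall>x\<in>fibre E p. \<forall>y\<in>fibre E p. \<rho> p (x + y) = \<rho> p x + \<rho> p y) \<and>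
       (\<forall>c. \<forall>x\<in>fibre E p. \<rho> p (c *\<^sub>R x) = c *\<^sub>R \<rho> p x)) \<and>
    (\<forall>(U, e)\<in>frames E. \<forall>i\<in>fidx E. smooth_section_on M F U (\<lambda>p. \<rho> p (e i p)))"

definition bundle_sum ::
    "('p, 'i, 'v) vbundle \<Rightarrow> ('p, 'j, 'w) vbundle \<Rightarrow>
      ('p, 'i + 'j, 'v::real_vector \<times> 'w::real_vector) vbundle"
  where "bundle_sum E F = \<lparr>
    fibre = (\<lambda>p. fibre E p \<times> fibre F p),
    fidx = fidx E <+> fidx F,
    frames = {(U \<inter> V, case_sum (\<lambda>i p. (e i p, 0)) (\<lambda>j p. (0, e' j p))) | U e V e'.
                (U, e) \<in> frames E \<and> (V, e') \<in> frames F}\<rparr>"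

definition tangent_bundle :: "'p manifold \<Rightarrow> ('p, nat, 'p tvec) vbundle"
  where "tangent_bundle M = \<lparr>
    fibre = tangent_space M,
    fidx = {..<mdim M},
    frames = {(fst c, coord_vec M c) | c. c \<in> atlas M}\<rparr>"

definition form_bundle :: "'p manifold \<Rightarrow> nat \<Rightarrow> ('p, nat list, 'p form) vbundle"
  where "form_bundle M n = \<lparr>
    fibre = (\<lambda>p. alt_forms (tangent_space M p) n),
    fidx = {I. length I = n \<and> sorted_wrt (<) I \<and> set I \<subseteq> {..<mdim M}},
    frames = {(fst c, coord_form M c) | c. c \<in> atlas M}\<rparr>"


section \<open>Operations on vector fields and forms\<close>

definition lie_bracket ::
    "'p manifold \<Rightarrow> ('p \<Rightarrow> 'p tvec) \<Rightarrow> ('p \<Rightarrow> 'p tvec) \<Rightarrow> 'p \<Rightarrow> 'p tvec"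
  where "lie_bracket M X Y p =
    (\<lambda>f. if smooth_near M p f then X p (\<lambda>q. Y q f) - Y p (\<lambda>q. X q f) else 0)"

definition int_prod :: "('p \<Rightarrow> 'p tvec) \<Rightarrow> ('p \<Rightarrow> 'p form) \<Rightarrow> 'p \<Rightarrow> 'p form"
  where "int_prod X \<omega> p = (\<lambda>vs. \<omega> p (X p # vs))"

definition chart_at :: "'p manifold \<Rightarrow> 'p \<Rightarrow> 'p chart"
  where "chart_at M p = (SOME c. c \<in> atlas M \<and> p \<in> fst c)"

text \<open>The extension of a tangent vector \<open>v\<close> at \<open>p\<close> to the vector field with constant coefficients
  in a chart around \<open>p\<close> (meaningful at points \<open>q\<close> of the domain of this chart).\<close>

definition coord_ext :: "'p manifold \<Rightarrow> 'p \<Rightarrow> 'p tvec \<Rightarrow> 'p \<Rightarrow> 'p tvec"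
  where "coord_ext M p v q =
    (\<Sum>i<mdim M. v (\<lambda>r. snd (chart_at M p) r i) *\<^sub>R coord_vec M (chart_at M p) i q)"

text \<open>With \<open>V\<^sub>i\<close> the constant coefficient extension of \<open>v\<^sub>i\<close>,
  \<open>d\<omega> (v\<^sub>0, \<dots>, v\<^sub>k) = \<Sum>\<^sub>i (-1)\<^sup>i v\<^sub>i (\<omega> (V\<^sub>0, \<dots>, V\<^sub>k))\<close>, where \<open>V\<^sub>i\<close> is omitted in the \<open>i\<close>-th term. This is the
  coordinate formula \<open>d (\<Sum>\<^sub>I \<omega>\<^sub>I dx\<^sup>I) = \<Sum>\<^sub>I d\<omega>\<^sub>I \<and> dx\<^sup>I\<close> evaluated at \<open>v\<^sub>0, \<dots>, v\<^sub>k\<close>; the bracket terms of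
  the invariant formula vanish because the \<open>V\<^sub>i\<close> commute. The value does not depend on the chart.\<close>

definition ext_deriv :: "'p manifold \<Rightarrow> ('p \<Rightarrow> 'p form) \<Rightarrow> 'p \<Rightarrow> 'p form"
  where "ext_deriv M \<omega> p vs =
    (if set vs \<subseteq> tangent_space M p
     then \<Sum>i<length vs. (-1) ^ i *
            (vs ! i) (\<lambda>q. \<omega> q (map (\<lambda>v. coord_ext M p v q) (take i vs @ drop (Suc i) vs)))
     else 0)"

text \<open>The formula
  \<open>(L\<^sub>X \<omega>) (V\<^sub>1, \<dots>, V\<^sub>k) = X (\<omega> (V\<^sub>1, \<dots>, V\<^sub>k)) - \<Sum>\<^sub>j \<omega> (V\<^sub>1, \<dots>, [X, V\<^sub>j], \<dots>, V\<^sub>k)\<close>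
  at \<open>p\<close>, for the constant coefficient extensions \<open>V\<^sub>j\<close> of tangent vectors at \<open>p\<close>. The right-hand
  side is tensorial in the \<open>V\<^sub>j\<close>, so that the choice of the extensions does not matter.\<close>

definition lie_deriv ::
    "'p manifold \<Rightarrow> ('p \<Rightarrow> 'p tvec) \<Rightarrow> ('p \<Rightarrow> 'p form) \<Rightarrow> 'p \<Rightarrow> 'p form"
  where "lie_deriv M X \<omega> p vs =
    (if set vs \<subseteq> tangent_space M p
     then X p (\<lambda>q. \<omega> q (map (\<lambda>v. coord_ext M p v q) vs)) -
          (\<Sum>j<length vs. \<omega> p (vs[j := lie_bracket M X (coord_ext M p (vs ! j)) p]))
     else 0)"

definition zero_form :: "('p \<Rightarrow> real) \<Rightarrow> 'p \<Rightarrow> 'p form"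
  where "zero_form f p vs = (if vs = [] then f p else 0)"


section \<open>Leibniz algebroids\<close>

definition fmult :: "('p \<Rightarrow> real) \<Rightarrow> ('p \<Rightarrow> 'v::real_vector) \<Rightarrow> 'p \<Rightarrow> 'v"
  where "fmult f s = (\<lambda>p. f p *\<^sub>R s p)"

definition vf_apply :: "('p \<Rightarrow> 'p tvec) \<Rightarrow> ('p \<Rightarrow> real) \<Rightarrow> 'p \<Rightarrow> real"
  where "vf_apply X f = (\<lambda>p. X p f)"

definition on_sections :: "('p \<Rightarrow> 'v \<Rightarrow> 'w) \<Rightarrow> ('p \<Rightarrow> 'v) \<Rightarrow> 'p \<Rightarrow> 'w"
  where "on_sections \<rho> s = (\<lambda>p. \<rho> p (s p))"

definition leibniz_algebra ::
    "'a::real_vector set \<Rightarrow> ('a \<Rightarrow> 'a \<Rightarrow> 'a) \<Rightarrow> bool"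
  where "leibniz_algebra A br \<longleftrightarrow>
    subspace A \<and>
    (\<forall>a\<in>A. \<forall>b\<in>A. br a b \<in> A) \<and>
    (\<forall>a\<in>A. \<forall>b\<in>A. \<forall>c\<in>A. br (a + b) c = br a c + br b c \<and> br a (b + c) = br a b + br a c) \<and>
    (\<forall>r. \<forall>a\<in>A. \<forall>b\<in>A. br (r *\<^sub>R a) b = r *\<^sub>R br a b \<and> br a (r *\<^sub>R b) = r *\<^sub>R br a b) \<and>
    (\<forall>a\<in>A. \<forall>b\<in>A. \<forall>c\<in>A. br a (br b c) = br (br a b) c + br b (br a c))"

definition leibniz_algebroid ::
    "'p manifold \<Rightarrow> ('p, 'i, 'v::real_vector) vbundle \<Rightarrow>
      (('p \<Rightarrow> 'v) \<Rightarrow> ('p \<Rightarrow> 'v) \<Rightarrow> 'p \<Rightarrow> 'v) \<Rightarrow> ('p \<Rightarrow> 'v \<Rightarrow> 'p tvec) \<Rightarrow> bool"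
  where "leibniz_algebroid M E br \<rho> \<longleftrightarrow>
    vector_bundle M E \<and>
    leibniz_algebra (sections M E) br \<and>
    bundle_morphism M E (tangent_bundle M) \<rho> \<and>
    (\<forall>a\<in>sections M E. \<forall>b\<in>sections M E. \<forall>p\<in>topspace (mtop M).
       on_sections \<rho> (br a b) p = lie_bracket M (on_sections \<rho> a) (on_sections \<rho> b) p) \<and>
    (\<forall>a\<in>sections M E. \<forall>b\<in>sections M E. \<forall>f\<in>smooth_functions M. \<forall>p\<in>topspace (mtop M).
       br a (fmult f b) p =
         (fmult f (br a b) + fmult (vf_apply (on_sections \<rho> a) f) b) p)"


section \<open>The bundle \<open>TM \<oplus> \<Lambda>\<^sup>n T\<^sup>*M\<close>\<close>

definition higher_bundle ::
    "'p manifold \<Rightarrow> nat \<Rightarrow> ('p, nat + nat list, 'p tvec \<times> 'p form) vbundle"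
  where "higher_bundle M n = bundle_sum (tangent_bundle M) (form_bundle M n)"

definition anchor :: "'p \<Rightarrow> 'p tvec \<times> 'p form \<Rightarrow> 'p tvec"
  where "anchor p x = fst x"

abbreviation vf_part :: "('p \<Rightarrow> 'p tvec \<times> 'p form) \<Rightarrow> 'p \<Rightarrow> 'p tvec"
  where "vf_part \<equiv> on_sections anchor"

definition form_part :: "('p \<Rightarrow> 'p tvec \<times> 'p form) \<Rightarrow> 'p \<Rightarrow> 'p form"
  where "form_part e = (\<lambda>p. snd (e p))"

definition form_section :: "('p \<Rightarrow> 'p form) \<Rightarrow> 'p \<Rightarrow> 'p tvec \<times> 'p form"
  where "form_section \<omega> = (\<lambda>p. (0, \<omega> p))"

definition pairing ::
    "('p \<Rightarrow> 'p tvec \<times> 'p form) \<Rightarrow> ('p \<Rightarrow> 'p tvec \<times> 'p form) \<Rightarrow> 'p \<Rightarrow> 'p form"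
  where "pairing e\<^sub>1 e\<^sub>2 =
    (1/2) *\<^sub>R (int_prod (vf_part e\<^sub>1) (form_part e\<^sub>2) + int_prod (vf_part e\<^sub>2) (form_part e\<^sub>1))"

definition dorfman ::
    "'p manifold \<Rightarrow> ('p \<Rightarrow> 'p tvec \<times> 'p form) \<Rightarrow> ('p \<Rightarrow> 'p tvec \<times> 'p form) \<Rightarrow>
      'p \<Rightarrow> 'p tvec \<times> 'p form"
  where "dorfman M e\<^sub>1 e\<^sub>2 = (\<lambda>p.
    (lie_bracket M (vf_part e\<^sub>1) (vf_part e\<^sub>2) p,
     (lie_deriv M (vf_part e\<^sub>1) (form_part e\<^sub>2) - lie_deriv M (vf_part e\<^sub>2) (form_part e\<^sub>1)
      + ext_deriv M (int_prod (vf_part e\<^sub>2) (form_part e\<^sub>1))) p))"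

end

theory Submission
  imports Defs
begin

text \<open>By Hadamard's lemma the coordinate fields of a chart are a basis of each tangent space; since a
  bracket of coordinate fields annihilates the coordinates, they commute. The Lie derivative and the
  exterior derivative, which are defined by constant coefficient extensions in some chart, are tensorial
  and can therefore be evaluated on arbitrary vector fields, \<open>d\<close> through Cartan's recursion
  \<open>i\<^sub>X d = L\<^sub>X - d i\<^sub>X\<close>. Contraction with vector fields and induction on the degree give
  \<open>[L\<^sub>X, L\<^sub>Y] = L\<^bsub>[X,Y]\<^esub>\<close>, \<open>[L\<^sub>X, d] = 0\<close> and \<open>d\<^sup>2 = 0\<close>. The form component of the bracket of
  \<open>X + \<alpha>\<close> and \<open>Y + \<beta>\<close> is \<open>L\<^sub>X \<beta> - i\<^sub>Y d\<alpha>\<close>, and all claims follow from these commutation rules.\<close>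


section \<open>Calculus on open subsets of Euclidean space\<close>

text \<open>\<open>lie_deriv\<close> and \<open>ext_deriv\<close> at a point use the chart that
  \<open>chart_at\<close> selects there, and this selection may jump from point to point; neither
  smoothness of the result nor a second derivative can therefore be read off the definitions. The
  obstacle is removed by \<open>LL\<close> and \<open>dd\<close>, chart-free formulas that act on
  lists of local fields and depend smoothly on the point. Tensoriality shows that only the values of
  the fields at the point matter, so coordinate extensions may be exchanged for any other fields.
  Identities are then proved after contraction with a field that exists only near the point; this is
  why fields and forms are set up over arbitrary open sets and why the inductions on the degree
  generalise over the open set. Degree -1 is not represented: contraction lowers the degree by
  truncated subtraction, and contractions of functions are zero.\<close>

lemma openin_Euclidean_space_iff:
  "openin (Euclidean_space m) U \<longleftrightarrow> (\<exists>T. open T \<and> U = T \<inter> {x. \<forall>i\<ge>m. x i = 0})"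
  by (simp add: Euclidean_space_def openin_subtopology euclidean_product_topology open_openin[symmetric])

text \<open>A basic open set of the product topology restricts each coordinate separately. Only the
  first \<open>m\<close> coordinates vary in the model space, so finitely many radii matter and
  their minimum serves as \<open>\<delta>\<close>.\<close>

lemma openin_Euclidean_space_box:
  assumes "openin (Euclidean_space m) U" "x \<in> U"
  obtains \<delta> where "\<delta> > 0"
    "\<And>y. (\<forall>i\<ge>m. y i = 0) \<Longrightarrow> (\<forall>i<m. \<bar>y i - x i\<bar> < \<delta>) \<Longrightarrow> y \<in> U"
proof -
  obtain T where T: "open T" "U = T \<inter> {x. \<forall>i\<ge>m. x i = 0}"
    using assms(1) openin_Euclidean_space_iff by blast
  have "openin (powertop_real UNIV) T"
    using T(1) by (simp add: euclidean_product_topology open_openin[symmetric])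
  then obtain X where X: "x \<in> (\<Pi>\<^sub>E i\<in>UNIV. X i)" "\<And>i. openin euclideanreal (X i)"
      "(\<Pi>\<^sub>E i\<in>UNIV. X i) \<subseteq> T"
    using product_topology_open_contains_basis[of "\<lambda>_. euclideanreal" UNIV T x] assms(2) T(2)
    by auto
  have "\<exists>d>0. ball (x i) d \<subseteq> X i" for i
    using X(1,2) by (simp add: PiE_iff open_contains_ball)
  then obtain d where d: "\<And>i. d i > 0" "\<And>i. ball (x i) (d i) \<subseteq> X i"
    by metis
  \<comment> \<open>Inserting 1 keeps the minimum meaningful for \<open>m = 0\<close>.\<close>
  define \<delta> where "\<delta> = Min (insert 1 (d ` {..<m}))"
  have "\<delta> > 0" unfolding \<delta>_def using d(1) by (subst Min_gr_iff) auto
  moreover have "y \<in> U" if y: "\<forall>i\<ge>m. y i = 0" "\<forall>i<m. \<bar>y i - x i\<bar> < \<delta>" for y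
  proof -
    have "y i \<in> X i" for i
    proof (cases "i < m")
      case True
      then have "\<delta> \<le> d i" unfolding \<delta>_def by (intro Min_le) auto
      then have "y i \<in> ball (x i) (d i)"
        using y(2) True by (fastforce simp: dist_real_def abs_minus_commute)
      then show ?thesis using d(2) by blast
    next
      case False
      then have "y i = x i" using y(1) assms(2) T(2) by auto
      then show ?thesis using X(1) by auto
    qed
    then show ?thesis using X(3) y(1) T(2) by (auto simp: PiE_iff)
  qed
  ultimately show ?thesis using that by blast
qed

lemma openin_Euclidean_space_subset:
  assumes "openin (Euclidean_space m) U" "x \<in> U" "i \<ge> m"
  shows "x i = 0"
  using assms openin_subset topspace_Euclidean_space by fastforce

text \<open>The preimage of a ball is open in the model space, so the previous box lemma turns
  continuity into an estimate in the first \<open>m\<close> coordinates.\<close>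

lemma continuous_on_box:
  fixes g :: "(nat \<Rightarrow> real) \<Rightarrow> real"
  assumes "openin (Euclidean_space m) U" "x \<in> U" "continuous_on U g" "\<epsilon> > 0"
  obtains \<delta> where "\<delta> > 0"
    "\<And>y. (\<forall>i\<ge>m. y i = 0) \<Longrightarrow> (\<forall>i<m. \<bar>y i - x i\<bar> < \<delta>) \<Longrightarrow> y \<in> U \<and> \<bar>g y - g x\<bar> < \<epsilon>"
proof -
  have "\<forall>B. open B \<longrightarrow> (\<exists>A. open A \<and> A \<inter> U = g -` B \<inter> U)"
    using assms(3) unfolding continuous_on_open_invariant .
  then obtain A where A: "open A" "A \<inter> U = g -` ball (g x) \<epsilon> \<inter> U"
    using open_ball[of "g x" \<epsilon>] by (elim allE[of _ "ball (g x) \<epsilon>"]) auto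
  have "openin (Euclidean_space m) (A \<inter> U)"
  proof -
    obtain T where "open T" "U = T \<inter> {x. \<forall>i\<ge>m. x i = 0}"
      using assms(1) openin_Euclidean_space_iff by blast
    then show ?thesis unfolding openin_Euclidean_space_iff using A(1)
      by (intro exI[of _ "A \<inter> T"]) auto
  qed
  moreover have "x \<in> A \<inter> U" using A(2) assms by auto
  ultimately obtain \<delta> where "\<delta> > 0"
    "\<And>y. (\<forall>i\<ge>m. y i = 0) \<Longrightarrow> (\<forall>i<m. \<bar>y i - x i\<bar> < \<delta>) \<Longrightarrow> y \<in> A \<inter> U"
    using openin_Euclidean_space_box by blast
  then show ?thesis using that A(2) by (auto simp: dist_real_def abs_minus_commute)
qed

text \<open>For \<open>i < m\<close> the coordinate line through \<open>x\<close> stays in the model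
  space, hence in \<open>U\<close> for a short time. Derivatives along it thus depend on the
  function on \<open>U\<close> alone.\<close>

lemma fun_upd_box_nhds:
  assumes "openin (Euclidean_space m) U" "x \<in> U" "i < m"
  shows "\<forall>\<^sub>F t in nhds (x i). x(i := t) \<in> U"
proof -
  obtain \<delta> where "\<delta> > 0"
    and \<delta>: "\<And>y. (\<forall>i\<ge>m. y i = 0) \<Longrightarrow> (\<forall>i<m. \<bar>y i - x i\<bar> < \<delta>) \<Longrightarrow> y \<in> U"
    using openin_Euclidean_space_box assms by blast
  have "x(i := t) \<in> U" if "dist t (x i) < \<delta>" for t
    using that assms openin_Euclidean_space_subset[OF assms(1,2)] \<open>\<delta> > 0\<close>
    by (intro \<delta>) (auto simp: dist_real_def)
  then show ?thesis unfolding eventually_nhds_metric using \<open>\<delta> > 0\<close> by blast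
qed

lemma partial_cong:
  assumes "openin (Euclidean_space m) U" "x \<in> U" "i < m" "\<And>y. y \<in> U \<Longrightarrow> f y = g y"
  shows "partial i f x = partial i g x"
  unfolding partial_def
proof (rule deriv_cong_ev)
  show "\<forall>\<^sub>F t in nhds (x i). f (x(i := t)) = g (x(i := t))"
    using fun_upd_box_nhds[OF assms(1-3)] by eventually_elim (use assms(4) in auto)
qed simp

lemma slice_differentiable_cong:
  assumes "openin (Euclidean_space m) U" "x \<in> U" "i < m" "\<And>y. y \<in> U \<Longrightarrow> f y = g y"
    and "(\<lambda>t. f (x(i := t))) differentiable (at (x i))"
  shows "(\<lambda>t. g (x(i := t))) differentiable (at (x i))"
proof -
  obtain D where D: "((\<lambda>t. f (x(i := t))) has_derivative D) (at (x i))"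
    using assms(5) unfolding differentiable_def by blast
  have "\<forall>\<^sub>F t in nhds (x i). f (x(i := t)) = g (x(i := t))"
    using fun_upd_box_nhds[OF assms(1-3)] by eventually_elim (use assms(4) in auto)
  then have "((\<lambda>t. g (x(i := t))) has_derivative D) (at (x i))"
    using has_derivative_transform_eventually[OF D, of "\<lambda>t. g (x(i := t))"]
    by (simp add: eventually_nhds_conv_at)
  then show ?thesis unfolding differentiable_def by blast
qed

lemma Ck_on_continuous: "Ck_on m k U f \<Longrightarrow> continuous_on U f"
  by (cases k) auto

lemma Ck_on_cong:
  assumes "openin (Euclidean_space m) U" "\<And>y. y \<in> U \<Longrightarrow> f y = g y" "Ck_on m k U f"
  shows "Ck_on m k U g"
  using assms(2,3)
proof (induction k arbitrary: f g)
  case 0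
  then show ?case using continuous_on_cong[of U U f g] by simp
next
  case (Suc k)
  have "continuous_on U g" using Suc.prems continuous_on_cong[of U U f g] by simp
  moreover have "Ck_on m k U (partial i g)" if "i < m" for i
  proof (rule Suc.IH)
    show "partial i f y = partial i g y" if "y \<in> U" for y
      using Suc.prems(1) by (rule partial_cong[OF assms(1) that \<open>i < m\<close>])
    show "Ck_on m k U (partial i f)" using Suc.prems(2) that by simp
  qed
  ultimately show ?case
    using Suc.prems(2) slice_differentiable_cong[OF assms(1), of _ _ f g] Suc.prems(1)
    unfolding Ck_on.simps by metis
qed

lemma Ck_on_subset:
  assumes "V \<subseteq> U" "Ck_on m k U f"
  shows "Ck_on m k V f"
  using assms by (induction k arbitrary: f) (auto intro: continuous_on_subset)

lemma Ck_on_Suc: "Ck_on m (Suc k) U f \<Longrightarrow> Ck_on m k U f"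
  by (induction k arbitrary: f) auto

lemma Ck_on_local:
  assumes "openin (Euclidean_space m) U"
    "\<And>x. x \<in> U \<Longrightarrow> \<exists>V. openin (Euclidean_space m) V \<and> x \<in> V \<and> V \<subseteq> U \<and> Ck_on m k V f"
  shows "Ck_on m k U f"
  using assms(2)
proof (induction k arbitrary: f)
  case 0
  have "continuous (at x within U) f" if x: "x \<in> U" for x
  proof -
    obtain V where V: "openin (Euclidean_space m) V" "x \<in> V" "V \<subseteq> U" "continuous_on V f"
      using 0[OF x] by auto
    obtain T where T: "open T" "V = T \<inter> {x. \<forall>i\<ge>m. x i = 0}"
      using V(1) openin_Euclidean_space_iff by blast
    \<comment> \<open>\<open>V\<close> is the trace of the ambient open set \<open>T\<close> on the
      model space, so limits at \<open>x\<close> within \<open>V\<close> and within \<open>U\<close>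
      agree.\<close>
    have "T \<inter> U = V"
      using V(3) T(2) openin_Euclidean_space_subset[OF assms(1)] by auto
    then have "at x within U = at x within V"
      using at_within_nhd[of x T U V] T V by auto
    then show ?thesis using V(2,4) by (simp add: continuous_on_eq_continuous_within)
  qed
  then show ?case by (simp add: continuous_on_eq_continuous_within)
next
  case (Suc k)
  have "Ck_on m k U f"
  proof (rule Suc.IH)
    fix x assume "x \<in> U"
    from Suc.prems[OF this]
    show "\<exists>V. openin (Euclidean_space m) V \<and> x \<in> V \<and> V \<subseteq> U \<and> Ck_on m k V f"
      using Ck_on_Suc by (elim ex_forward) simp
  qed
  moreover have "Ck_on m k U (partial i f)" if "i < m" for i
  proof (rule Suc.IH)
    fix x assume "x \<in> U"
    from Suc.prems[OF this] that
    show "\<exists>V. openin (Euclidean_space m) V \<and> x \<in> V \<and> V \<subseteq> U \<and> Ck_on m k V (partial i f)"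
      by auto
  qed
  moreover have "(\<lambda>t. f (x(i := t))) differentiable (at (x i))" if "i < m" "x \<in> U" for i x
    using Suc.prems[OF that(2)] that by auto
  ultimately show ?case using Ck_on_continuous unfolding Ck_on.simps by blast
qed

section \<open>Closure properties of continuously differentiable functions\<close>

lemma has_field_derivative_partial:
  assumes "(\<lambda>t. f (x(i := t))) differentiable (at (x i))"
  shows "((\<lambda>t. f (x(i := t))) has_real_derivative partial i f x) (at (x i))"
  using assms unfolding partial_def
  by (simp add: DERIV_deriv_iff_real_differentiable)

lemma Ck_on_has_partial:
  assumes "Ck_on m (Suc k) U f" "x \<in> U" "i < m"
  shows "((\<lambda>t. f (x(i := t))) has_real_derivative partial i f x) (at (x i))"
  using assms by (intro has_field_derivative_partial) auto

text \<open>The partial derivatives are exhibited as \<open>D\<close>, so that the closure proofs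
  can work with derivative rules instead of evaluating \<open>deriv\<close>.\<close>

lemma Ck_on_SucI:
  assumes "openin (Euclidean_space m) U" "continuous_on U f"
    "\<And>i x. i < m \<Longrightarrow> x \<in> U \<Longrightarrow> ((\<lambda>t. f (x(i := t))) has_real_derivative D i x) (at (x i))"
    "\<And>i. i < m \<Longrightarrow> Ck_on m k U (D i)"
  shows "Ck_on m (Suc k) U f"
proof -
  have "partial i f x = D i x" if "i < m" "x \<in> U" for i x
    unfolding partial_def using assms(3)[OF that] DERIV_imp_deriv by blast
  then have "Ck_on m k U (partial i f)" if "i < m" for i
    using assms(4)[OF that] that Ck_on_cong[OF assms(1), of "D i" "partial i f"] by auto
  then show ?thesis
    using assms(2,3) unfolding Ck_on.simps real_differentiable_def by blast
qed

lemma Ck_on_const: "openin (Euclidean_space m) U \<Longrightarrow> Ck_on m k U (\<lambda>_. c)"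
proof (induction k arbitrary: c)
  case (Suc k)
  then show ?case by (intro Ck_on_SucI[where D="\<lambda>_ _. 0"]) auto
qed auto

lemma Ck_on_coord:
  assumes "openin (Euclidean_space m) U"
  shows "Ck_on m k U (\<lambda>x. x j)"
proof (cases k)
  case 0
  then show ?thesis by (auto intro: continuous_on_product_coordinates continuous_on_subset)
next
  case (Suc k')
  have "continuous_on U (\<lambda>x::nat\<Rightarrow>real. x j)"
    by (auto intro: continuous_on_product_coordinates continuous_on_subset)
  moreover have "((\<lambda>t. (x(i := t)) j) has_real_derivative (if i = j then 1 else 0)) (at (x i))"
    for i and x :: "nat \<Rightarrow> real"
    by (cases "i = j") auto
  ultimately show ?thesis unfolding Suc
    using assms by (intro Ck_on_SucI[where D="\<lambda>i _. if i = j then 1 else 0"])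
      (auto intro: Ck_on_const)
qed

lemma Ck_on_add:
  assumes "openin (Euclidean_space m) U"
  shows "Ck_on m k U f \<Longrightarrow> Ck_on m k U g \<Longrightarrow> Ck_on m k U (\<lambda>x. f x + g x)"
proof (induction k arbitrary: f g)
  case (Suc k)
  then show ?case
    by (intro Ck_on_SucI[where D="\<lambda>i x. partial i f x + partial i g x"] assms DERIV_add
        Ck_on_has_partial[OF Suc.prems(1)] Ck_on_has_partial[OF Suc.prems(2)] continuous_on_add)
      simp_all
qed (auto intro: continuous_intros)

lemma Ck_on_mult:
  assumes "openin (Euclidean_space m) U"
  shows "Ck_on m k U f \<Longrightarrow> Ck_on m k U g \<Longrightarrow> Ck_on m k U (\<lambda>x. f x * g x)"
proof (induction k arbitrary: f g)
  case (Suc k)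
  have "Ck_on m k U f" "Ck_on m k U g" using Suc.prems Ck_on_Suc by auto
  moreover have "((\<lambda>t. f (x(i := t)) * g (x(i := t))) has_real_derivative
      f x * partial i g x + partial i f x * g x) (at (x i))" if "i < m" "x \<in> U" for i x
    using DERIV_mult'[OF Ck_on_has_partial[OF Suc.prems(1) that(2,1)]
        Ck_on_has_partial[OF Suc.prems(2) that(2,1)]] unfolding fun_upd_triv .
  ultimately show ?case using Suc
    by (intro Ck_on_SucI[where D="\<lambda>i x. f x * partial i g x + partial i f x * g x"] assms
        Ck_on_add[OF assms] continuous_on_mult) (simp_all del: fun_upd_apply)
qed (auto intro: continuous_intros)

lemma Ck_on_sum:
  assumes "openin (Euclidean_space m) U" "\<And>i. i \<in> I \<Longrightarrow> Ck_on m k U (f i)"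
  shows "Ck_on m k U (\<lambda>x. \<Sum>i\<in>I. f i x)"
  using assms(2) by (induction I rule: infinite_finite_induct)
    (auto intro: Ck_on_const Ck_on_add assms(1))

text \<open>The increment is split into increments in the coordinate directions, to which the mean value
  theorem applies.\<close>

lemma increment_telescope:
  assumes "openin (Euclidean_space m) U" "x \<in> U" "Ck_on m (Suc 0) U f"
  obtains \<delta> where "\<delta> > 0"
    "\<And>y. (\<forall>i\<ge>m. y i = 0) \<Longrightarrow> (\<forall>i<m. \<bar>y i - x i\<bar> < \<delta>) \<Longrightarrow>
      \<exists>\<xi>. (\<forall>i<m. (\<forall>j\<ge>m. \<xi> i j = 0) \<and> (\<forall>j<m. \<bar>\<xi> i j - x j\<bar> \<le> \<bar>y j - x j\<bar>)) \<and>
        f y - f x = (\<Sum>i<m. partial i f (\<xi> i) * (y i - x i))"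
proof -
  obtain \<delta> where "\<delta> > 0"
    and \<delta>: "\<And>y. (\<forall>i\<ge>m. y i = 0) \<Longrightarrow> (\<forall>i<m. \<bar>y i - x i\<bar> < \<delta>) \<Longrightarrow> y \<in> U"
    using openin_Euclidean_space_box assms by blast
  have x0: "x i = 0" if "i \<ge> m" for i
    using openin_Euclidean_space_subset[OF assms(1,2)] that by blast
  have "\<exists>\<xi>. (\<forall>i<m. (\<forall>j\<ge>m. \<xi> i j = 0) \<and> (\<forall>j<m. \<bar>\<xi> i j - x j\<bar> \<le> \<bar>y j - x j\<bar>)) \<and>
        f y - f x = (\<Sum>i<m. partial i f (\<xi> i) * (y i - x i))"
    if y: "\<forall>i\<ge>m. y i = 0" "\<forall>i<m. \<bar>y i - x i\<bar> < \<delta>" for y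
  proof -
    \<comment> \<open>In \<open>z k\<close> the first \<open>k\<close> coordinates have already been
      moved from \<open>x\<close> to \<open>y\<close>.\<close>
    define z where "z k = (\<lambda>j. if j < k then y j else x j)" for k
    have z_Suc: "z (Suc k) = (z k)(k := y k)" for k
      by (auto simp: z_def fun_eq_iff less_Suc_eq)
    have step: "\<exists>w. \<bar>w - x i\<bar> \<le> \<bar>y i - x i\<bar> \<and>
        f (z (Suc i)) - f (z i) = partial i f ((z i)(i := w)) * (y i - x i)" if i: "i < m" for i
    proof -
      define g where "g t = f ((z i)(i := t))" for t
      have der: "(g has_real_derivative partial i f ((z i)(i := t))) (at t)"
        if t: "\<bar>t - x i\<bar> \<le> \<bar>y i - x i\<bar>" for t
      proof -
        have "(z i)(i := t) \<in> U"
        proof (rule \<delta>)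
          show "\<forall>ia\<ge>m. ((z i)(i := t)) ia = 0" using x0 y i by (auto simp: z_def)
          show "\<forall>ia<m. \<bar>((z i)(i := t)) ia - x ia\<bar> < \<delta>"
            using y(2) i t \<open>\<delta> > 0\<close> by (auto simp: z_def intro: le_less_trans)
        qed
        from Ck_on_has_partial[OF assms(3) this i] show ?thesis by (simp add: g_def[abs_def])
      qed
      have zx: "z i = (z i)(i := x i)" by (auto simp: z_def)
      have e: "f (z (Suc i)) - f (z i) = g (y i) - g (x i)"
        unfolding g_def z_Suc using zx by simp
      \<comment> \<open>The mean value theorem needs a proper interval, so the sign of the increment
        is distinguished; for increment 0 any point serves.\<close>
      consider "x i < y i" | "x i = y i" | "y i < x i" by linarith
      then show ?thesis
      proof cases
        case 1
        obtain w where "x i < w" "w < y i"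
          "g (y i) - g (x i) = (y i - x i) * partial i f ((z i)(i := w))"
          using MVT2[OF 1, of g "\<lambda>t. partial i f ((z i)(i := t))"] der by force
        then show ?thesis unfolding e by (intro exI[of _ w]) (auto simp: mult.commute)
      next
        case 2
        then show ?thesis unfolding e by (intro exI[of _ "x i"]) auto
      next
        case 3
        obtain w where "y i < w" "w < x i"
          "g (x i) - g (y i) = (x i - y i) * partial i f ((z i)(i := w))"
          using MVT2[OF 3, of g "\<lambda>t. partial i f ((z i)(i := t))"] der by force
        then show ?thesis unfolding e by (intro exI[of _ w]) (auto simp: algebra_simps)
      qed
    qed
    then obtain w where w: "\<And>i. i < m \<Longrightarrow> \<bar>w i - x i\<bar> \<le> \<bar>y i - x i\<bar>"
      "\<And>i. i < m \<Longrightarrow> f (z (Suc i)) - f (z i) = partial i f ((z i)(i := w i)) * (y i - x i)"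
      by metis
    have "z m = y" "z 0 = x" using y(1) x0 by (auto simp: z_def fun_eq_iff not_less)
    then have "f y - f x = (\<Sum>i<m. f (z (Suc i)) - f (z i))"
      using sum_lessThan_telescope[of "\<lambda>i. f (z i)" m] by simp
    also have "\<dots> = (\<Sum>i<m. partial i f ((z i)(i := w i)) * (y i - x i))"
      using w(2) by (intro sum.cong) auto
    finally show ?thesis
      using w(1) y(1) x0 by (intro exI[of _ "\<lambda>i. (z i)(i := w i)"]) (auto simp: z_def)
  qed
  then show ?thesis using that \<open>\<delta> > 0\<close> by blast
qed

text \<open>The telescoped increment turns the difference quotient into a sum of partial derivatives
  at intermediate points times difference quotients of the coordinates. The intermediate points are
  squeezed towards \<open>\<gamma> t0\<close>, and the partial derivatives are continuous
  there.\<close>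

lemma chain_rule_curve:
  assumes U: "openin (Euclidean_space m) U" and f: "Ck_on m (Suc 0) U f"
    and \<gamma>: "\<forall>\<^sub>F t in nhds t0. \<gamma> t \<in> U"
    and d: "\<And>i. i < m \<Longrightarrow> ((\<lambda>t. \<gamma> t i) has_real_derivative D i) (at t0)"
  shows "((\<lambda>t. f (\<gamma> t)) has_real_derivative (\<Sum>i<m. partial i f (\<gamma> t0) * D i)) (at t0)"
proof -
  define x where "x = \<gamma> t0"
  have xU: "x \<in> U" using \<gamma> eventually_nhds_x_imp_x x_def by blast
  have near: "\<forall>\<^sub>F t in at t0. (\<forall>i\<ge>m. \<gamma> t i = 0) \<and> (\<forall>i<m. \<bar>\<gamma> t i - x i\<bar> < \<delta>)" if "\<delta> > 0" for \<delta>
  proof -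
    have "\<forall>\<^sub>F t in at t0. \<bar>\<gamma> t i - x i\<bar> < \<delta>" if "i < m" for i
    proof -
      have "((\<lambda>t. \<gamma> t i) \<longlongrightarrow> x i) (at t0)"
        using DERIV_isCont[OF d[OF that]] unfolding isCont_def x_def .
      from tendstoD[OF this \<open>\<delta> > 0\<close>] show ?thesis by (simp add: dist_real_def)
    qed
    then have "\<forall>\<^sub>F t in at t0. \<forall>i\<in>{..<m}. \<bar>\<gamma> t i - x i\<bar> < \<delta>"
      by (simp add: eventually_ball_finite)
    moreover have "\<forall>\<^sub>F t in at t0. \<gamma> t \<in> U" using \<gamma> by (simp add: eventually_nhds_conv_at)
    ultimately show ?thesis
      by eventually_elim (use openin_Euclidean_space_subset[OF U] in auto)
  qed
  obtain \<delta>\<^sub>0 where "\<delta>\<^sub>0 > 0" and \<delta>\<^sub>0: "\<And>y. (\<forall>i\<ge>m. y i = 0) \<Longrightarrow> (\<forall>i<m. \<bar>y i - x i\<bar> < \<delta>\<^sub>0) \<Longrightarrow>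
      \<exists>\<xi>. (\<forall>i<m. (\<forall>j\<ge>m. \<xi> i j = 0) \<and> (\<forall>j<m. \<bar>\<xi> i j - x j\<bar> \<le> \<bar>y j - x j\<bar>)) \<and>
        f y - f x = (\<Sum>i<m. partial i f (\<xi> i) * (y i - x i))"
    using increment_telescope[OF U xU f] by blast
  \<comment> \<open>On admissible end points the intermediate points can be chosen as a function of
    \<open>y\<close>, which may then be composed with the curve.\<close>
  define good where "good y \<longleftrightarrow> (\<forall>i\<ge>m. y i = 0) \<and> (\<forall>i<m. \<bar>y i - x i\<bar> < \<delta>\<^sub>0)" for y
  have "\<exists>\<xi>. \<forall>y\<in>Collect good. (\<forall>i<m. (\<forall>j\<ge>m. \<xi> y i j = 0) \<and> (\<forall>j<m. \<bar>\<xi> y i j - x j\<bar> \<le> \<bar>y j - x j\<bar>)) \<and>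
      f y - f x = (\<Sum>i<m. partial i f (\<xi> y i) * (y i - x i))"
    by (rule bchoice) (use \<delta>\<^sub>0 good_def in blast)
  then obtain \<xi> where \<xi>: "\<And>y. good y \<Longrightarrow> \<forall>i<m. (\<forall>j\<ge>m. \<xi> y i j = 0) \<and> (\<forall>j<m. \<bar>\<xi> y i j - x j\<bar> \<le> \<bar>y j - x j\<bar>)"
      "\<And>y. good y \<Longrightarrow> f y - f x = (\<Sum>i<m. partial i f (\<xi> y i) * (y i - x i))"
    by blast
  have lim: "((\<lambda>t. partial i f (\<xi> (\<gamma> t) i)) \<longlongrightarrow> partial i f x) (at t0)" if i: "i < m" for i
  proof (rule tendstoI)
    fix e :: real assume "e > 0"
    have "continuous_on U (partial i f)" using f i by simp
    then obtain \<delta> where "\<delta> > 0" and \<delta>: "\<And>y. (\<forall>i\<ge>m. y i = 0) \<Longrightarrow> (\<forall>i<m. \<bar>y i - x i\<bar> < \<delta>) \<Longrightarrow>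
        y \<in> U \<and> \<bar>partial i f y - partial i f x\<bar> < e"
      using continuous_on_box[OF U xU _ \<open>e > 0\<close>] by metis
    show "\<forall>\<^sub>F t in at t0. dist (partial i f (\<xi> (\<gamma> t) i)) (partial i f x) < e"
      using near[OF \<open>\<delta>\<^sub>0 > 0\<close>] near[OF \<open>\<delta> > 0\<close>]
    proof eventually_elim
      case (elim t)
      then have "good (\<gamma> t)" by (simp add: good_def)
      then show ?case
      proof -
        have "\<forall>j<m. \<bar>\<xi> (\<gamma> t) i j - x j\<bar> < \<delta>"
          using \<xi>(1)[OF \<open>good (\<gamma> t)\<close>] elim(2) i by (meson le_less_trans)
        then show ?thesis
          using \<delta>[of "\<xi> (\<gamma> t) i"] \<xi>(1)[OF \<open>good (\<gamma> t)\<close>] i by (simp add: dist_real_def)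
      qed
    qed
  qed
  have "((\<lambda>t. \<Sum>i<m. partial i f (\<xi> (\<gamma> t) i) * ((\<gamma> t i - \<gamma> t0 i) / (t - t0))) \<longlongrightarrow>
      (\<Sum>i<m. partial i f x * D i)) (at t0)"
    using d lim by (intro tendsto_sum tendsto_mult) (auto simp: has_field_derivative_iff)
  moreover have "\<forall>\<^sub>F t in at t0. (\<Sum>i<m. partial i f (\<xi> (\<gamma> t) i) * ((\<gamma> t i - \<gamma> t0 i) / (t - t0))) =
      (f (\<gamma> t) - f (\<gamma> t0)) / (t - t0)"
    using near[OF \<open>\<delta>\<^sub>0 > 0\<close>]
  proof eventually_elim
    case (elim t)
    then have "good (\<gamma> t)" by (simp add: good_def)
    from \<xi>(2)[OF this] show ?case by (simp add: x_def sum_divide_distrib)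
  qed
  ultimately show ?thesis
    unfolding has_field_derivative_iff x_def[symmetric] by (rule Lim_transform_eventually)
qed

text \<open>By the chain rule the partial derivatives of the composite are sums of products of
  functions to which the induction hypothesis for the smaller order applies.\<close>

lemma Ck_on_compose:
  assumes U: "openin (Euclidean_space m) U" and V: "openin (Euclidean_space l) V"
    and sub: "G ` V \<subseteq> U" and G: "\<And>i. i < m \<Longrightarrow> Ck_on l k V (\<lambda>y. G y i)"
    and f: "Ck_on m k U f"
  shows "Ck_on l k V (\<lambda>y. f (G y))"
  using f G
proof (induction k arbitrary: f)
  case cont: 0
  have "continuous_on V (\<lambda>y. G y i)" for i
  proof (cases "i < m")
    case True
    then show ?thesis using cont(2)[OF True] by simp
  next
    \<comment> \<open>The coordinates of \<open>G\<close> from \<open>m\<close> on are constantly 0,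
      because \<open>G\<close> maps into the model space.\<close>
    case False
    then have "\<And>y. y \<in> V \<Longrightarrow> G y i = 0" using openin_Euclidean_space_subset[OF U] sub by auto
    then show ?thesis by (metis (no_types, lifting) continuous_on_cong continuous_on_const)
  qed
  then have "continuous_on V G" by (rule continuous_on_coordinatewise_then_product)
  then show ?case using cont(1) sub continuous_on_compose2 by force
next
  case (Suc k)
  have k: "Ck_on l k V (\<lambda>y. f (G y))" using Suc by (meson Ck_on_Suc)
  have f1: "Ck_on m (Suc 0) U f"
    using Suc.prems(1) by (auto intro: Ck_on_continuous)
  show ?case
  proof (rule Ck_on_SucI[where D="\<lambda>j y. \<Sum>i<m. partial i f (G y) * partial j (\<lambda>y. G y i) y"])
    show "openin (Euclidean_space l) V" by (rule V)
    show "continuous_on V (\<lambda>y. f (G y))" using k by (rule Ck_on_continuous)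
    fix j assume j: "j < l"
    show "Ck_on l k V (\<lambda>y. \<Sum>i<m. partial i f (G y) * partial j (\<lambda>y. G y i) y)"
    proof (intro Ck_on_sum Ck_on_mult V)
      fix i assume "i \<in> {..<m}"
      then have i: "i < m" by simp
      show "Ck_on l k V (\<lambda>y. partial i f (G y))"
      proof (rule Suc.IH)
        show "Ck_on m k U (partial i f)" using Suc.prems(1) i by simp
        show "Ck_on l k V (\<lambda>y. G y i)" if "i < m" for i using Ck_on_Suc[OF Suc.prems(2)[OF that]] .
      qed
      show "Ck_on l k V (partial j (\<lambda>y. G y i))"
        using Suc.prems(2)[OF i] j by simp
    qed
    fix y assume y: "y \<in> V"
    have "\<forall>\<^sub>F t in nhds (y j). G (y(j := t)) \<in> U"
      using fun_upd_box_nhds[OF V y j] by eventually_elim (use sub in auto)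
    moreover have "((\<lambda>t. G (y(j := t)) i) has_real_derivative partial j (\<lambda>y. G y i) y) (at (y j))"
      if "i < m" for i
      using Ck_on_has_partial[OF Suc.prems(2)[OF that] y j] .
    ultimately show "((\<lambda>t. f (G (y(j := t)))) has_real_derivative
        (\<Sum>i<m. partial i f (G y) * partial j (\<lambda>y. G y i) y)) (at (y j))"
      using chain_rule_curve[OF U f1, of "\<lambda>t. G (y(j := t))" "y j"] by simp
  qed
qed

section \<open>Hadamard's lemma by integration along segments\<close>

definition box_nhd :: "nat \<Rightarrow> (nat \<Rightarrow> real) \<Rightarrow> real \<Rightarrow> (nat \<Rightarrow> real) set"
  where "box_nhd m a e = {y. (\<forall>i\<ge>m. y i = 0) \<and> (\<forall>i<m. \<bar>y i - a i\<bar> < e)}"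

lemma openin_box_nhd: "openin (Euclidean_space m) (box_nhd m a e)"
proof -
  have "open (\<Inter>i<m. {y::nat\<Rightarrow>real. \<bar>y i - a i\<bar> < e})"
    by (intro open_INT ballI finite_lessThan open_Collect_less continuous_intros
        continuous_on_product_coordinates)
  moreover have "box_nhd m a e = (\<Inter>i<m. {y. \<bar>y i - a i\<bar> < e}) \<inter> {y. \<forall>i\<ge>m. y i = 0}"
    by (auto simp: box_nhd_def)
  ultimately show ?thesis unfolding openin_Euclidean_space_iff by blast
qed

definition segment_point :: "(nat \<Rightarrow> real) \<Rightarrow> real \<Rightarrow> (nat \<Rightarrow> real) \<Rightarrow> nat \<Rightarrow> real"
  where "segment_point a t y = (\<lambda>i. a i + t * (y i - a i))"

text \<open>A box is star-shaped about its centre; a general open set is not, and the integrals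
  below run along segments from the centre.\<close>

lemma segment_point_in_box:
  assumes "\<forall>i\<ge>m. a i = 0" "y \<in> box_nhd m a e" "t \<in> {0..1}"
  shows "segment_point a t y \<in> box_nhd m a e"
proof -
  have "\<bar>t * (y i - a i)\<bar> \<le> \<bar>y i - a i\<bar>" for i
    using assms(3) by (simp add: abs_mult mult_left_le_one_le)
  then show ?thesis
    using assms(1,2) unfolding box_nhd_def segment_point_def
    by (auto intro: le_less_trans[OF \<open>\<And>i. \<bar>t * (y i - a i)\<bar> \<le> \<bar>y i - a i\<bar>\<close>])
qed

lemma continuous_on_segment_point:
  assumes a: "\<forall>i\<ge>m. a i = 0" and F: "continuous_on (box_nhd m a e) F"
  shows "continuous_on (box_nhd m a e \<times> {0..1}) (\<lambda>(y, t). t ^ r * (F (segment_point a t y) :: real))"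
proof -
  have "continuous_on A (\<lambda>p::(nat \<Rightarrow> real) \<times> real. fst p i)" for i A
    by (rule continuous_on_compose2[OF continuous_on_product_coordinates[of i]])
      (auto intro: continuous_intros)
  then have "continuous_on A (\<lambda>p::(nat \<Rightarrow> real) \<times> real. segment_point a (snd p) (fst p))" for A
    unfolding segment_point_def
    by (intro continuous_on_coordinatewise_then_product continuous_intros)
  then have "continuous_on (box_nhd m a e \<times> {0..1}) (\<lambda>p. F (segment_point a (snd p) (fst p)))"
    by (rule continuous_on_compose2[OF F]) (use segment_point_in_box[OF a] in auto)
  then show ?thesis unfolding split_beta by (intro continuous_intros)
qed

text \<open>The weight \<open>t ^ r\<close> closes the statement under differentiation: each partial
  derivative in \<open>y\<close> brings out one factor \<open>t\<close> of the segment, so the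
  derivative is an integral of the same kind with exponent \<open>Suc r\<close>.\<close>

lemma Ck_on_segment_integral:
  assumes a: "\<forall>i\<ge>m. a i = 0" and F: "Ck_on m k (box_nhd m a e) F"
  shows "Ck_on m k (box_nhd m a e) (\<lambda>y. integral {0..1} (\<lambda>t. t ^ r * F (segment_point a t y)))"
proof -
  have cont: "continuous_on (box_nhd m a e) (\<lambda>y. integral {0..1} (\<lambda>t. t ^ r * F (segment_point a t y)))"
    if "continuous_on (box_nhd m a e) F" for F r
    using integral_continuous_on_param[of "box_nhd m a e" 0 "1::real"
        "\<lambda>y t. t ^ r * F (segment_point a t y)"] continuous_on_segment_point[OF a that, of r]
    unfolding cbox_interval by simp
  show ?thesis using F
  proof (induction k arbitrary: F r)
    case 0
    then show ?case using cont by simp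
  next
    case (Suc k)
    show ?case
    proof (rule Ck_on_SucI[where
          D="\<lambda>i y. integral {0..1} (\<lambda>t. t ^ Suc r * partial i F (segment_point a t y))"])
      show "openin (Euclidean_space m) (box_nhd m a e)" by (rule openin_box_nhd)
      show "continuous_on (box_nhd m a e) (\<lambda>y. integral {0..1} (\<lambda>t. t ^ r * F (segment_point a t y)))"
        using Suc.prems Ck_on_continuous by (blast intro: cont)
      fix i assume i: "i < m"
      show "Ck_on m k (box_nhd m a e) (\<lambda>y. integral {0..1} (\<lambda>t. t ^ Suc r * partial i F (segment_point a t y)))"
        using Suc.prems i by (intro Suc.IH) simp
      fix y assume y: "y \<in> box_nhd m a e"
      \<comment> \<open>The range of the \<open>i\<close>-th coordinate in the box. It is convex, as
        the Leibniz rule for parameter integrals requires, and open, so the derivative within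
        \<open>J\<close> is the full derivative.\<close>
      define J where "J = {a i - e <..< a i + e}"
      have yJ: "y(i := u) \<in> box_nhd m a e" if "u \<in> J" for u
        using y i that unfolding box_nhd_def J_def by auto
      have der: "((\<lambda>u. t ^ r * F (segment_point a t (y(i := u)))) has_field_derivative
          t ^ Suc r * partial i F (segment_point a t (y(i := u)))) (at u within J)"
        if u: "u \<in> J" and t: "t \<in> cbox 0 1" for u t
      proof -
        define P where "P = segment_point a t (y(i := u))"
        have "P \<in> box_nhd m a e"
          unfolding P_def using segment_point_in_box[OF a yJ[OF u]] t by simp
        then have "((\<lambda>w. F (P(i := w))) has_real_derivative partial i F P) (at (P i))"
          using Ck_on_has_partial[OF Suc.prems _ i] by blast
        moreover have "P i = a i + t * (u - a i)" by (simp add: P_def segment_point_def)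
        ultimately have "((\<lambda>w. F (P(i := w))) has_real_derivative partial i F P)
            (at (a i + t * (u - a i)))" by simp
        moreover have "((\<lambda>u. a i + t * (u - a i)) has_real_derivative t) (at u within J)"
          by (auto intro!: derivative_eq_intros)
        ultimately have "((\<lambda>u. F (P(i := a i + t * (u - a i)))) has_real_derivative partial i F P * t)
            (at u within J)"
          by (rule DERIV_chain2)
        moreover have "P(i := a i + t * (u' - a i)) = segment_point a t (y(i := u'))" for u'
          by (auto simp: P_def segment_point_def fun_eq_iff)
        ultimately have "((\<lambda>u. F (segment_point a t (y(i := u)))) has_real_derivative partial i F P * t)
            (at u within J)" by simp
        from DERIV_cmult[OF this, of "t ^ r"] show ?thesis by (simp add: P_def mult_ac)
      qed
      have c: "continuous_on (J \<times> cbox 0 1) (\<lambda>(u, t). t ^ s * G (segment_point a t (y(i := u))))"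
        if "continuous_on (box_nhd m a e) G" for G s
      proof -
        have "continuous_on (J \<times> cbox 0 1) (\<lambda>p::real\<times>real. (y(i := fst p), snd p))"
        proof (intro continuous_on_Pair continuous_on_coordinatewise_then_product)
          show "continuous_on (J \<times> cbox 0 1) (\<lambda>p::real\<times>real. (y(i := fst p)) j)" for j
            by (cases "j = i") (auto intro!: continuous_intros)
        qed (intro continuous_intros)
        then have "continuous_on (J \<times> cbox 0 1)
            (\<lambda>p::real\<times>real. (\<lambda>(y, t). t ^ s * G (segment_point a t y)) (y(i := fst p), snd p))"
          by (rule continuous_on_compose2[OF continuous_on_segment_point[OF a that]])
            (use yJ in auto)
        then show ?thesis by (simp add: split_beta)
      qed
      have "(\<lambda>t. t ^ r * F (segment_point a t (y(i := u)))) integrable_on cbox 0 1" if "u \<in> J" for u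
      proof (rule integrable_continuous)
        have "continuous_on (cbox 0 1) (\<lambda>t::real. (u, t))" by (intro continuous_intros)
        then have "continuous_on (cbox 0 1) (\<lambda>t. (\<lambda>(u, t). t ^ r * F (segment_point a t (y(i := u)))) (u, t))"
          by (rule continuous_on_compose2[OF c[OF Ck_on_continuous[OF Suc.prems]]])
            (use that in auto)
        then show "continuous_on (cbox 0 1) (\<lambda>t. t ^ r * F (segment_point a t (y(i := u))))" by simp
      qed
      moreover have "continuous_on (box_nhd m a e) (partial i F)"
        using Suc.prems i by (auto intro: Ck_on_continuous)
      moreover have "y i \<in> J"
        using y i unfolding J_def box_nhd_def by (auto simp: abs_diff_less_iff)
      ultimately have "((\<lambda>u. integral (cbox 0 1) (\<lambda>t. t ^ r * F (segment_point a t (y(i := u)))))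
          has_field_derivative
          integral (cbox 0 1) (\<lambda>t. t ^ Suc r * partial i F (segment_point a t (y(i := y i)))))
          (at (y i) within J)"
        using leibniz_rule_field_derivative[of J 0 1 "\<lambda>u t. t ^ r * F (segment_point a t (y(i := u)))"
            "\<lambda>u t. t ^ Suc r * partial i F (segment_point a t (y(i := u)))" "y i"] der
          c[of "partial i F" "Suc r"] unfolding J_def by (meson convex_real_interval(8))
      then show "((\<lambda>t. integral {0..1} (\<lambda>s. s ^ r * F (segment_point a s (y(i := t)))))
          has_real_derivative integral {0..1} (\<lambda>t. t ^ Suc r * partial i F (segment_point a t y)))
          (at (y i))"
        using \<open>y i \<in> J\<close> at_within_open[of "y i" J] unfolding fun_upd_triv cbox_interval
        by (simp add: J_def)
    qed
  qed
qed

text \<open>The coefficient \<open>g i\<close> is the average of the \<open>i\<close>-th partial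
  derivative over the segment from \<open>a\<close> to \<open>y\<close>. The fundamental theorem of
  calculus along the segment gives the formula, differentiation under the integral the
  smoothness.\<close>

lemma Hadamard:
  assumes U: "openin (Euclidean_space m) U" and aU: "a \<in> U" and f: "smooth_on m U f"
  obtains B g where "openin (Euclidean_space m) B" "a \<in> B" "B \<subseteq> U"
    "\<And>i. i < m \<Longrightarrow> smooth_on m B (g i)"
    "\<And>y. y \<in> B \<Longrightarrow> f y = f a + (\<Sum>i<m. (y i - a i) * g i y)"
proof -
  obtain e where "e > 0" and e: "\<And>y. (\<forall>i\<ge>m. y i = 0) \<Longrightarrow> (\<forall>i<m. \<bar>y i - a i\<bar> < e) \<Longrightarrow> y \<in> U"
    using openin_Euclidean_space_box[OF U aU] by blast
  define B where "B = box_nhd m a e"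
  have BU: "B \<subseteq> U" using e unfolding B_def box_nhd_def by auto
  have a: "\<forall>i\<ge>m. a i = 0" using openin_Euclidean_space_subset[OF U aU] by blast
  have aB: "a \<in> B" using a \<open>e > 0\<close> by (simp add: B_def box_nhd_def)
  have fB: "Ck_on m k B f" for k
    using f BU unfolding smooth_on_def by (blast intro: Ck_on_subset)
  have pfB: "Ck_on m k B (partial i f)" if "i < m" for i k
    using fB[of "Suc k"] that by simp
  \<comment> \<open>The factor \<open>t ^ 0\<close> brings the integrand into the shape of
    \<open>Ck_on_segment_integral\<close>.\<close>
  define g where "g i y = integral {0..1} (\<lambda>t. t ^ 0 * partial i f (segment_point a t y))" for i y
  have "smooth_on m B (g i)" if "i < m" for i
    unfolding smooth_on_def g_def B_def
    using Ck_on_segment_integral[OF a] pfB[OF that] B_def by blast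
  moreover have "f y = f a + (\<Sum>i<m. (y i - a i) * g i y)" if y: "y \<in> B" for y
  proof -
    have "((\<lambda>t. f (segment_point a t y)) has_real_derivative
        (\<Sum>i<m. partial i f (segment_point a t y) * (y i - a i))) (at t)" if t: "t \<in> {0..1}" for t
    proof (rule chain_rule_curve[OF _ fB])
      show "openin (Euclidean_space m) B" unfolding B_def by (rule openin_box_nhd)
      \<comment> \<open>The chain rule asks for a full neighbourhood of \<open>t\<close>, also at
        the ends 0 and 1: there the parameter leaves the unit interval, but the curve stays in the
        open box for a while.\<close>
      have tB: "segment_point a t y \<in> B"
        using segment_point_in_box[OF a _ t] y unfolding B_def by blast
      have "\<forall>\<^sub>F s in nhds t. \<bar>segment_point a s y i - a i\<bar> < e" if "i < m" for i
      proof -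
        have "isCont (\<lambda>s. \<bar>segment_point a s y i - a i\<bar>) t"
          unfolding segment_point_def by (intro continuous_intros)
        then have "((\<lambda>s. \<bar>segment_point a s y i - a i\<bar>) \<longlongrightarrow> \<bar>segment_point a t y i - a i\<bar>) (nhds t)"
          using tendsto_at_iff_tendsto_nhds[of "\<lambda>s. \<bar>segment_point a s y i - a i\<bar>" t]
          by (simp add: isCont_def)
        moreover have "\<bar>segment_point a t y i - a i\<bar> < e" using tB that by (simp add: B_def box_nhd_def)
        ultimately show ?thesis using order_tendstoD(2) by blast
      qed
      then have "\<forall>\<^sub>F s in nhds t. \<forall>i\<in>{..<m}. \<bar>segment_point a s y i - a i\<bar> < e"
        by (simp add: eventually_ball_finite)
      then show "\<forall>\<^sub>F s in nhds t. segment_point a s y \<in> B"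
        by eventually_elim (use y a in \<open>auto simp: B_def box_nhd_def segment_point_def\<close>)
      show "((\<lambda>t. segment_point a t y i) has_real_derivative y i - a i) (at t)" for i
        unfolding segment_point_def by (auto intro!: derivative_eq_intros)
    qed
    \<comment> \<open>\<open>I1\<close> and \<open>I2\<close> evaluate one integral twice, by the
      fundamental theorem and term by term.\<close>
    then have I1: "((\<lambda>t. \<Sum>i<m. partial i f (segment_point a t y) * (y i - a i)) has_integral
        f (segment_point a 1 y) - f (segment_point a 0 y)) {0..1}"
      by (intro fundamental_theorem_of_calculus)
        (auto simp flip: has_real_derivative_iff_has_vector_derivative
          intro: has_field_derivative_at_within)
    have I2: "((\<lambda>t. \<Sum>i<m. partial i f (segment_point a t y) * (y i - a i)) has_integral
        (\<Sum>i<m. g i y * (y i - a i))) {0..1}"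
    proof (intro has_integral_sum has_integral_mult_left finite_lessThan)
      fix i assume "i \<in> {..<m}"
      then have "continuous_on B (partial i f)" using pfB[of i 0] by simp
      then have "continuous_on (B \<times> {0..1}) (\<lambda>(y, t). t ^ 0 * partial i f (segment_point a t y))"
        unfolding B_def by (rule continuous_on_segment_point[OF a])
      moreover have "continuous_on {0..1} (\<lambda>t::real. (y, t))" by (intro continuous_intros)
      ultimately have "continuous_on {0..1::real} (\<lambda>t. (\<lambda>(y, t). t ^ 0 * partial i f (segment_point a t y)) (y, t))"
        by (rule continuous_on_compose2) (use y in auto)
      then have "continuous_on {0..1::real} (\<lambda>t. partial i f (segment_point a t y))" by simp
      from integrable_integral[OF integrable_continuous_real[OF this]]
      show "((\<lambda>t. partial i f (segment_point a t y)) has_integral g i y) {0..1}"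
        by (simp add: g_def)
    qed
    have "segment_point a 1 y = y" "segment_point a 0 y = a"
      by (auto simp: segment_point_def)
    with has_integral_unique[OF I1 I2] have "f y - f a = (\<Sum>i<m. g i y * (y i - a i))"
      by simp
    also have "\<dots> = (\<Sum>i<m. (y i - a i) * g i y)" by (simp add: mult.commute)
    finally show ?thesis by linarith
  qed
  ultimately show ?thesis
    using that[of B g] openin_box_nhd aB BU unfolding B_def by blast
qed

section \<open>Smooth functions on open subsets of the model space\<close>

lemma smooth_on_partial:
  assumes "smooth_on m U f" "i < m"
  shows "smooth_on m U (partial i f)"
  unfolding smooth_on_def
proof
  fix k
  have "Ck_on m (Suc k) U f" using assms(1) smooth_on_def by blast
  then show "Ck_on m k U (partial i f)" using assms(2) by simp
qed

lemma smooth_on_has_partial: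
  assumes "smooth_on m U f" "x \<in> U" "i < m"
  shows "((\<lambda>t. f (x(i := t))) has_real_derivative partial i f x) (at (x i))"
  using assms Ck_on_has_partial unfolding smooth_on_def by blast

lemma smooth_on_cong:
  assumes "openin (Euclidean_space m) U" "\<And>y. y \<in> U \<Longrightarrow> f y = g y" "smooth_on m U f"
  shows "smooth_on m U g"
  using assms(3) Ck_on_cong[OF assms(1), of f g] assms(2) unfolding smooth_on_def by blast

lemma smooth_on_subset: "V \<subseteq> U \<Longrightarrow> smooth_on m U f \<Longrightarrow> smooth_on m V f"
  unfolding smooth_on_def by (blast intro: Ck_on_subset)

lemma smooth_on_local:
  assumes "openin (Euclidean_space m) U"
    "\<And>x. x \<in> U \<Longrightarrow> \<exists>V. openin (Euclidean_space m) V \<and> x \<in> V \<and> V \<subseteq> U \<and> smooth_on m V f"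
  shows "smooth_on m U f"
  unfolding smooth_on_def
proof
  fix k show "Ck_on m k U f"
    using assms(2) by (intro Ck_on_local[OF assms(1)]) (meson smooth_on_def)
qed

lemma smooth_on_compose:
  assumes "openin (Euclidean_space m) U" "openin (Euclidean_space l) V"
    "G ` V \<subseteq> U" "\<And>i. i < m \<Longrightarrow> smooth_on l V (\<lambda>y. G y i)" "smooth_on m U f"
  shows "smooth_on l V (\<lambda>y. f (G y))"
  using Ck_on_compose[OF assms(1-3)] assms(4,5) unfolding smooth_on_def by blast

lemma sum_fun_apply: "(\<Sum>i\<in>I. f i) x = (\<Sum>i\<in>I. f i x)"
  by (induction I rule: infinite_finite_induct) auto


section \<open>Smooth functions on a manifold\<close>

locale smooth_mfd =
  fixes M :: "'p manifold"
  assumes M: "smooth_manifold M"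
begin

abbreviation opn :: "'p set \<Rightarrow> bool" where "opn \<equiv> openin (mtop M)"
abbreviation T :: "'p \<Rightarrow> 'p tvec set" where "T \<equiv> tangent_space M"
abbreviation C :: "'p set \<Rightarrow> ('p \<Rightarrow> real) \<Rightarrow> bool" where "C \<equiv> smooth_fun_on M"
abbreviation E :: "(nat \<Rightarrow> real) topology" where "E \<equiv> Euclidean_space (mdim M)"

lemma chart_open: "(U, \<phi>) \<in> atlas M \<Longrightarrow> opn U"
  and chart_hom: "(U, \<phi>) \<in> atlas M \<Longrightarrow> homeomorphic_map (subtopology (mtop M) U) (subtopology E (\<phi> ` U)) \<phi>"
  and chart_image_open': "(U, \<phi>) \<in> atlas M \<Longrightarrow> openin E (\<phi> ` U)"
  and chart_transition: "(U, \<phi>) \<in> atlas M \<Longrightarrow> (V, \<psi>) \<in> atlas M \<Longrightarrow> i < mdim M \<Longrightarrow>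
    smooth_on (mdim M) (\<phi> ` (U \<inter> V)) (\<lambda>x. \<psi> (inv_into U \<phi> x) i)"
  and chart_cover: "(\<Union>(U, \<phi>)\<in>atlas M. U) = topspace (mtop M)"
  using M unfolding smooth_manifold_def by blast+

lemma chart_subset: "(U, \<phi>) \<in> atlas M \<Longrightarrow> U \<subseteq> topspace (mtop M)"
  using chart_open openin_subset by blast

lemma chart_inj: "(U, \<phi>) \<in> atlas M \<Longrightarrow> inj_on \<phi> U"
  using homeomorphic_imp_injective_map[OF chart_hom] chart_subset
  by (metis inf.absorb_iff2 topspace_subtopology)

lemma chart_image_open:
  assumes "(U, \<phi>) \<in> atlas M" "opn W"
  shows "openin E (\<phi> ` (U \<inter> W))"
proof -
  have "openin (subtopology (mtop M) U) (U \<inter> W)"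
    using assms chart_open openin_open_subtopology by blast
  then have "openin (subtopology E (\<phi> ` U)) (\<phi> ` (U \<inter> W))"
    using homeomorphic_imp_open_map[OF chart_hom[OF assms(1)]] unfolding open_map_def by blast
  then show ?thesis
    using openin_open_subtopology[OF chart_image_open'[OF assms(1)]] by blast
qed

lemma chart_preimage_open:
  assumes "(U, \<phi>) \<in> atlas M" "openin E V"
  shows "opn {q \<in> U. \<phi> q \<in> V}"
proof -
  have "openin (subtopology E (\<phi> ` U)) (\<phi> ` U \<inter> V)"
    using openin_open_subtopology[OF chart_image_open'[OF assms(1)]] assms
      chart_image_open' by blast
  from openin_continuous_map_preimage[OF homeomorphic_imp_continuous_map[OF chart_hom[OF assms(1)]] this]
  have "openin (subtopology (mtop M) U) {q \<in> topspace (mtop M) \<inter> U. \<phi> q \<in> \<phi> ` U \<inter> V}"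
    by simp
  moreover have "{q \<in> topspace (mtop M) \<inter> U. \<phi> q \<in> \<phi> ` U \<inter> V} = {q \<in> U. \<phi> q \<in> V}"
    using chart_subset[OF assms(1)] by auto
  ultimately show ?thesis
    using openin_open_subtopology[OF chart_open[OF assms(1)]] by simp
qed

lemma chart_around:
  assumes "q \<in> topspace (mtop M)"
  obtains U \<phi> where "(U, \<phi>) \<in> atlas M" "q \<in> U"
proof -
  have "q \<in> (\<Union>(U, \<phi>)\<in>atlas M. U)" using assms unfolding chart_cover .
  then obtain c where "c \<in> atlas M" "q \<in> fst c" by (auto simp: case_prod_beta)
  then show ?thesis using that[of "fst c" "snd c"] by simp
qed

text \<open>In any other chart the representative of \<open>f\<close> is the given one composed with
  a transition map. On subsets of its domain a single chart therefore decides smoothness.\<close>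

lemma C_chartI:
  assumes c: "(U, \<phi>) \<in> atlas M" and W: "opn W" "W \<subseteq> U"
    and f: "smooth_on (mdim M) (\<phi> ` W) (f \<circ> inv_into U \<phi>)"
  shows "C W f"
  unfolding smooth_fun_on_def
proof clarify
  fix V \<psi> assume d: "(V, \<psi>) \<in> atlas M"
  have o1: "openin E (\<phi> ` W)" using chart_image_open[OF c W(1)] W(2) by (simp add: Int_absorb1)
  have o2: "openin E (\<psi> ` (V \<inter> W))" using chart_image_open[OF d W(1)] .
  have inv: "inv_into V \<psi> (\<psi> q) = q" if "q \<in> V" for q
    using chart_inj[OF d] that by simp
  have inv': "inv_into U \<phi> (\<phi> q) = q" if "q \<in> U" for q
    using chart_inj[OF c] that by simp
  have "smooth_on (mdim M) (\<psi> ` (V \<inter> W)) (\<lambda>y. (f \<circ> inv_into U \<phi>) (\<phi> (inv_into V \<psi> y)))"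
  proof (rule smooth_on_compose[OF o1 o2 _ _ f])
    show "(\<lambda>y. \<phi> (inv_into V \<psi> y)) ` \<psi> ` (V \<inter> W) \<subseteq> \<phi> ` W" using inv by auto
    show "smooth_on (mdim M) (\<psi> ` (V \<inter> W)) (\<lambda>y. \<phi> (inv_into V \<psi> y) i)" if "i < mdim M" for i
      using chart_transition[OF d c that] by (rule smooth_on_subset[rotated]) (use W(2) in auto)
  qed
  then show "smooth_on (mdim M) (\<psi> ` (V \<inter> W)) (f \<circ> inv_into V \<psi>)"
    by (rule smooth_on_cong[OF o2, rotated]) (use inv inv' W(2) in auto)
qed

lemma C_chartD:
  assumes "(U, \<phi>) \<in> atlas M" "C W f" "W \<subseteq> U"
  shows "smooth_on (mdim M) (\<phi> ` W) (f \<circ> inv_into U \<phi>)"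
proof -
  have "smooth_on (mdim M) (\<phi> ` (U \<inter> W)) (f \<circ> inv_into U \<phi>)"
    using assms(1,2) unfolding smooth_fun_on_def by blast
  then show ?thesis using assms(3) by (simp add: Int_absorb1)
qed

lemma C_subset: "W' \<subseteq> W \<Longrightarrow> C W f \<Longrightarrow> C W' f"
  unfolding smooth_fun_on_def by (fastforce intro: smooth_on_subset[rotated])

lemma C_cong:
  assumes W: "opn W" "\<And>q. q \<in> W \<Longrightarrow> f q = g q" and f: "C W f"
  shows "C W g"
  unfolding smooth_fun_on_def
proof clarify
  fix U \<phi> assume c: "(U, \<phi>) \<in> atlas M"
  have "smooth_on (mdim M) (\<phi> ` (U \<inter> W)) (f \<circ> inv_into U \<phi>)"
    using c f unfolding smooth_fun_on_def by blast
  then show "smooth_on (mdim M) (\<phi> ` (U \<inter> W)) (g \<circ> inv_into U \<phi>)"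
    by (rule smooth_on_cong[OF chart_image_open[OF c W(1)], rotated])
      (use W(2) chart_inj[OF c] in auto)
qed

lemma C_local:
  assumes W: "opn W" and f: "\<And>q. q \<in> W \<Longrightarrow> \<exists>W'. opn W' \<and> q \<in> W' \<and> C W' f"
  shows "C W f"
  unfolding smooth_fun_on_def
proof clarify
  fix U \<phi> assume c: "(U, \<phi>) \<in> atlas M"
  show "smooth_on (mdim M) (\<phi> ` (U \<inter> W)) (f \<circ> inv_into U \<phi>)"
  proof (rule smooth_on_local[OF chart_image_open[OF c W]])
    fix x assume "x \<in> \<phi> ` (U \<inter> W)"
    then obtain q where q: "q \<in> U" "q \<in> W" "x = \<phi> q" by blast
    obtain W' where W': "opn W'" "q \<in> W'" "C W' f" using f q by blast
    have "openin E (\<phi> ` (U \<inter> (W' \<inter> W)))"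
      using chart_image_open[OF c] W W' by (simp add: openin_Int)
    moreover have "smooth_on (mdim M) (\<phi> ` (U \<inter> (W' \<inter> W))) (f \<circ> inv_into U \<phi>)"
      using W'(3) c unfolding smooth_fun_on_def by (fastforce intro: smooth_on_subset[rotated])
    ultimately show "\<exists>V. openin E V \<and> x \<in> V \<and> V \<subseteq> \<phi> ` (U \<inter> W) \<and> smooth_on (mdim M) V (f \<circ> inv_into U \<phi>)"
      using q W' by (intro exI[of _ "\<phi> ` (U \<inter> (W' \<inter> W))"]) auto
  qed
qed

lemma C_const: "opn W \<Longrightarrow> C W (\<lambda>_. r)"
  unfolding smooth_fun_on_def smooth_on_def comp_def
  using Ck_on_const chart_image_open by blast

lemma C_add: "opn W \<Longrightarrow> C W f \<Longrightarrow> C W g \<Longrightarrow> C W (\<lambda>q. f q + g q)"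
  unfolding smooth_fun_on_def smooth_on_def comp_def
  using Ck_on_add chart_image_open by fast

lemma C_mult: "opn W \<Longrightarrow> C W f \<Longrightarrow> C W g \<Longrightarrow> C W (\<lambda>q. f q * g q)"
  unfolding smooth_fun_on_def smooth_on_def comp_def
  using Ck_on_mult chart_image_open by fast

lemma C_uminus: "opn W \<Longrightarrow> C W f \<Longrightarrow> C W (\<lambda>q. - f q)"
  using C_mult[OF _ C_const, of W "f" "-1"] by simp

lemma C_diff: "opn W \<Longrightarrow> C W f \<Longrightarrow> C W g \<Longrightarrow> C W (\<lambda>q. f q - g q)"
  using C_add[OF _ _ C_uminus, of W f g] by simp

lemma C_sum: "opn W \<Longrightarrow> (\<And>i. i \<in> I \<Longrightarrow> C W (f i)) \<Longrightarrow> C W (\<lambda>q. \<Sum>i\<in>I. f i q)"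
  by (induction I rule: infinite_finite_induct) (auto intro: C_const C_add)

lemma C_prod: "opn W \<Longrightarrow> (\<And>i. i \<in> I \<Longrightarrow> C W (f i)) \<Longrightarrow> C W (\<lambda>q. \<Prod>i\<in>I. f i q)"
  by (induction I rule: infinite_finite_induct) (auto intro: C_const C_mult)

lemma C_coord:
  assumes c: "(U, \<phi>) \<in> atlas M" and W: "opn W" "W \<subseteq> U"
  shows "C W (\<lambda>q. \<phi> q i)"
proof (rule C_chartI[OF c W])
  have o: "openin E (\<phi> ` W)" using chart_image_open[OF c W(1)] W(2) by (simp add: Int_absorb1)
  have "smooth_on (mdim M) (\<phi> ` W) (\<lambda>x. x i)" using Ck_on_coord[OF o] smooth_on_def by blast
  then show "smooth_on (mdim M) (\<phi> ` W) ((\<lambda>q. \<phi> q i) \<circ> inv_into U \<phi>)"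
    by (rule smooth_on_cong[OF o, rotated]) (use W(2) chart_inj[OF c] in auto)
qed

lemma C_partial:
  assumes c: "(U, \<phi>) \<in> atlas M" and W: "opn W" "W \<subseteq> U" and f: "C W f" and i: "i < mdim M"
  shows "C W (\<lambda>q. partial i (f \<circ> inv_into U \<phi>) (\<phi> q))"
proof (rule C_chartI[OF c W])
  have o: "openin E (\<phi> ` W)" using chart_image_open[OF c W(1)] W(2) by (simp add: Int_absorb1)
  have "smooth_on (mdim M) (\<phi> ` W) (partial i (f \<circ> inv_into U \<phi>))"
    using smooth_on_partial[OF C_chartD[OF c f W(2)] i] .
  then show "smooth_on (mdim M) (\<phi> ` W) ((\<lambda>q. partial i (f \<circ> inv_into U \<phi>) (\<phi> q)) \<circ> inv_into U \<phi>)"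
    by (rule smooth_on_cong[OF o, rotated]) (use W(2) chart_inj[OF c] in auto)
qed

lemma smooth_nearI: "opn W \<Longrightarrow> q \<in> W \<Longrightarrow> C W f \<Longrightarrow> smooth_near M q f"
  unfolding smooth_near_def by blast

lemma smooth_nearE:
  assumes "smooth_near M q f"
  obtains W where "opn W" "q \<in> W" "C W f"
  using assms unfolding smooth_near_def by blast

lemma smooth_near_common:
  assumes "smooth_near M q f" "smooth_near M q g"
  obtains W where "opn W" "q \<in> W" "C W f" "C W g"
proof -
  obtain W1 W2 where "opn W1" "q \<in> W1" "C W1 f" "opn W2" "q \<in> W2" "C W2 g"
    using assms unfolding smooth_near_def by blast
  then show ?thesis
    using that[of "W1 \<inter> W2"] C_subset[of "W1 \<inter> W2" W1 f] C_subset[of "W1 \<inter> W2" W2 g]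
    by (simp add: openin_Int)
qed

lemma smooth_near_topspace: "smooth_near M q f \<Longrightarrow> q \<in> topspace (mtop M)"
  using openin_subset by (blast elim: smooth_nearE)


section \<open>Tangent vectors in coordinates\<close>

text \<open>Two functions smooth near \<open>q\<close> are smooth on a common neighbourhood, so the
  clauses may be checked for functions satisfying \<open>C W\<close> with one \<open>W\<close>, to
  which the closure rules apply.\<close>

lemma tangentI:
  assumes "\<And>f. \<not> smooth_near M q f \<Longrightarrow> v f = 0"
    "\<And>f g W. opn W \<Longrightarrow> q \<in> W \<Longrightarrow> C W f \<Longrightarrow> C W g \<Longrightarrow> (\<And>r. r \<in> W \<Longrightarrow> f r = g r) \<Longrightarrow> v f = v g"
    "\<And>f g W. opn W \<Longrightarrow> q \<in> W \<Longrightarrow> C W f \<Longrightarrow> C W g \<Longrightarrow> v (\<lambda>r. f r + g r) = v f + v g"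
    "\<And>f g W. opn W \<Longrightarrow> q \<in> W \<Longrightarrow> C W f \<Longrightarrow> C W g \<Longrightarrow> v (\<lambda>r. f r * g r) = f q * v g + g q * v f"
    "\<And>c f W. opn W \<Longrightarrow> q \<in> W \<Longrightarrow> C W f \<Longrightarrow> v (\<lambda>r. c * f r) = c * v f"
  shows "v \<in> T q"
proof -
  have h2: "v f = v g" if fg: "smooth_near M q f" "smooth_near M q g"
    and W: "opn W" "q \<in> W" "\<forall>r\<in>W. f r = g r" for f g W
  proof -
    obtain W' where W': "opn W'" "q \<in> W'" "C W' f" "C W' g" using smooth_near_common[OF fg] .
    show ?thesis
      using assms(2)[of "W \<inter> W'" f g] W W' C_subset[of "W \<inter> W'" W'] by (simp add: openin_Int)
  qed
  have h3: "v (\<lambda>r. f r + g r) = v f + v g" "v (\<lambda>r. f r * g r) = f q * v g + g q * v f"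
    if fg: "smooth_near M q f" "smooth_near M q g" for f g
    using smooth_near_common[OF fg] assms(3,4) by metis+
  have h5: "v (\<lambda>r. c * f r) = c * v f" if "smooth_near M q f" for c f
    using smooth_nearE[OF that] assms(5) by metis
  show ?thesis unfolding tangent_space_def
  proof (intro CollectI conjI allI impI, goal_cases)
    case (2 f g)
    then show ?case using h2 by blast
  qed (use assms(1) h3 h5 in blast)+
qed

lemma tan_nonsmooth: "v \<in> T q \<Longrightarrow> \<not> smooth_near M q f \<Longrightarrow> v f = 0"
  unfolding tangent_space_def by blast

lemma tan_outside: "v \<in> T q \<Longrightarrow> q \<notin> topspace (mtop M) \<Longrightarrow> v = 0"
  using tan_nonsmooth smooth_near_topspace by (fastforce simp: fun_eq_iff)

lemma tan_cong:
  assumes "v \<in> T q" "opn W" "q \<in> W" "C W f" "\<And>r. r \<in> W \<Longrightarrow> f r = g r"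
  shows "v f = v g"
proof -
  have "smooth_near M q f" "smooth_near M q g"
    using assms smooth_nearI C_cong[OF assms(2,5,4)] by blast+
  then show ?thesis using assms unfolding tangent_space_def by blast
qed

text \<open>If one of the two functions is smooth near \<open>q\<close>, so is the other, and germs
  decide; if neither is, both values are 0 by convention.\<close>

lemma tan_cong':
  assumes "v \<in> T q" "opn W" "q \<in> W" "\<And>r. r \<in> W \<Longrightarrow> f r = g r"
  shows "v f = v g"
proof (cases "smooth_near M q f \<or> smooth_near M q g")
  case True
  have *: "v f = v g" if f: "smooth_near M q f" and fg: "\<And>r. r \<in> W \<Longrightarrow> f r = g r" for f g
  proof -
    obtain W' where "opn W'" "q \<in> W'" "C W' f" using f by (rule smooth_nearE)
    then show ?thesis
      using tan_cong[OF assms(1), of "W \<inter> W'" f g] assms(2,3) fg C_subset[of "W \<inter> W'" W' f]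
      by (simp add: openin_Int)
  qed
  show ?thesis using True *[of f g] *[of g f] assms(4) by auto
next
  case False
  then show ?thesis using tan_nonsmooth[OF assms(1)] by metis
qed

lemma tan_add: "v \<in> T q \<Longrightarrow> opn W \<Longrightarrow> q \<in> W \<Longrightarrow> C W f \<Longrightarrow> C W g \<Longrightarrow> v (\<lambda>r. f r + g r) = v f + v g"
  and tan_mult: "v \<in> T q \<Longrightarrow> opn W \<Longrightarrow> q \<in> W \<Longrightarrow> C W f \<Longrightarrow> C W g \<Longrightarrow>
    v (\<lambda>r. f r * g r) = f q * v g + g q * v f"
  and tan_cmult: "v \<in> T q \<Longrightarrow> opn W \<Longrightarrow> q \<in> W \<Longrightarrow> C W f \<Longrightarrow> v (\<lambda>r. c * f r) = c * v f"
  using smooth_nearI[of W q f] smooth_nearI[of W q g] unfolding tangent_space_def by blast+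

text \<open>The product rule for \<open>1 = 1 * 1\<close> gives
  \<open>v 1 = 2 * v 1\<close>.\<close>

lemma tan_const:
  assumes "v \<in> T q"
  shows "v (\<lambda>_. c) = 0"
proof (cases "q \<in> topspace (mtop M)")
  case True
  then obtain W where W: "opn W" "q \<in> W" by blast
  have "v (\<lambda>_. 1) = 0" using tan_mult[OF assms W C_const C_const, of 1 1] W by simp
  then show ?thesis using tan_cmult[OF assms W C_const, of c 1] W by simp
next
  case False
  then show ?thesis using tan_outside[OF assms] by simp
qed

lemma tan_uminus: "v \<in> T q \<Longrightarrow> opn W \<Longrightarrow> q \<in> W \<Longrightarrow> C W f \<Longrightarrow> v (\<lambda>r. - f r) = - v f"
  using tan_cmult[of v q W f "-1"] by simp

lemma tan_diff: "v \<in> T q \<Longrightarrow> opn W \<Longrightarrow> q \<in> W \<Longrightarrow> C W f \<Longrightarrow> C W g \<Longrightarrow> v (\<lambda>r. f r - g r) = v f - v g"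
  using tan_add[of v q W f "\<lambda>r. - g r"] tan_uminus[of v q W g] C_uminus by simp

lemma tan_sum:
  assumes "v \<in> T q" "opn W" "q \<in> W" "\<And>i. i \<in> I \<Longrightarrow> C W (f i)"
  shows "v (\<lambda>r. \<Sum>i\<in>I. f i r) = (\<Sum>i\<in>I. v (f i))"
  using assms(4)
proof (induction I rule: infinite_finite_induct)
  case (insert i I)
  then have "C W (\<lambda>r. \<Sum>i\<in>I. f i r)" by (intro C_sum assms(2)) simp
  with insert show ?case using tan_add[OF assms(1-3), of "f i" "\<lambda>r. \<Sum>i\<in>I. f i r"] by simp
qed (auto simp: tan_const[OF assms(1)])

lemma subspace_tangent: "subspace (T q)"
  unfolding subspace_def
proof (intro conjI ballI allI)
  show "0 \<in> T q" by (rule tangentI) auto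
next
  fix v w assume vw: "v \<in> T q" "w \<in> T q"
  show "v + w \<in> T q"
  proof (rule tangentI)
    fix f assume "\<not> smooth_near M q f"
    then show "(v + w) f = 0" using tan_nonsmooth[OF vw(1), of f] tan_nonsmooth[OF vw(2), of f] by simp
  next
    fix f g c W assume W: "opn W" "q \<in> W" and f: "C W f"
    note [simp] = tan_cmult[OF vw(1) W f] tan_cmult[OF vw(2) W f]
    show "(v + w) (\<lambda>r. c * f r) = c * (v + w) f" by (simp add: algebra_simps)
    assume g: "C W g"
    note [simp] = tan_add[OF vw(1) W f g] tan_add[OF vw(2) W f g]
      tan_mult[OF vw(1) W f g] tan_mult[OF vw(2) W f g]
    show "(v + w) (\<lambda>r. f r + g r) = (v + w) f + (v + w) g"
      "(v + w) (\<lambda>r. f r * g r) = f q * (v + w) g + g q * (v + w) f"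
      by (simp_all add: algebra_simps)
    assume "\<And>r. r \<in> W \<Longrightarrow> f r = g r"
    then show "(v + w) f = (v + w) g"
      using tan_cong[OF vw(1) W f, of g] tan_cong[OF vw(2) W f, of g] by simp
  qed
next
  fix c v assume v: "v \<in> T q"
  show "c *\<^sub>R v \<in> T q"
  proof (rule tangentI)
    fix f assume "\<not> smooth_near M q f"
    then show "(c *\<^sub>R v) f = 0" using v tan_nonsmooth by (simp add: scaleR_fun_def)
  next
    fix f g d W assume W: "opn W" "q \<in> W" and f: "C W f"
    show "(c *\<^sub>R v) (\<lambda>r. d * f r) = d * (c *\<^sub>R v) f"
      using tan_cmult[OF v W f, of d] by (simp add: scaleR_fun_def)
    assume g: "C W g"
    show "(c *\<^sub>R v) (\<lambda>r. f r + g r) = (c *\<^sub>R v) f + (c *\<^sub>R v) g"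
      "(c *\<^sub>R v) (\<lambda>r. f r * g r) = f q * (c *\<^sub>R v) g + g q * (c *\<^sub>R v) f"
      using tan_add[OF v W f g] tan_mult[OF v W f g] by (simp_all add: scaleR_fun_def algebra_simps)
    assume "\<And>r. r \<in> W \<Longrightarrow> f r = g r"
    then show "(c *\<^sub>R v) f = (c *\<^sub>R v) g"
      using tan_cong[OF v W f, of g] by (simp add: scaleR_fun_def)
  qed
qed

lemma coord_vec_eq:
  assumes "(U, \<phi>) \<in> atlas M" "opn W" "q \<in> W" "C W f"
  shows "coord_vec M (U, \<phi>) i q f = partial i (f \<circ> inv_into U \<phi>) (\<phi> q)"
  using smooth_nearI[OF assms(2-4)] by (simp add: coord_vec_def)

lemma coord_has_partial:
  assumes c: "(U, \<phi>) \<in> atlas M" and W: "opn W" "q \<in> W" "q \<in> U" "C W f" and i: "i < mdim M"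
  shows "((\<lambda>t. (f \<circ> inv_into U \<phi>) ((\<phi> q)(i := t))) has_real_derivative
    coord_vec M (U, \<phi>) i q f) (at (\<phi> q i))"
proof -
  have "smooth_on (mdim M) (\<phi> ` (U \<inter> W)) (f \<circ> inv_into U \<phi>)"
    using c W(4) unfolding smooth_fun_on_def by blast
  then show ?thesis
    unfolding coord_vec_eq[OF c W(1,2,4)] by (rule smooth_on_has_partial) (use W i in auto)
qed

text \<open>The laws of a derivation are the one-variable differentiation rules along a coordinate
  line, transferred by uniqueness of derivatives.\<close>

lemma coord_vec_tangent:
  assumes c: "(U, \<phi>) \<in> atlas M" and q: "q \<in> U" and i: "i < mdim M"
  shows "coord_vec M (U, \<phi>) i q \<in> T q"
proof (rule tangentI)
  have inv: "inv_into U \<phi> (\<phi> q) = q" using chart_inj[OF c] q by simp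
  note der = coord_has_partial[OF c _ _ q _ i, unfolded comp_def]
  fix f g W c' assume W: "opn W" "q \<in> W" and f: "C W f"
  show "coord_vec M (U, \<phi>) i q (\<lambda>r. c' * f r) = c' * coord_vec M (U, \<phi>) i q f"
    using DERIV_unique[OF der[OF W C_mult[OF W(1) C_const[OF W(1)] f]] DERIV_cmult[OF der[OF W f]]] .
  assume g: "C W g"
  show "coord_vec M (U, \<phi>) i q (\<lambda>r. f r + g r) = coord_vec M (U, \<phi>) i q f + coord_vec M (U, \<phi>) i q g"
    using DERIV_unique[OF der[OF W C_add[OF W(1) f g]] DERIV_add[OF der[OF W f] der[OF W g]]] .
  show "coord_vec M (U, \<phi>) i q (\<lambda>r. f r * g r) = f q * coord_vec M (U, \<phi>) i q g + g q * coord_vec M (U, \<phi>) i q f"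
    using DERIV_unique[OF der[OF W C_mult[OF W(1) f g]] DERIV_mult'[OF der[OF W f] der[OF W g]]]
    by (simp add: inv)
  assume eq: "\<And>r. r \<in> W \<Longrightarrow> f r = g r"
  show "coord_vec M (U, \<phi>) i q f = coord_vec M (U, \<phi>) i q g"
    unfolding coord_vec_eq[OF c W f] coord_vec_eq[OF c W g]
  proof (rule partial_cong[OF chart_image_open[OF c W(1)] _ i])
    show "\<phi> q \<in> \<phi> ` (U \<inter> W)" using q W by blast
    show "(f \<circ> inv_into U \<phi>) y = (g \<circ> inv_into U \<phi>) y" if "y \<in> \<phi> ` (U \<inter> W)" for y
      using that eq chart_inj[OF c] by auto
  qed
qed (auto simp: coord_vec_def)

lemma coord_vec_coord:
  assumes c: "(U, \<phi>) \<in> atlas M" and q: "q \<in> U" and i: "i < mdim M"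
  shows "coord_vec M (U, \<phi>) i q (\<lambda>r. \<phi> r j) = (if i = j then 1 else 0)"
proof -
  have "coord_vec M (U, \<phi>) i q (\<lambda>r. \<phi> r j) = partial i ((\<lambda>r. \<phi> r j) \<circ> inv_into U \<phi>) (\<phi> q)"
    using coord_vec_eq[OF c chart_open[OF c] q C_coord[OF c chart_open[OF c] subset_refl]] .
  also have "\<dots> = partial i (\<lambda>x. x j) (\<phi> q)"
    by (rule partial_cong[OF chart_image_open'[OF c] _ i])
      (use q chart_inj[OF c] in \<open>auto simp: f_inv_into_f\<close>)
  also have "\<dots> = (if i = j then 1 else 0)"
    unfolding partial_def by (cases "i = j") auto
  finally show ?thesis .
qed

text \<open>Near \<open>q\<close> Hadamard's lemma writes \<open>f\<close> as a constant plus a sum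
  of products of \<open>\<phi> r i - \<phi> q i\<close> with smooth factors. A derivation at
  \<open>q\<close> retains only its values on the coordinates, weighted by the factors at
  \<open>q\<close>. The same formula for the coordinate vectors identifies these weights as the
  partial derivatives of \<open>f\<close>.\<close>

lemma tangent_expand:
  assumes c: "(U, \<phi>) \<in> atlas M" and q: "q \<in> U" and v: "v \<in> T q"
  shows "v = (\<Sum>i<mdim M. v (\<lambda>r. \<phi> r i) *\<^sub>R coord_vec M (U, \<phi>) i q)"
proof (rule ext)
  fix f
  have sum_app: "(\<Sum>i<mdim M. v (\<lambda>r. \<phi> r i) *\<^sub>R coord_vec M (U, \<phi>) i q) f =
      (\<Sum>i<mdim M. v (\<lambda>r. \<phi> r i) * coord_vec M (U, \<phi>) i q f)"
    by (simp add: sum_fun_apply scaleR_fun_def)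
  show "v f = (\<Sum>i<mdim M. v (\<lambda>r. \<phi> r i) *\<^sub>R coord_vec M (U, \<phi>) i q) f"
  proof (cases "smooth_near M q f")
    case False
    then show ?thesis unfolding sum_app by (simp add: tan_nonsmooth[OF v] coord_vec_def)
  next
    case True
    then obtain W where W: "opn W" "q \<in> W" "C W f" by (rule smooth_nearE)
    have sm: "smooth_on (mdim M) (\<phi> ` (U \<inter> W)) (f \<circ> inv_into U \<phi>)"
      using c W(3) unfolding smooth_fun_on_def by blast
    obtain B g where B: "openin E B" "\<phi> q \<in> B" "B \<subseteq> \<phi> ` (U \<inter> W)"
      and g: "\<And>i. i < mdim M \<Longrightarrow> smooth_on (mdim M) B (g i)"
      and fg: "\<And>y. y \<in> B \<Longrightarrow> (f \<circ> inv_into U \<phi>) y =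
        (f \<circ> inv_into U \<phi>) (\<phi> q) + (\<Sum>i<mdim M. (y i - \<phi> q i) * g i y)"
      using Hadamard[OF chart_image_open[OF c W(1)] _ sm, of "\<phi> q"] q W(2) by blast
    define O' where "O' = {r \<in> U. \<phi> r \<in> B}"
    have O': "opn O'" "q \<in> O'" "O' \<subseteq> U"
      unfolding O'_def using chart_preimage_open[OF c B(1)] q B(2) by auto
    have img: "\<phi> ` O' = B" using B(3) unfolding O'_def by auto
    have gC: "C O' (\<lambda>r. g i (\<phi> r))" if i: "i < mdim M" for i
    proof (rule C_chartI[OF c O'(1,3)])
      show "smooth_on (mdim M) (\<phi> ` O') ((\<lambda>r. g i (\<phi> r)) \<circ> inv_into U \<phi>)"
        unfolding img by (rule smooth_on_cong[OF B(1) _ g[OF i]])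
          (use B(3) in \<open>auto simp: f_inv_into_f\<close>)
    qed
    define F where "F r = f q + (\<Sum>i<mdim M. (\<phi> r i - \<phi> q i) * g i (\<phi> r))" for r
    have FC: "C O' (\<lambda>r. (\<phi> r i - \<phi> q i) * g i (\<phi> r))" "C O' (\<lambda>r. \<phi> r i - \<phi> q i)" if "i < mdim M" for i
      using gC[OF that] O' by (auto intro!: C_mult C_diff C_const C_coord[OF c])
    have *: "w f = (\<Sum>i<mdim M. g i (\<phi> q) * w (\<lambda>r. \<phi> r i))" if w: "w \<in> T q" for w
    proof -
      have "w f = w F"
      proof (rule tan_cong'[OF w O'(1,2)])
        fix r assume "r \<in> O'"
        then show "f r = F r"
          using fg[of "\<phi> r"] chart_inj[OF c] q unfolding O'_def F_def by simp
      qed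
      also have "\<dots> = w (\<lambda>r. f q) + w (\<lambda>r. \<Sum>i<mdim M. (\<phi> r i - \<phi> q i) * g i (\<phi> r))"
        unfolding F_def using O' FC by (intro tan_add[OF w]) (auto intro!: C_const C_sum)
      also have "\<dots> = (\<Sum>i<mdim M. w (\<lambda>r. (\<phi> r i - \<phi> q i) * g i (\<phi> r)))"
        using tan_sum[OF w O'(1,2), of "{..<mdim M}" "\<lambda>i r. (\<phi> r i - \<phi> q i) * g i (\<phi> r)"] FC
        by (simp add: tan_const[OF w])
      also have "\<dots> = (\<Sum>i<mdim M. g i (\<phi> q) * w (\<lambda>r. \<phi> r i))"
      proof (rule sum.cong[OF refl])
        fix i assume "i \<in> {..<mdim M}"
        then have i: "i < mdim M" by simp
        have "w (\<lambda>r. (\<phi> r i - \<phi> q i) * g i (\<phi> r)) = g i (\<phi> q) * w (\<lambda>r. \<phi> r i - \<phi> q i)"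
          using tan_mult[OF w O'(1,2) FC(2)[OF i] gC[OF i]] by simp
        also have "w (\<lambda>r. \<phi> r i - \<phi> q i) = w (\<lambda>r. \<phi> r i)"
          using tan_diff[OF w O'(1,2) C_coord[OF c O'(1,3)] C_const[OF O'(1)], of i "\<phi> q i"]
          by (simp add: tan_const[OF w])
        finally show "w (\<lambda>r. (\<phi> r i - \<phi> q i) * g i (\<phi> r)) = g i (\<phi> q) * w (\<lambda>r. \<phi> r i)" .
      qed
      finally show ?thesis .
    qed
    have "coord_vec M (U, \<phi>) i q f = g i (\<phi> q)" if i: "i < mdim M" for i
      unfolding *[OF coord_vec_tangent[OF c q i]] coord_vec_coord[OF c q i]
      using i by (simp add: if_distrib cong: if_cong)
    then show ?thesis unfolding sum_app *[OF v] by (simp add: mult.commute)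
  qed
qed

lemma tangent_eqI:
  assumes "(U, \<phi>) \<in> atlas M" "q \<in> U" "v \<in> T q" "w \<in> T q"
    "\<And>i. i < mdim M \<Longrightarrow> v (\<lambda>r. \<phi> r i) = w (\<lambda>r. \<phi> r i)"
  shows "v = w"
  using tangent_expand[OF assms(1-3)] tangent_expand[OF assms(1,2,4)] assms(5) by simp

end


section \<open>Alternating forms\<close>

definition omit :: "nat \<Rightarrow> 'a list \<Rightarrow> 'a list"
  where "omit i xs = take i xs @ drop (Suc i) xs"

lemma omit_0 [simp]: "omit 0 (x # xs) = xs"
  and omit_Suc [simp]: "omit (Suc i) (x # xs) = x # omit i xs"
  by (simp_all add: omit_def)

lemma length_omit: "i < length xs \<Longrightarrow> length (omit i xs) = length xs - 1"
  by (simp add: omit_def)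

lemma alt_length: "\<omega> \<in> alt_forms V k \<Longrightarrow> length vs \<noteq> k \<Longrightarrow> \<omega> vs = 0"
  and alt_support: "\<omega> \<in> alt_forms V k \<Longrightarrow> \<not> set vs \<subseteq> V \<Longrightarrow> \<omega> vs = 0"
  and alt_add: "\<omega> \<in> alt_forms V k \<Longrightarrow> set us \<subseteq> V \<Longrightarrow> x \<in> V \<Longrightarrow> y \<in> V \<Longrightarrow> set ws \<subseteq> V \<Longrightarrow>
    \<omega> (us @ (x + y) # ws) = \<omega> (us @ x # ws) + \<omega> (us @ y # ws)"
  and alt_scale: "\<omega> \<in> alt_forms V k \<Longrightarrow> set us \<subseteq> V \<Longrightarrow> x \<in> V \<Longrightarrow> set ws \<subseteq> V \<Longrightarrow>
    \<omega> (us @ (c *\<^sub>R x) # ws) = c * \<omega> (us @ x # ws)"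
  and alt_not_distinct: "\<omega> \<in> alt_forms V k \<Longrightarrow> \<not> distinct vs \<Longrightarrow> \<omega> vs = 0"
  unfolding alt_forms_def by blast+

lemma alt_zero_entry: "\<omega> \<in> alt_forms V k \<Longrightarrow> subspace V \<Longrightarrow> \<omega> (us @ 0 # ws) = 0"
  using alt_scale[of \<omega> V k us 0 ws 0] alt_support[of \<omega> V k "us @ 0 # ws"] subspace_0[of V]
  by (cases "set us \<subseteq> V \<and> set ws \<subseteq> V") auto

lemma alt_minus_entry:
  assumes "\<omega> \<in> alt_forms V k" "set us \<subseteq> V" "x \<in> V" "set ws \<subseteq> V"
  shows "\<omega> (us @ (- x) # ws) = - \<omega> (us @ x # ws)"
  using alt_scale[OF assms, of "-1"] by simp

lemma alt_diff_entry:
  assumes "subspace V" "\<omega> \<in> alt_forms V k" "set us \<subseteq> V" "x \<in> V" "y \<in> V" "set ws \<subseteq> V"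
  shows "\<omega> (us @ (x - y) # ws) = \<omega> (us @ x # ws) - \<omega> (us @ y # ws)"
  using alt_add[OF assms(2-4) _ assms(6), of "- y"] alt_minus_entry[OF assms(2,3,5,6)]
    subspace_neg[OF assms(1,5)] by simp

lemma alt_sum_entry:
  assumes V: "subspace V" and \<omega>: "\<omega> \<in> alt_forms V k"
    and "set us \<subseteq> V" "set ws \<subseteq> V" "\<And>i. i \<in> I \<Longrightarrow> x i \<in> V"
  shows "\<omega> (us @ (\<Sum>i\<in>I. c i *\<^sub>R x i) # ws) = (\<Sum>i\<in>I. c i * \<omega> (us @ x i # ws))"
  using assms(3-)
proof (induction I rule: infinite_finite_induct)
  case (insert i I)
  have "(\<Sum>i\<in>I. c i *\<^sub>R x i) \<in> V" using insert.prems V by (intro subspace_sum subspace_scale) auto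
  moreover have "c i *\<^sub>R x i \<in> V" using insert.prems V by (intro subspace_scale) auto
  ultimately have "\<omega> (us @ (c i *\<^sub>R x i + (\<Sum>i\<in>I. c i *\<^sub>R x i)) # ws) =
      \<omega> (us @ c i *\<^sub>R x i # ws) + \<omega> (us @ (\<Sum>i\<in>I. c i *\<^sub>R x i) # ws)"
    using alt_add[OF \<omega> insert.prems(1) _ _ insert.prems(2)] by blast
  also have "\<omega> (us @ c i *\<^sub>R x i # ws) = c i * \<omega> (us @ x i # ws)"
    using insert.prems by (intro alt_scale[OF \<omega>]) auto
  also have "\<omega> (us @ (\<Sum>i\<in>I. c i *\<^sub>R x i) # ws) = (\<Sum>i\<in>I. c i * \<omega> (us @ x i # ws))"
    using insert.prems by (intro insert.IH) auto
  finally show ?case unfolding sum.insert[OF insert.hyps] .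
qed (auto simp: alt_zero_entry[OF \<omega> V])

text \<open>A functional that vanishes when two adjacent entries agree is skew under exchange of adjacent
  entries, and hence vanishes when any two entries agree.\<close>

lemma adjacent_swap:
  fixes \<omega> :: "'a::real_vector list \<Rightarrow> real"
  assumes V: "subspace V"
    and add: "\<And>us x y ws. set us \<subseteq> V \<Longrightarrow> x \<in> V \<Longrightarrow> y \<in> V \<Longrightarrow> set ws \<subseteq> V \<Longrightarrow>
      \<omega> (us @ (x + y) # ws) = \<omega> (us @ x # ws) + \<omega> (us @ y # ws)"
    and adj: "\<And>us x ws. set us \<subseteq> V \<Longrightarrow> x \<in> V \<Longrightarrow> set ws \<subseteq> V \<Longrightarrow> \<omega> (us @ x # x # ws) = 0"
    and mem: "set us \<subseteq> V" "x \<in> V" "y \<in> V" "set ws \<subseteq> V"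
  shows "\<omega> (us @ x # y # ws) = - \<omega> (us @ y # x # ws)"
proof -
  have xy: "x + y \<in> V" using V mem subspace_add by blast
  have "0 = \<omega> (us @ (x + y) # (x + y) # ws)" using adj[OF mem(1) xy mem(4)] by simp
  also have "\<dots> = \<omega> (us @ x # (x + y) # ws) + \<omega> (us @ y # (x + y) # ws)"
    using add[OF mem(1-3), of "(x + y) # ws"] mem xy by simp
  also have "\<omega> (us @ x # (x + y) # ws) = \<omega> (us @ x # x # ws) + \<omega> (us @ x # y # ws)"
    using add[of "us @ [x]" x y ws] mem by simp
  also have "\<omega> (us @ y # (x + y) # ws) = \<omega> (us @ y # x # ws) + \<omega> (us @ y # y # ws)"
    using add[of "us @ [y]" x y ws] mem by simp
  finally show ?thesis using adj[OF mem(1,2), of ws] adj[OF mem(1,3), of ws] mem by simp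
qed

lemma alt_formsI:
  assumes V: "subspace V"
    and supp: "\<And>vs. \<omega> vs \<noteq> 0 \<Longrightarrow> length vs = k \<and> set vs \<subseteq> V"
    and add: "\<And>us x y ws. set us \<subseteq> V \<Longrightarrow> x \<in> V \<Longrightarrow> y \<in> V \<Longrightarrow> set ws \<subseteq> V \<Longrightarrow>
      \<omega> (us @ (x + y) # ws) = \<omega> (us @ x # ws) + \<omega> (us @ y # ws)"
    and scale: "\<And>c us x ws. set us \<subseteq> V \<Longrightarrow> x \<in> V \<Longrightarrow> set ws \<subseteq> V \<Longrightarrow>
      \<omega> (us @ (c *\<^sub>R x) # ws) = c * \<omega> (us @ x # ws)"
    and adj: "\<And>us x ws. set us \<subseteq> V \<Longrightarrow> x \<in> V \<Longrightarrow> set ws \<subseteq> V \<Longrightarrow> \<omega> (us @ x # x # ws) = 0"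
  shows "\<omega> \<in> alt_forms V k"
proof -
  have rep: "\<omega> (us @ x # ws @ x # zs) = 0"
    if "set us \<subseteq> V" "x \<in> V" "set ws \<subseteq> V" "set zs \<subseteq> V" for us x ws zs
    using that
  proof (induction ws arbitrary: us)
    case Nil
    then show ?case using adj by simp
  next
    case (Cons w ws)
    have "\<omega> (us @ x # w # (ws @ x # zs)) = - \<omega> (us @ w # x # (ws @ x # zs))"
      by (rule adjacent_swap[OF V add adj]) (use Cons.prems in auto)
    then show ?case using Cons.IH[of "us @ [w]"] Cons.prems by simp
  qed
  have "\<omega> vs = 0" if nd: "\<not> distinct vs" for vs
  proof (rule ccontr)
    assume "\<omega> vs \<noteq> 0"
    then have "set vs \<subseteq> V" using supp by blast
    moreover obtain xs ys zs y where "vs = xs @ [y] @ ys @ [y] @ zs"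
      using not_distinct_decomp[OF nd] by blast
    ultimately show False using rep[of xs y ys zs] \<open>\<omega> vs \<noteq> 0\<close> by simp
  qed
  then show ?thesis unfolding alt_forms_def
  proof (intro CollectI conjI allI impI, goal_cases)
    case (1 vs) then show ?case using supp by blast
  next
    case (2 vs) then show ?case using supp by blast
  next
    case (3 us x y ws) then show ?case by (intro add) auto
  next
    case (4 c us x ws) then show ?case by (intro scale) auto
  next
    case (5 vs) then show ?case by blast
  qed
qed

lemma alt_swap:
  assumes "subspace V" "\<omega> \<in> alt_forms V k" "set us \<subseteq> V" "x \<in> V" "y \<in> V" "set ws \<subseteq> V"
  shows "\<omega> (us @ x # y # ws) = - \<omega> (us @ y # x # ws)"
proof (rule adjacent_swap[OF assms(1) alt_add[OF assms(2)] _ assms(3-6)])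
  show "\<omega> (us @ x # x # ws) = 0" for us x ws
    by (rule alt_not_distinct[OF assms(2)]) simp
qed

text \<open>On its way to the front \<open>x\<close> passes each entry of \<open>us\<close>
  once.\<close>

lemma alt_move:
  assumes "subspace V" "\<omega> \<in> alt_forms V k" "set us \<subseteq> V" "x \<in> V" "set ws \<subseteq> V"
  shows "\<omega> (us @ x # ws) = (-1) ^ length us * \<omega> (x # us @ ws)"
  using assms(3,5)
proof (induction us arbitrary: ws rule: rev_induct)
  case (snoc u us)
  have "\<omega> (us @ u # x # ws) = - \<omega> (us @ x # u # ws)"
    using alt_swap[OF assms(1,2), of us u x ws] snoc.prems assms(4) by simp
  also have "\<omega> (us @ x # u # ws) = (-1) ^ length us * \<omega> (x # us @ u # ws)"
    using snoc.prems by (intro snoc.IH) auto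
  finally show ?case by simp
qed simp

text \<open>Links the sums over replaced entries in Lie derivatives with the alternating sums over
  omitted entries in exterior derivatives and wedge products.\<close>

lemma alt_update:
  assumes "subspace V" "\<omega> \<in> alt_forms V k" "set vs \<subseteq> V" "x \<in> V" "j < length vs"
  shows "\<omega> (vs[j := x]) = (-1) ^ j * \<omega> (x # omit j vs)"
proof -
  have "set (take j vs) \<subseteq> V" "set (drop (Suc j) vs) \<subseteq> V"
    using assms(3) set_take_subset[of j vs] set_drop_subset[of "Suc j" vs] by blast+
  from alt_move[OF assms(1,2) this(1) assms(4) this(2)] show ?thesis
    using assms(5) by (simp add: upd_conv_take_nth_drop omit_def)
qed

lemma zero_alt: "0 \<in> alt_forms V k"
  unfolding alt_forms_def by simp

lemma lincomb_alt:
  assumes "subspace V" "\<omega> \<in> alt_forms V k" "\<eta> \<in> alt_forms V k"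
  shows "\<omega> + (c::real) *\<^sub>R \<eta> \<in> alt_forms V k"
proof (rule alt_formsI[OF assms(1)])
  fix vs assume "(\<omega> + c *\<^sub>R \<eta>) vs \<noteq> 0"
  then have "\<omega> vs \<noteq> 0 \<or> \<eta> vs \<noteq> 0" by (auto simp: scaleR_fun_def)
  then show "length vs = k \<and> set vs \<subseteq> V"
    using alt_length alt_support assms(2,3) by metis
next
  fix us ws x y d assume m: "set us \<subseteq> V" "x \<in> V" "set ws \<subseteq> V"
  show "(\<omega> + c *\<^sub>R \<eta>) (us @ (d *\<^sub>R x) # ws) = d * (\<omega> + c *\<^sub>R \<eta>) (us @ x # ws)"
    using alt_scale[OF assms(2) m, of d] alt_scale[OF assms(3) m, of d]
    by (simp add: scaleR_fun_def[of c] algebra_simps)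
  show "(\<omega> + c *\<^sub>R \<eta>) (us @ x # x # ws) = 0"
    using alt_not_distinct[OF assms(2), of "us @ x # x # ws"]
      alt_not_distinct[OF assms(3), of "us @ x # x # ws"] by (simp add: scaleR_fun_def)
  assume y: "y \<in> V"
  show "(\<omega> + c *\<^sub>R \<eta>) (us @ (x + y) # ws) = (\<omega> + c *\<^sub>R \<eta>) (us @ x # ws) + (\<omega> + c *\<^sub>R \<eta>) (us @ y # ws)"
    using alt_add[OF assms(2) m(1,2) y m(3)] alt_add[OF assms(3) m(1,2) y m(3)]
    by (simp add: scaleR_fun_def[of c] algebra_simps)
qed

lemma subspace_alt_forms:
  assumes "subspace V"
  shows "subspace (alt_forms V k)"
  unfolding subspace_def
proof (intro conjI ballI allI)
  show "0 \<in> alt_forms V k" by (rule zero_alt)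
  fix x y assume "x \<in> alt_forms V k" "y \<in> alt_forms V k"
  from lincomb_alt[OF assms this, of 1] show "x + y \<in> alt_forms V k" by simp
next
  fix c x assume "x \<in> alt_forms V k"
  from lincomb_alt[OF assms zero_alt this, of c] show "c *\<^sub>R x \<in> alt_forms V k"
    by (simp only: add_0)
qed

text \<open>Reordering the entries changes the value only by a sign, which does not affect
  vanishing; this permits the sorting of index lists. The prefix \<open>pre\<close> carries the
  induction.\<close>

lemma alt_mset_zero_iff:
  assumes V: "subspace V" and \<omega>: "\<omega> \<in> alt_forms V k"
  shows "mset xs = mset ys \<Longrightarrow> set (pre @ xs) \<subseteq> V \<Longrightarrow> \<omega> (pre @ xs) = 0 \<longleftrightarrow> \<omega> (pre @ ys) = 0"
proof (induction xs arbitrary: pre ys)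
  case (Cons x xs)
  have "x \<in> set ys" using Cons.prems(1) by (metis list.set_intros(1) mset_eq_setD)
  then obtain as bs where ys: "ys = as @ x # bs" by (meson split_list)
  have xs: "mset xs = mset (as @ bs)" using Cons.prems(1) ys by simp
  then have st: "set xs = set as \<union> set bs" by (metis mset_eq_setD set_append)
  have m: "x \<in> V" "set (pre @ as) \<subseteq> V" "set pre \<subseteq> V" "set bs \<subseteq> V" "set (as @ bs) \<subseteq> V"
    using Cons.prems(2) st by auto
  have "\<omega> (pre @ x # xs) = 0 \<longleftrightarrow> \<omega> ((pre @ [x]) @ as @ bs) = 0"
    using Cons.IH[OF xs, of "pre @ [x]"] Cons.prems(2) by simp
  also have "\<dots> \<longleftrightarrow> \<omega> (x # pre @ as @ bs) = 0"
    using alt_move[OF V \<omega> m(3,1,5)] by simp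
  also have "\<dots> \<longleftrightarrow> \<omega> ((pre @ as) @ x # bs) = 0"
    using alt_move[OF V \<omega> m(2,1,4)] by simp
  finally show ?case by (simp add: ys)
qed simp

text \<open>The sum over all slots is split at one distinguished slot. The list that is looked up
  and the list that is updated are kept apart, because in the applications the former consists of
  fields and the latter of their values at a point.\<close>

lemma sum_update_split:
  fixes G :: "'b list \<Rightarrow> 'c::comm_monoid_add"
  assumes "length us' = length us"
  shows "(\<Sum>j<length (us @ Y # ws). G ((us' @ y # ws')[j := h ((us @ Y # ws) ! j)])) =
    (\<Sum>j<length us. G (us'[j := h (us ! j)] @ y # ws')) + G (us' @ h Y # ws') +
    (\<Sum>j<length ws. G (us' @ y # ws'[j := h (ws ! j)]))"
proof -
  define n where "n = length us"
  define F where "F j = G ((us' @ y # ws')[j := h ((us @ Y # ws) ! j)])" for j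
  have "{..<length (us @ Y # ws)} = {..<n} \<union> {n} \<union> (\<lambda>j. Suc (n + j)) ` {..<length ws}"
    (is "_ = ?R")
  proof (rule set_eqI)
    fix j
    have "j \<in> (\<lambda>j. Suc (n + j)) ` {..<length ws} \<longleftrightarrow> n < j \<and> j < length (us @ Y # ws)"
    proof
      assume "n < j \<and> j < length (us @ Y # ws)"
      then have "j = Suc (n + (j - Suc n))" "j - Suc n < length ws" by (auto simp: n_def)
      then show "j \<in> (\<lambda>j. Suc (n + j)) ` {..<length ws}" by blast
    qed (auto simp: n_def)
    then show "j \<in> {..<length (us @ Y # ws)} \<longleftrightarrow> j \<in> ?R" by (auto simp: n_def)
  qed
  then have "sum F {..<length (us @ Y # ws)} = sum F ({..<n} \<union> {n} \<union> (\<lambda>j. Suc (n + j)) ` {..<length ws})"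
    by simp
  also have "\<dots> = sum F ({..<n} \<union> {n}) + sum F ((\<lambda>j. Suc (n + j)) ` {..<length ws})"
    by (rule sum.union_disjoint) auto
  also have "sum F ({..<n} \<union> {n}) = sum F {..<n} + F n"
    by (subst sum.union_disjoint) auto
  also have "sum F ((\<lambda>j. Suc (n + j)) ` {..<length ws}) = (\<Sum>j<length ws. F (Suc (n + j)))"
    by (subst sum.reindex) (auto simp: inj_on_def)
  also have "sum F {..<n} = (\<Sum>j<length us. G (us'[j := h (us ! j)] @ y # ws'))"
    unfolding F_def n_def by (rule sum.cong) (auto simp: assms list_update_append nth_append)
  also have "F n = G (us' @ h Y # ws')"
    unfolding F_def n_def using assms by (simp add: list_update_append nth_append)
  also have "(\<Sum>j<length ws. F (Suc (n + j))) = (\<Sum>j<length ws. G (us' @ y # ws'[j := h (ws ! j)]))"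
    unfolding F_def n_def by (rule sum.cong) (auto simp: assms list_update_append nth_append)
  finally show ?thesis unfolding F_def .
qed

context smooth_mfd begin


section \<open>Vector fields on open subsets\<close>

text \<open>Smoothness is tested on functions over all open subsets and does not refer to charts. Every
  tangent vector extends to such a field near its base point, so no bump functions are needed.\<close>

definition VF :: "'p set \<Rightarrow> ('p \<Rightarrow> 'p tvec) \<Rightarrow> bool"
  where "VF W X \<longleftrightarrow> (\<forall>q\<in>W. X q \<in> T q) \<and>
    (\<forall>W' f. opn W' \<and> W' \<subseteq> W \<and> C W' f \<longrightarrow> C W' (\<lambda>q. X q f))"

abbreviation br :: "('p \<Rightarrow> 'p tvec) \<Rightarrow> ('p \<Rightarrow> 'p tvec) \<Rightarrow> 'p \<Rightarrow> 'p tvec"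
  where "br \<equiv> lie_bracket M"

lemma VF_tan: "VF W X \<Longrightarrow> q \<in> W \<Longrightarrow> X q \<in> T q"
  unfolding VF_def by blast

lemma VF_C: "VF W X \<Longrightarrow> opn W' \<Longrightarrow> W' \<subseteq> W \<Longrightarrow> C W' f \<Longrightarrow> C W' (\<lambda>q. X q f)"
  unfolding VF_def by blast

lemma VF_subset: "W' \<subseteq> W \<Longrightarrow> VF W X \<Longrightarrow> VF W' X"
  unfolding VF_def by (meson subset_iff)

lemma VF_cong:
  assumes X: "VF W X" and eq: "\<And>q. q \<in> W \<Longrightarrow> X q = Y q"
  shows "VF W Y"
  unfolding VF_def
proof (intro conjI ballI allI impI, goal_cases)
  case (1 q)
  then show ?case using VF_tan[OF X 1] eq by simp
next
  case (2 W' f)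
  then have "C W' (\<lambda>q. X q f)" using VF_C[OF X] by blast
  then show ?case by (rule C_cong[rotated 2]) (use 2 eq in auto)
qed

lemma VF_local:
  assumes "\<And>q. q \<in> W \<Longrightarrow> \<exists>W'. opn W' \<and> q \<in> W' \<and> VF W' X"
  shows "VF W X"
  unfolding VF_def
proof (intro conjI ballI allI impI, goal_cases)
  case (1 q)
  then show ?case using assms VF_tan by blast
next
  case (2 W' f)
  show ?case
  proof (rule C_local)
    show "opn W'" using 2 by blast
    fix q assume q: "q \<in> W'"
    then obtain V where V: "opn V" "q \<in> V" "VF V X" using assms 2 by blast
    have "C (V \<inter> W') (\<lambda>q. X q f)"
      using 2 V by (intro VF_C[OF V(3)] openin_Int) (auto intro: C_subset[of _ W'])
    then show "\<exists>W'. opn W' \<and> q \<in> W' \<and> C W' (\<lambda>q. X q f)"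
      using 2 V q by (intro exI[of _ "V \<inter> W'"]) (auto intro: openin_Int)
  qed
qed

lemma VF_zero: "VF W (\<lambda>q. 0)"
  unfolding VF_def using subspace_0[OF subspace_tangent] by (auto intro: C_const)

lemma VF_add: "VF W X \<Longrightarrow> VF W Y \<Longrightarrow> VF W (\<lambda>q. X q + Y q)"
  unfolding VF_def using subspace_add[OF subspace_tangent] by (auto intro: C_add)

lemma VF_scale: "VF W X \<Longrightarrow> C W g \<Longrightarrow> VF W (\<lambda>q. g q *\<^sub>R X q)"
  unfolding VF_def
proof (elim conjE, intro conjI ballI allI impI, goal_cases)
  case (1 q)
  then show ?case using subspace_scale[OF subspace_tangent] by blast
next
  case (2 W' f)
  then have "C W' (\<lambda>q. g q * X q f)" by (intro C_mult) (auto intro: C_subset[of W' W g])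
  then show ?case by (simp add: scaleR_fun_def)
qed

lemma VF_sum: "(\<And>i. i \<in> I \<Longrightarrow> VF W (X i)) \<Longrightarrow> VF W (\<lambda>q. \<Sum>i\<in>I. X i q)"
  by (induction I rule: infinite_finite_induct) (auto intro: VF_zero VF_add)

lemma VF_coord_vec:
  assumes c: "(U, \<phi>) \<in> atlas M" and i: "i < mdim M"
  shows "VF U (coord_vec M (U, \<phi>) i)"
  unfolding VF_def
proof (intro conjI ballI allI impI, goal_cases)
  case (1 q)
  then show ?case using coord_vec_tangent[OF c _ i] by blast
next
  case (2 W' f)
  then have W': "opn W'" "W' \<subseteq> U" "C W' f" by auto
  show ?case
    by (rule C_cong[OF W'(1) _ C_partial[OF c W' i]]) (simp add: coord_vec_eq[OF c W'(1) _ W'(3)])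
qed

lemma br_eq:
  assumes "opn W" "q \<in> W" "C W f"
  shows "br X Y q f = X q (\<lambda>r. Y r f) - Y q (\<lambda>r. X r f)"
  using smooth_nearI[OF assms] by (simp add: lie_bracket_def)

lemma br_swap: "br X Y q = - br Y X q"
  by (auto simp: lie_bracket_def fun_eq_iff)

lemma br_self: "br X X q = 0"
  by (auto simp: lie_bracket_def fun_eq_iff)

text \<open>In the product rule for \<open>X (Y (f * g))\<close> the mixed terms are symmetric in
  \<open>X\<close> and \<open>Y\<close> and cancel in the commutator.\<close>

lemma br_tangent:
  assumes W: "opn W" "q \<in> W" and X: "VF W X" and Y: "VF W Y"
  shows "br X Y q \<in> T q"
proof (rule tangentI)
  fix f assume "\<not> smooth_near M q f"
  then show "br X Y q f = 0" by (simp add: lie_bracket_def)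
next
  have Xq: "X q \<in> T q" and Yq: "Y q \<in> T q" using VF_tan X Y W by auto
  fix f g c V assume V: "opn V" "q \<in> V" and f: "C V f"
  define W' where "W' = V \<inter> W"
  have W': "opn W'" "q \<in> W'" "W' \<subseteq> W" using V W by (auto simp: W'_def openin_Int)
  have f: "C W' f" using f C_subset[of W' V] by (auto simp: W'_def)
  have Xf: "C W' (\<lambda>r. X r f)" and Yf: "C W' (\<lambda>r. Y r f)" using VF_C X Y W' f by auto
  note [simp] = br_eq[OF W'(1,2)]
  have 1: "Z q (\<lambda>r. X r (\<lambda>r. c * f r)) = c * Z q (\<lambda>r. X r f)"
    if "VF W Z" "VF W X" for Z X
  proof -
    have "Z q (\<lambda>r. X r (\<lambda>r. c * f r)) = Z q (\<lambda>r. c * X r f)"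
      by (rule tan_cong'[OF VF_tan[OF that(1) W(2)] W'(1,2)])
        (rule tan_cmult[OF VF_tan[OF that(2)] W'(1) _ f], use W' in auto)
    then show ?thesis
      using tan_cmult[OF VF_tan[OF that(1) W(2)] W'(1,2) VF_C[OF that(2) W'(1,3) f]] by simp
  qed
  show "br X Y q (\<lambda>r. c * f r) = c * br X Y q f"
    using 1[OF X Y] 1[OF Y X] C_mult[OF W'(1) C_const[OF W'(1), of c] f] f
    by (simp add: algebra_simps)
  assume g: "C V g"
  have g: "C W' g" using g C_subset[of W' V] by (auto simp: W'_def)
  have 2: "Z q (\<lambda>r. X r (\<lambda>r. f r + g r)) = Z q (\<lambda>r. X r f) + Z q (\<lambda>r. X r g)"
    if "VF W Z" "VF W X" for Z X
  proof -
    have "Z q (\<lambda>r. X r (\<lambda>r. f r + g r)) = Z q (\<lambda>r. X r f + X r g)"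
      by (rule tan_cong'[OF VF_tan[OF that(1) W(2)] W'(1,2)])
        (rule tan_add[OF VF_tan[OF that(2)] W'(1) _ f g], use W' in auto)
    then show ?thesis
      using tan_add[OF VF_tan[OF that(1) W(2)] W'(1,2) VF_C[OF that(2) W'(1,3) f] VF_C[OF that(2) W'(1,3) g]]
      by simp
  qed
  show "br X Y q (\<lambda>r. f r + g r) = br X Y q f + br X Y q g"
    using 2[OF X Y] 2[OF Y X] C_add[OF W'(1) f g] f g by simp
  have 3: "Z q (\<lambda>r. X r (\<lambda>r. f r * g r)) =
      f q * Z q (\<lambda>r. X r g) + X q g * Z q f + (g q * Z q (\<lambda>r. X r f) + X q f * Z q g)"
    if Z: "VF W Z" and X: "VF W X" for Z X
  proof -
    note Zq = VF_tan[OF Z W(2)]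
    note Xg = VF_C[OF X W'(1,3) g]
    note Xf = VF_C[OF X W'(1,3) f]
    have "Z q (\<lambda>r. X r (\<lambda>r. f r * g r)) = Z q (\<lambda>r. f r * X r g + g r * X r f)"
      by (rule tan_cong'[OF Zq W'(1,2)])
        (rule tan_mult[OF VF_tan[OF X] W'(1) _ f g], use W' in auto)
    then show ?thesis
      unfolding tan_add[OF Zq W'(1,2) C_mult[OF W'(1) f Xg] C_mult[OF W'(1) g Xf]]
        tan_mult[OF Zq W'(1,2) f Xg] tan_mult[OF Zq W'(1,2) g Xf] .
  qed
  show "br X Y q (\<lambda>r. f r * g r) = f q * br X Y q g + g q * br X Y q f"
    using 3[OF X Y] 3[OF Y X] C_mult[OF W'(1) f g] f g by (simp add: algebra_simps)
  assume eq: "\<And>r. r \<in> V \<Longrightarrow> f r = g r"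
  have 4: "Z q (\<lambda>r. X r f) = Z q (\<lambda>r. X r g)" if "VF W Z" "VF W X" for Z X
    by (rule tan_cong'[OF VF_tan[OF that(1) W(2)] W'(1,2)])
      (rule tan_cong'[OF VF_tan[OF that(2)] W'(1)], use W' eq W'_def in auto)
  show "br X Y q f = br X Y q g"
    using 4[OF X Y] 4[OF Y X] f g by simp
qed

lemma VF_br:
  assumes W: "opn W" and X: "VF W X" and Y: "VF W Y"
  shows "VF W (br X Y)"
  unfolding VF_def
proof (intro conjI ballI allI impI, goal_cases)
  case (1 q)
  then show ?case using br_tangent[OF W _ X Y] by blast
next
  case (2 W' f)
  then have W': "opn W'" "W' \<subseteq> W" "C W' f" by auto
  have "C W' (\<lambda>q. X q (\<lambda>r. Y r f) - Y q (\<lambda>r. X r f))"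
    using W' by (intro C_diff VF_C[OF X] VF_C[OF Y])
  then show ?case
    by (rule C_cong[OF W'(1), rotated]) (simp add: br_eq[OF W'(1) _ W'(3)])
qed

lemma br_cong:
  assumes W: "opn W" "q \<in> W" and X: "VF W X" and Y: "VF W Y"
    and eq: "\<And>r. r \<in> W \<Longrightarrow> X r = X' r" "\<And>r. r \<in> W \<Longrightarrow> Y r = Y' r"
  shows "br X Y q = br X' Y' q"
proof (rule ext)
  fix f
  have "X q (\<lambda>r. Y r f) = X q (\<lambda>r. Y' r f)" "Y q (\<lambda>r. X r f) = Y q (\<lambda>r. X' r f)"
    using eq by (auto intro: tan_cong'[OF VF_tan[OF X W(2)] W] tan_cong'[OF VF_tan[OF Y W(2)] W])
  then show "br X Y q f = br X' Y' q f"
    using eq W by (simp add: lie_bracket_def)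
qed

lemma br_add_right:
  assumes W: "opn W" "q \<in> W" and X: "VF W X" and Y: "VF W Y" and Z: "VF W Z"
  shows "br X (\<lambda>r. Y r + Z r) q = br X Y q + br X Z q"
proof (rule ext)
  fix f
  show "br X (\<lambda>r. Y r + Z r) q f = (br X Y q + br X Z q) f"
  proof (cases "smooth_near M q f")
    case True
    then obtain V where V: "opn V" "q \<in> V" "C V f" by (rule smooth_nearE)
    have o: "opn (V \<inter> W)" and f: "C (V \<inter> W) f" using V W C_subset[of "V \<inter> W" V] by (auto simp: openin_Int)
    have "C (V \<inter> W) (\<lambda>r. Y r f)" "C (V \<inter> W) (\<lambda>r. Z r f)"
      using VF_C[OF Y o _ f] VF_C[OF Z o _ f] by auto
    from tan_add[OF VF_tan[OF X W(2)] o _ this] show ?thesis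
      using True V W by (simp add: lie_bracket_def)
  qed (simp add: lie_bracket_def)
qed

lemma br_scale_right:
  assumes W: "opn W" "q \<in> W" and X: "VF W X" and Y: "VF W Y" and g: "C W g"
  shows "br X (\<lambda>r. g r *\<^sub>R Y r) q = g q *\<^sub>R br X Y q + X q g *\<^sub>R Y q"
proof (rule ext)
  fix f
  show "br X (\<lambda>r. g r *\<^sub>R Y r) q f = (g q *\<^sub>R br X Y q + X q g *\<^sub>R Y q) f"
  proof (cases "smooth_near M q f")
    case True
    then obtain V where V: "opn V" "q \<in> V" "C V f" by (rule smooth_nearE)
    have o: "opn (V \<inter> W)" and f: "C (V \<inter> W) f" and g: "C (V \<inter> W) g"
      using V W g C_subset[of "V \<inter> W" V] C_subset[of "V \<inter> W" W g] by (auto simp: openin_Int)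
    have "C (V \<inter> W) (\<lambda>r. Y r f)" using VF_C[OF Y o _ f] by auto
    from tan_mult[OF VF_tan[OF X W(2)] o _ g this]
    show ?thesis
      using True V W by (simp add: lie_bracket_def scaleR_fun_def algebra_simps)
  next
    \<comment> \<open>The term with \<open>X q g\<close> also vanishes, since
      \<open>Y q f = 0\<close> for a function that is not smooth near \<open>q\<close>.\<close>
    case False
    then show ?thesis
      using tan_nonsmooth[OF VF_tan[OF Y W(2)]] by (simp add: lie_bracket_def scaleR_fun_def)
  qed
qed

lemma br_add_left:
  assumes W: "opn W" "q \<in> W" and X: "VF W X" and Y: "VF W Y" and Z: "VF W Z"
  shows "br (\<lambda>r. Y r + Z r) X q = br Y X q + br Z X q"
  using br_add_right[OF assms] br_swap[of "\<lambda>r. Y r + Z r" X q] br_swap[of Y X q] br_swap[of Z X q]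
  by simp

lemma br_scale_left:
  assumes W: "opn W" "q \<in> W" and X: "VF W X" and Y: "VF W Y" and g: "C W g"
  shows "br (\<lambda>r. g r *\<^sub>R Y r) X q = g q *\<^sub>R br Y X q - X q g *\<^sub>R Y q"
  using br_scale_right[OF assms] br_swap[of "\<lambda>r. g r *\<^sub>R Y r" X q] br_swap[of Y X q] by simp

text \<open>On a function smooth near \<open>q\<close> all three double brackets expand into triple
  derivatives, which cancel in pairs; on any other function both sides are 0.\<close>

lemma br_jacobi:
  assumes W: "opn W" "q \<in> W" and X: "VF W X" and Y: "VF W Y" and Z: "VF W Z"
  shows "br X (br Y Z) q = br (br X Y) Z q + br Y (br X Z) q"
proof (rule ext)
  fix f
  show "br X (br Y Z) q f = (br (br X Y) Z q + br Y (br X Z) q) f"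
  proof (cases "smooth_near M q f")
    case True
    then obtain V where V: "opn V" "q \<in> V" "C V f" by (rule smooth_nearE)
    define V' where "V' = V \<inter> W"
    have o: "opn V'" "q \<in> V'" "V' \<subseteq> W" and f: "C V' f"
      using V W C_subset[of V' V] by (auto simp: openin_Int V'_def)
    have *: "A q (\<lambda>r. br B D r f) = A q (\<lambda>r. B r (\<lambda>r. D r f)) - A q (\<lambda>r. D r (\<lambda>r. B r f))"
      if A: "VF W A" and B: "VF W B" and D: "VF W D" for A B D
    proof -
      have "A q (\<lambda>r. br B D r f) = A q (\<lambda>r. B r (\<lambda>r. D r f) - D r (\<lambda>r. B r f))"
        by (rule tan_cong'[OF VF_tan[OF A W(2)] o(1,2)]) (simp add: br_eq[OF o(1) _ f])
      also have "\<dots> = A q (\<lambda>r. B r (\<lambda>r. D r f)) - A q (\<lambda>r. D r (\<lambda>r. B r f))"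
        by (rule tan_diff[OF VF_tan[OF A W(2)] o(1,2) VF_C[OF B o(1,3) VF_C[OF D o(1,3) f]]
              VF_C[OF D o(1,3) VF_C[OF B o(1,3) f]]])
      finally show ?thesis .
    qed
    have **: "br B D q (\<lambda>r. A r f) = B q (\<lambda>r. D r (\<lambda>r. A r f)) - D q (\<lambda>r. B r (\<lambda>r. A r f))"
      if A: "VF W A" for A B D
      using br_eq[OF o(1,2) VF_C[OF A o(1,3) f]] .
    show ?thesis
      using True *[OF X Y Z] *[OF Z X Y] *[OF Y X Z] **[OF X] **[OF Y] **[OF Z]
      unfolding lie_bracket_def[of M X "br Y Z"] lie_bracket_def[of M "br X Y" Z]
        lie_bracket_def[of M Y "br X Z"] by simp
  qed (simp add: lie_bracket_def)
qed


section \<open>Coordinate extensions of tangent vectors\<close>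

lemma chart_at:
  assumes "q \<in> topspace (mtop M)"
  shows "(fst (chart_at M q), snd (chart_at M q)) \<in> atlas M" "q \<in> fst (chart_at M q)"
proof -
  obtain U \<phi> where "(U, \<phi>) \<in> atlas M" "q \<in> U" using chart_around[OF assms] .
  then have "\<exists>c. c \<in> atlas M \<and> q \<in> fst c" by (intro exI[of _ "(U, \<phi>)"]) simp
  from someI_ex[OF this] show "(fst (chart_at M q), snd (chart_at M q)) \<in> atlas M" "q \<in> fst (chart_at M q)"
    unfolding chart_at_def by auto
qed

lemma coord_ext_VF:
  assumes "q \<in> topspace (mtop M)"
  shows "VF (fst (chart_at M q)) (coord_ext M q v)"
proof -
  have *: "VF (fst (chart_at M q)) (coord_vec M (chart_at M q) i)" if "i < mdim M" for i
    using VF_coord_vec[OF chart_at(1)[OF assms] that] by simp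
  have "opn (fst (chart_at M q))" using chart_open[OF chart_at(1)[OF assms]] .
  then show ?thesis unfolding coord_ext_def[abs_def]
    by (intro VF_sum VF_scale C_const *) auto
qed

lemma coord_ext_self:
  assumes "q \<in> topspace (mtop M)" "v \<in> T q"
  shows "coord_ext M q v q = v"
  using tangent_expand[OF chart_at[OF assms(1)] assms(2)] unfolding coord_ext_def by simp

lemma coord_ext_apply:
  assumes q: "q \<in> topspace (mtop M)" and r: "r \<in> fst (chart_at M q)" and i: "i < mdim M"
  shows "coord_ext M q v r (\<lambda>s. snd (chart_at M q) s i) = v (\<lambda>s. snd (chart_at M q) s i)"
proof -
  have "coord_vec M (chart_at M q) j r (\<lambda>s. snd (chart_at M q) s i) = (if j = i then 1 else 0)"
    if "j < mdim M" for j
    using coord_vec_coord[OF chart_at(1)[OF q] r that, of i] by simp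
  then have "coord_ext M q v r (\<lambda>s. snd (chart_at M q) s i) =
      (\<Sum>j<mdim M. if j = i then v (\<lambda>s. snd (chart_at M q) s i) else 0)"
    unfolding coord_ext_def sum_fun_apply scaleR_fun_def by (intro sum.cong) auto
  then show ?thesis using i by simp
qed

text \<open>The bracket is a tangent vector, and it annihilates the coordinates because the fields have
  constant coefficients; no symmetry of second derivatives is needed.\<close>

lemma coord_ext_commute:
  assumes q: "q \<in> topspace (mtop M)"
  shows "br (coord_ext M q v) (coord_ext M q w) q = 0"
proof (rule tangent_eqI[OF chart_at[OF q]])
  note o = chart_open[OF chart_at(1)[OF q]] and qU = chart_at(2)[OF q]
  show "br (coord_ext M q v) (coord_ext M q w) q \<in> T q"
    by (rule br_tangent[OF o qU coord_ext_VF[OF q] coord_ext_VF[OF q]])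
  show "0 \<in> T q" using subspace_0[OF subspace_tangent] .
  fix i assume i: "i < mdim M"
  have "coord_ext M q v q (\<lambda>r. coord_ext M q w r (\<lambda>s. snd (chart_at M q) s i)) = 0" for v w
  proof -
    note t = VF_tan[OF coord_ext_VF[OF q] qU, of v]
    have "coord_ext M q v q (\<lambda>r. coord_ext M q w r (\<lambda>s. snd (chart_at M q) s i)) =
        coord_ext M q v q (\<lambda>r. w (\<lambda>s. snd (chart_at M q) s i))"
      by (rule tan_cong'[OF t o qU]) (rule coord_ext_apply[OF q _ i])
    then show ?thesis by (simp add: tan_const[OF t])
  qed
  then show "br (coord_ext M q v) (coord_ext M q w) q (\<lambda>r. snd (chart_at M q) r i) =
      0 (\<lambda>r. snd (chart_at M q) r i)"
    by (simp add: lie_bracket_def)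
qed

text \<open>One neighbourhood serves all tangent vectors at \<open>q\<close>, so a whole list of
  arguments can be extended simultaneously.\<close>

lemma coord_ext_fields:
  assumes "opn W" "q \<in> W"
  obtains W' where "opn W'" "q \<in> W'" "W' \<subseteq> W" "\<And>v. VF W' (coord_ext M q v)"
proof -
  have q: "q \<in> topspace (mtop M)" using assms openin_subset by blast
  define W' where "W' = fst (chart_at M q) \<inter> W"
  have "opn W'" "q \<in> W'" "W' \<subseteq> W"
    using assms chart_open[OF chart_at(1)[OF q]] chart_at(2)[OF q] by (auto simp: W'_def openin_Int)
  moreover have "VF W' (coord_ext M q v)" for v
    using coord_ext_VF[OF q] by (rule VF_subset[rotated]) (simp add: W'_def)
  ultimately show ?thesis using that[of W'] by auto
qed

lemma map_coord_ext:
  assumes "opn W" "q \<in> W" "set vs \<subseteq> T q"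
  shows "map (\<lambda>v. coord_ext M q v q) vs = vs"
proof -
  have "q \<in> topspace (mtop M)" using assms openin_subset by blast
  from coord_ext_self[OF this] show ?thesis using assms(3) by (induction vs) auto
qed


section \<open>Differential forms on open subsets\<close>

abbreviation ev :: "'p \<Rightarrow> ('p \<Rightarrow> 'p tvec) list \<Rightarrow> 'p tvec list"
  where "ev q Ys \<equiv> map (\<lambda>Y. Y q) Ys"

abbreviation VFs :: "'p set \<Rightarrow> ('p \<Rightarrow> 'p tvec) list \<Rightarrow> bool"
  where "VFs W Ys \<equiv> (\<forall>Y\<in>set Ys. VF W Y)"

text \<open>As for \<open>VF\<close>, smoothness is tested on fields over smaller open sets. This is
  stable under restriction and involves no chart; agreement with smooth coefficients in coordinate
  frames is shown in \<open>smooth_in_coord_form_iff\<close>.\<close>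

definition FM :: "nat \<Rightarrow> 'p set \<Rightarrow> ('p \<Rightarrow> 'p form) \<Rightarrow> bool"
  where "FM k W \<omega> \<longleftrightarrow> (\<forall>q\<in>W. \<omega> q \<in> alt_forms (T q) k) \<and>
    (\<forall>W' Ys. opn W' \<and> W' \<subseteq> W \<and> VFs W' Ys \<longrightarrow> C W' (\<lambda>q. \<omega> q (ev q Ys)))"

lemma FM_alt: "FM k W \<omega> \<Longrightarrow> q \<in> W \<Longrightarrow> \<omega> q \<in> alt_forms (T q) k"
  unfolding FM_def by blast

lemma FM_C: "FM k W \<omega> \<Longrightarrow> opn W' \<Longrightarrow> W' \<subseteq> W \<Longrightarrow> VFs W' Ys \<Longrightarrow> C W' (\<lambda>q. \<omega> q (ev q Ys))"
  unfolding FM_def by blast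

lemma FM_subset: "W' \<subseteq> W \<Longrightarrow> FM k W \<omega> \<Longrightarrow> FM k W' \<omega>"
  unfolding FM_def by (meson subset_iff)

lemma FM_cong:
  assumes \<omega>: "FM k W \<omega>" and eq: "\<And>q. q \<in> W \<Longrightarrow> \<omega> q = \<eta> q"
  shows "FM k W \<eta>"
  unfolding FM_def
proof (intro conjI ballI allI impI, goal_cases)
  case (1 q)
  then show ?case using FM_alt[OF \<omega> 1] eq by simp
next
  case (2 W' Ys)
  then have "C W' (\<lambda>q. \<omega> q (ev q Ys))" using FM_C[OF \<omega>] by blast
  then show ?case by (rule C_cong[rotated 2]) (use 2 eq in auto)
qed

lemma FM_local:
  assumes "\<And>q. q \<in> W \<Longrightarrow> \<exists>W'. opn W' \<and> q \<in> W' \<and> FM k W' \<omega>"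
  shows "FM k W \<omega>"
  unfolding FM_def
proof (intro conjI ballI allI impI, goal_cases)
  case (1 q)
  then show ?case using assms FM_alt by blast
next
  case (2 W' Ys)
  show ?case
  proof (rule C_local)
    show "opn W'" using 2 by blast
    fix q assume q: "q \<in> W'"
    then obtain V where V: "opn V" "q \<in> V" "FM k V \<omega>" using assms 2 by blast
    have "VFs (V \<inter> W') Ys" using 2 VF_subset[of "V \<inter> W'" W'] by blast
    then have "C (V \<inter> W') (\<lambda>q. \<omega> q (ev q Ys))"
      using 2 V by (intro FM_C[OF V(3)] openin_Int) auto
    then show "\<exists>W'. opn W' \<and> q \<in> W' \<and> C W' (\<lambda>q. \<omega> q (ev q Ys))"
      using 2 V q by (intro exI[of _ "V \<inter> W'"]) (auto intro: openin_Int)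
  qed
qed

lemma VFs_subset: "W' \<subseteq> W \<Longrightarrow> VFs W Ys \<Longrightarrow> VFs W' Ys"
  using VF_subset by blast

lemma ev_tan: "VFs W Ys \<Longrightarrow> q \<in> W \<Longrightarrow> set (ev q Ys) \<subseteq> T q"
  using VF_tan by auto

lemma FM_zero: "FM k W (\<lambda>_. 0)"
  unfolding FM_def using zero_alt by (auto intro: C_const)

lemma FM_lincomb:
  assumes "FM k W \<omega>" "FM k W \<eta>" "C W g"
  shows "FM k W (\<lambda>q. \<omega> q + g q *\<^sub>R \<eta> q)"
  unfolding FM_def
proof (intro conjI ballI allI impI, goal_cases)
  case (1 q)
  then show ?case
    using lincomb_alt[OF subspace_tangent FM_alt[OF assms(1)] FM_alt[OF assms(2)]] by blast
next
  case (2 W' Ys)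
  then have "C W' (\<lambda>q. \<omega> q (ev q Ys) + g q * \<eta> q (ev q Ys))"
    using assms by (intro C_add C_mult) (auto intro: FM_C C_subset[of W' W g])
  then show ?case by (simp add: scaleR_fun_def)
qed

lemma FM_scale:
  assumes "FM k W \<eta>" "C W g"
  shows "FM k W (\<lambda>q. g q *\<^sub>R \<eta> q)"
  using FM_lincomb[OF FM_zero assms] by simp

lemma FM_add: "opn W \<Longrightarrow> FM k W \<omega> \<Longrightarrow> FM k W \<eta> \<Longrightarrow> FM k W (\<omega> + \<eta>)"
  using FM_lincomb[OF _ _ C_const, of k W \<omega> \<eta> 1] by (simp add: plus_fun_def)

lemma FM_diff: "opn W \<Longrightarrow> FM k W \<omega> \<Longrightarrow> FM k W \<eta> \<Longrightarrow> FM k W (\<omega> - \<eta>)"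
  using FM_lincomb[OF _ _ C_const, of k W \<omega> \<eta> "-1"] by (simp add: fun_diff_def)

lemma int_prod_degree_0:
  assumes "FM 0 W \<omega>" "q \<in> W"
  shows "int_prod X \<omega> q = 0"
  using alt_length[OF FM_alt[OF assms]] by (auto simp: int_prod_def fun_eq_iff)

text \<open>Truncated subtraction is harmless: the contraction of a function is zero, and zero is a
  form of every degree, in particular of degree 0.\<close>

lemma FM_int_prod:
  assumes \<omega>: "FM k W \<omega>" and X: "VF W X"
  shows "FM (k - 1) W (int_prod X \<omega>)"
proof (cases k)
  case 0
  then show ?thesis
    using FM_cong[OF FM_zero] int_prod_degree_0 \<omega> by metis
next
  case (Suc j)
  show ?thesis unfolding FM_def
  proof (intro conjI ballI allI impI, goal_cases)
    case (1 q)
    note a = FM_alt[OF \<omega> 1] and x = VF_tan[OF X 1]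
    show ?case
    proof (rule alt_formsI[OF subspace_tangent])
      fix vs assume "int_prod X \<omega> q vs \<noteq> 0"
      then have "length (X q # vs) = k" "set (X q # vs) \<subseteq> T q"
        unfolding int_prod_def using alt_length[OF a] alt_support[OF a] by blast+
      then show "length vs = k - 1 \<and> set vs \<subseteq> T q" using Suc by auto
    next
      fix us ws y z d assume m: "set us \<subseteq> T q" "y \<in> T q" "set ws \<subseteq> T q"
      show "int_prod X \<omega> q (us @ (d *\<^sub>R y) # ws) = d * int_prod X \<omega> q (us @ y # ws)"
        using alt_scale[OF a, of "X q # us" y ws d] m x by (simp add: int_prod_def)
      show "int_prod X \<omega> q (us @ y # y # ws) = 0"
        unfolding int_prod_def by (rule alt_not_distinct[OF a]) simp
      assume "z \<in> T q"
      then show "int_prod X \<omega> q (us @ (y + z) # ws) = int_prod X \<omega> q (us @ y # ws) + int_prod X \<omega> q (us @ z # ws)"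
        using alt_add[OF a, of "X q # us" y z ws] m x by (simp add: int_prod_def)
    qed
  next
    case (2 W' Ys)
    then have "VFs W' (X # Ys)" using VF_subset[of W' W X] X by simp
    from FM_C[OF \<omega> _ _ this] 2 show ?case by (simp add: int_prod_def)
  qed
qed


section \<open>The Lie derivative on arbitrary vector fields\<close>

text \<open>The invariant formula for \<open>L\<^sub>X \<omega>\<close> on arbitrary fields
  \<open>Ys\<close>. Unlike \<open>lie_deriv\<close> it uses the same fields at all points, so its
  dependence on \<open>q\<close> is accessible.\<close>

definition LL :: "('p \<Rightarrow> 'p tvec) \<Rightarrow> ('p \<Rightarrow> 'p form) \<Rightarrow> ('p \<Rightarrow> 'p tvec) list \<Rightarrow> 'p \<Rightarrow> real"
  where "LL X \<omega> Ys q = X q (\<lambda>r. \<omega> r (ev r Ys)) -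
    (\<Sum>j<length Ys. \<omega> q ((ev q Ys)[j := br X (Ys ! j) q]))"

lemma LL_split:
  "LL X \<omega> (us @ Y # ws) q = X q (\<lambda>r. \<omega> r (ev r us @ Y r # ev r ws)) -
    ((\<Sum>j<length us. \<omega> q ((ev q us)[j := br X (us ! j) q] @ Y q # ev q ws)) +
     \<omega> q (ev q us @ br X Y q # ev q ws) +
     (\<Sum>j<length ws. \<omega> q (ev q us @ Y q # (ev q ws)[j := br X (ws ! j) q])))"
  unfolding LL_def
  using sum_update_split[where us'="ev q us" and us=us and Y=Y and ws=ws and G="\<omega> q" and y="Y q"
      and ws'="ev q ws" and h="\<lambda>Z. br X Z q"] by simp

lemma update_tan:
  assumes "opn W" "q \<in> W" "VF W X" "VFs W us"
  shows "j < length us \<Longrightarrow> set ((ev q us)[j := br X (us ! j) q]) \<subseteq> T q"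
  using assms by (intro set_update_subsetI ev_tan br_tangent[OF assms(1-3)]) auto

section \<open>Algebraic rules for the Lie derivative evaluated on fields\<close>

context
  fixes W q X k \<omega>
  assumes W: "opn W" "q \<in> W" and X: "VF W X" and \<omega>: "FM k W \<omega>"
begin

lemma LL_add_slot:
  assumes us: "VFs W us" and ws: "VFs W ws" and Y: "VF W Y" and Z: "VF W Z"
  shows "LL X \<omega> (us @ (\<lambda>r. Y r + Z r) # ws) q = LL X \<omega> (us @ Y # ws) q + LL X \<omega> (us @ Z # ws) q"
proof -
  note a = alt_add[OF FM_alt[OF \<omega>]] and t = ev_tan[OF us] ev_tan[OF ws] VF_tan[OF Y] VF_tan[OF Z]
  note aq = a[OF W(2)] and tq = t[OF W(2)]
  have "X q (\<lambda>r. \<omega> r (ev r us @ (Y r + Z r) # ev r ws)) =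
      X q (\<lambda>r. \<omega> r (ev r us @ Y r # ev r ws) + \<omega> r (ev r us @ Z r # ev r ws))"
    by (rule tan_cong'[OF VF_tan[OF X W(2)] W]) (intro a t)
  also have "\<dots> = X q (\<lambda>r. \<omega> r (ev r us @ Y r # ev r ws)) + X q (\<lambda>r. \<omega> r (ev r us @ Z r # ev r ws))"
    using FM_C[OF \<omega> W(1) subset_refl, of "us @ Y # ws"] FM_C[OF \<omega> W(1) subset_refl, of "us @ Z # ws"]
      us ws Y Z by (intro tan_add[OF VF_tan[OF X W(2)] W]) auto
  finally have 1: "X q (\<lambda>r. \<omega> r (ev r us @ (Y r + Z r) # ev r ws)) = \<dots>" .
  have 2: "(\<Sum>j<length us. \<omega> q ((ev q us)[j := br X (us ! j) q] @ (Y q + Z q) # ev q ws)) =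
      (\<Sum>j<length us. \<omega> q ((ev q us)[j := br X (us ! j) q] @ Y q # ev q ws)) +
      (\<Sum>j<length us. \<omega> q ((ev q us)[j := br X (us ! j) q] @ Z q # ev q ws))"
    unfolding sum.distrib[symmetric] using update_tan[OF W X us] tq by (intro sum.cong refl aq) auto
  have 3: "(\<Sum>j<length ws. \<omega> q (ev q us @ (Y q + Z q) # (ev q ws)[j := br X (ws ! j) q])) =
      (\<Sum>j<length ws. \<omega> q (ev q us @ Y q # (ev q ws)[j := br X (ws ! j) q])) +
      (\<Sum>j<length ws. \<omega> q (ev q us @ Z q # (ev q ws)[j := br X (ws ! j) q]))"
    unfolding sum.distrib[symmetric] using update_tan[OF W X ws] tq by (intro sum.cong refl aq) auto
  have 4: "\<omega> q (ev q us @ br X (\<lambda>r. Y r + Z r) q # ev q ws) =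
      \<omega> q (ev q us @ br X Y q # ev q ws) + \<omega> q (ev q us @ br X Z q # ev q ws)"
    unfolding br_add_right[OF W X Y Z] by (intro aq tq br_tangent[OF W X] Y Z)
  show ?thesis unfolding LL_split 1 2 3 4 by simp
qed

text \<open>The derivative of \<open>g\<close> appears twice with opposite signs: from the product
  rule for \<open>X\<close> and from \<open>[X, g Y] = g [X, Y] + X(g) Y\<close>.\<close>

lemma LL_scale_slot:
  assumes us: "VFs W us" and ws: "VFs W ws" and Y: "VF W Y" and g: "C W g"
  shows "LL X \<omega> (us @ (\<lambda>r. g r *\<^sub>R Y r) # ws) q = g q * LL X \<omega> (us @ Y # ws) q"
proof -
  note a = alt_scale[OF FM_alt[OF \<omega>]] and t = ev_tan[OF us] ev_tan[OF ws] VF_tan[OF Y]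
  note aq = a[OF W(2)] and tq = t[OF W(2)]
  have "X q (\<lambda>r. \<omega> r (ev r us @ (g r *\<^sub>R Y r) # ev r ws)) =
      X q (\<lambda>r. g r * \<omega> r (ev r us @ Y r # ev r ws))"
    by (rule tan_cong'[OF VF_tan[OF X W(2)] W]) (intro a t)
  also have "\<dots> = g q * X q (\<lambda>r. \<omega> r (ev r us @ Y r # ev r ws)) + \<omega> q (ev q us @ Y q # ev q ws) * X q g"
    using FM_C[OF \<omega> W(1) subset_refl, of "us @ Y # ws"] us ws Y g
    by (intro tan_mult[OF VF_tan[OF X W(2)] W]) auto
  finally have 1: "X q (\<lambda>r. \<omega> r (ev r us @ (g r *\<^sub>R Y r) # ev r ws)) = \<dots>" .
  have 2: "(\<Sum>j<length us. \<omega> q ((ev q us)[j := br X (us ! j) q] @ (g q *\<^sub>R Y q) # ev q ws)) =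
      g q * (\<Sum>j<length us. \<omega> q ((ev q us)[j := br X (us ! j) q] @ Y q # ev q ws))"
    unfolding sum_distrib_left using update_tan[OF W X us] tq by (intro sum.cong refl aq) auto
  have 3: "(\<Sum>j<length ws. \<omega> q (ev q us @ (g q *\<^sub>R Y q) # (ev q ws)[j := br X (ws ! j) q])) =
      g q * (\<Sum>j<length ws. \<omega> q (ev q us @ Y q # (ev q ws)[j := br X (ws ! j) q]))"
    unfolding sum_distrib_left using update_tan[OF W X ws] tq by (intro sum.cong refl aq) auto
  have "\<omega> q (ev q us @ br X (\<lambda>r. g r *\<^sub>R Y r) q # ev q ws) =
      \<omega> q (ev q us @ (g q *\<^sub>R br X Y q) # ev q ws) + \<omega> q (ev q us @ (X q g *\<^sub>R Y q) # ev q ws)"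
    unfolding br_scale_right[OF W X Y g]
    by (intro alt_add[OF FM_alt[OF \<omega> W(2)]] tq subspace_scale[OF subspace_tangent] br_tangent[OF W X Y])
  also have "\<dots> = g q * \<omega> q (ev q us @ br X Y q # ev q ws) + X q g * \<omega> q (ev q us @ Y q # ev q ws)"
    using aq[OF tq(1) br_tangent[OF W X Y] tq(2), of "g q"] aq[OF tq(1,3,2), of "X q g"] by simp
  finally have 4: "\<omega> q (ev q us @ br X (\<lambda>r. g r *\<^sub>R Y r) q # ev q ws) = \<dots>" .
  show ?thesis unfolding LL_split 1 2 3 4 by (simp add: algebra_simps)
qed

text \<open>The two terms in which the bracket replaces one of the equal entries cancel by skew
  symmetry; in all others the equal entries survive.\<close>

lemma LL_adjacent:
  assumes us: "VFs W us" and ws: "VFs W ws" and Y: "VF W Y"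
  shows "LL X \<omega> (us @ Y # Y # ws) q = 0"
proof -
  note a = alt_not_distinct[OF FM_alt[OF \<omega>]]
  have "X q (\<lambda>r. \<omega> r (ev r us @ Y r # Y r # ev r ws)) = X q (\<lambda>r. 0)"
    by (rule tan_cong'[OF VF_tan[OF X W(2)] W]) (rule a, auto)
  then have 1: "X q (\<lambda>r. \<omega> r (ev r us @ Y r # ev r (Y # ws))) = 0"
    using tan_const[OF VF_tan[OF X W(2)]] by simp
  have 2: "(\<Sum>j<length us. \<omega> q ((ev q us)[j := br X (us ! j) q] @ Y q # ev q (Y # ws))) = 0"
    by (intro sum.neutral ballI a[OF W(2)]) simp
  have "(\<Sum>j<length (Y # ws). \<omega> q (ev q us @ Y q # (ev q (Y # ws))[j := br X ((Y # ws) ! j) q])) =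
      \<omega> q (ev q us @ Y q # br X Y q # ev q ws) +
      (\<Sum>j<length ws. \<omega> q (ev q us @ Y q # Y q # (ev q ws)[j := br X (ws ! j) q]))"
    by (simp add: sum.lessThan_Suc_shift del: sum.lessThan_Suc)
  also have "(\<Sum>j<length ws. \<omega> q (ev q us @ Y q # Y q # (ev q ws)[j := br X (ws ! j) q])) = 0"
    by (intro sum.neutral ballI a[OF W(2)]) simp
  also have "\<omega> q (ev q us @ Y q # br X Y q # ev q ws) = - \<omega> q (ev q us @ br X Y q # Y q # ev q ws)"
    by (rule alt_swap[OF subspace_tangent FM_alt[OF \<omega> W(2)] ev_tan[OF us W(2)] VF_tan[OF Y W(2)]
          br_tangent[OF W X Y] ev_tan[OF ws W(2)]])
  finally show ?thesis unfolding LL_split 1 2 by simp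
qed

lemma LL_scale_form:
  assumes Ys: "VFs W Ys" and g: "C W g"
  shows "LL X (\<lambda>r. g r *\<^sub>R \<omega> r) Ys q = g q * LL X \<omega> Ys q + X q g * \<omega> q (ev q Ys)"
  using tan_mult[OF VF_tan[OF X W(2)] W g FM_C[OF \<omega> W(1) subset_refl Ys]]
  by (simp add: LL_def scaleR_fun_def algebra_simps sum_distrib_left)

lemma LL_lincomb_form:
  assumes Ys: "VFs W Ys" and \<eta>: "FM k' W \<eta>"
  shows "LL X (\<lambda>r. \<omega> r + c *\<^sub>R \<eta> r) Ys q = LL X \<omega> Ys q + c * LL X \<eta> Ys q"
  using tan_add[OF VF_tan[OF X W(2)] W FM_C[OF \<omega> W(1) subset_refl Ys]
      C_mult[OF W(1) C_const[OF W(1)] FM_C[OF \<eta> W(1) subset_refl Ys]], of c]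
    tan_cmult[OF VF_tan[OF X W(2)] W FM_C[OF \<eta> W(1) subset_refl Ys], of c]
  by (simp add: LL_def scaleR_fun_def algebra_simps sum_distrib_left sum.distrib)

lemma LL_length:
  assumes "length Ys \<noteq> k"
  shows "LL X \<omega> Ys q = 0"
proof -
  have "X q (\<lambda>r. \<omega> r (ev r Ys)) = X q (\<lambda>r. 0)"
    by (rule tan_cong'[OF VF_tan[OF X W(2)] W]) (rule alt_length[OF FM_alt[OF \<omega>]], use assms in auto)
  moreover have "(\<Sum>j<length Ys. \<omega> q ((ev q Ys)[j := br X (Ys ! j) q])) = 0"
    by (intro sum.neutral ballI alt_length[OF FM_alt[OF \<omega> W(2)]]) (use assms in auto)
  ultimately show ?thesis using tan_const[OF VF_tan[OF X W(2)]] by (simp add: LL_def)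
qed

text \<open>Dependence on the differentiating field is not tensorial:
  \<open>[g X, Y] = g [X, Y] - Y(g) X\<close> leaves a correction, which is the wedge product of dg
  with the contraction of \<open>\<omega>\<close> by \<open>X\<close>.\<close>

lemma LL_scale_field:
  assumes Ys: "VFs W Ys" and g: "C W g"
  shows "LL (\<lambda>r. g r *\<^sub>R X r) \<omega> Ys q =
    g q * LL X \<omega> Ys q + (\<Sum>j<length Ys. (Ys ! j) q g * \<omega> q ((ev q Ys)[j := X q]))"
proof -
  have "\<omega> q ((ev q Ys)[j := br (\<lambda>r. g r *\<^sub>R X r) (Ys ! j) q]) =
      g q * \<omega> q ((ev q Ys)[j := br X (Ys ! j) q]) - (Ys ! j) q g * \<omega> q ((ev q Ys)[j := X q])"
    if j: "j < length Ys" for j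
  proof -
    have Yj: "VF W (Ys ! j)" using Ys j by simp
    note b = br_tangent[OF W X Yj] and xq = VF_tan[OF X W(2)]
    have t: "set (take j (ev q Ys)) \<subseteq> T q" "set (drop (Suc j) (ev q Ys)) \<subseteq> T q"
      using ev_tan[OF Ys W(2)] set_take_subset[of j "ev q Ys"] set_drop_subset[of "Suc j" "ev q Ys"]
      by (auto intro: subset_trans)
    have u: "(ev q Ys)[j := z] = take j (ev q Ys) @ z # drop (Suc j) (ev q Ys)" for z
      using j by (simp add: upd_conv_take_nth_drop)
    show ?thesis
      unfolding br_scale_left[OF W Yj X g] u
      using alt_diff_entry[OF subspace_tangent FM_alt[OF \<omega> W(2)] t(1) _ _ t(2),
          of "g q *\<^sub>R br X (Ys ! j) q" "(Ys ! j) q g *\<^sub>R X q"]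
        alt_scale[OF FM_alt[OF \<omega> W(2)] t(1) b t(2), of "g q"]
        alt_scale[OF FM_alt[OF \<omega> W(2)] t(1) xq t(2), of "(Ys ! j) q g"]
        subspace_scale[OF subspace_tangent b] subspace_scale[OF subspace_tangent xq] by simp
  qed
  then have "(\<Sum>j<length Ys. \<omega> q ((ev q Ys)[j := br (\<lambda>r. g r *\<^sub>R X r) (Ys ! j) q])) =
      g q * (\<Sum>j<length Ys. \<omega> q ((ev q Ys)[j := br X (Ys ! j) q])) -
      (\<Sum>j<length Ys. (Ys ! j) q g * \<omega> q ((ev q Ys)[j := X q]))"
    by (simp add: sum_subtractf sum_distrib_left)
  then show ?thesis by (simp add: LL_def scaleR_fun_def[of "g q"] algebra_simps)
qed

lemma LL_add_field:
  assumes Ys: "VFs W Ys" and X': "VF W X'"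
  shows "LL (\<lambda>r. X r + X' r) \<omega> Ys q = LL X \<omega> Ys q + LL X' \<omega> Ys q"
proof -
  have "\<omega> q ((ev q Ys)[j := br (\<lambda>r. X r + X' r) (Ys ! j) q]) =
      \<omega> q ((ev q Ys)[j := br X (Ys ! j) q]) + \<omega> q ((ev q Ys)[j := br X' (Ys ! j) q])"
    if j: "j < length Ys" for j
  proof -
    have Yj: "VF W (Ys ! j)" using Ys j by simp
    have t: "set (take j (ev q Ys)) \<subseteq> T q" "set (drop (Suc j) (ev q Ys)) \<subseteq> T q"
      using ev_tan[OF Ys W(2)] set_take_subset[of j "ev q Ys"] set_drop_subset[of "Suc j" "ev q Ys"]
      by (auto intro: subset_trans)
    have u: "(ev q Ys)[j := z] = take j (ev q Ys) @ z # drop (Suc j) (ev q Ys)" for z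
      using j by (simp add: upd_conv_take_nth_drop)
    show ?thesis
      unfolding br_add_left[OF W Yj X X'] u
      by (rule alt_add[OF FM_alt[OF \<omega> W(2)] t(1) br_tangent[OF W X Yj] br_tangent[OF W X' Yj] t(2)])
  qed
  then show ?thesis by (simp add: LL_def sum.distrib)
qed

lemma LL_C: "VFs W Ys \<Longrightarrow> C W (LL X \<omega> Ys)"
proof -
  assume Ys: "VFs W Ys"
  \<comment> \<open>Updating the list of values amounts to evaluating an updated list of fields, on
    which the smoothness test for \<open>\<omega>\<close> applies.\<close>
  have u: "(ev r Ys)[j := br X (Ys ! j) r] = ev r (Ys[j := br X (Ys ! j)])" for r j
    by (simp add: map_update)
  have "C W (\<lambda>r. \<omega> r (ev r (Ys[j := br X (Ys ! j)])))" if "j < length Ys" for j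
    using Ys that set_update_subset_insert[of Ys j "br X (Ys ! j)"] VF_br[OF W(1) X]
    by (intro FM_C[OF \<omega> W(1)]) auto
  then show ?thesis
    unfolding LL_def[abs_def] u
    using FM_C[OF \<omega> W(1) subset_refl Ys] W(1)
    by (intro C_diff C_sum VF_C[OF X]) auto
qed

end

lemma LL_cong:
  assumes W: "opn W" "q \<in> W" and X: "VF W X" and Ys: "VFs W Ys"
    and eq: "\<And>r. r \<in> W \<Longrightarrow> \<omega> r = \<omega>' r" "\<And>r. r \<in> W \<Longrightarrow> X r = X' r" "\<And>r. r \<in> W \<Longrightarrow> ev r Ys = ev r Ys'"
  shows "LL X \<omega> Ys q = LL X' \<omega>' Ys' q"
proof -
  have len: "length Ys = length Ys'" using eq(3)[OF W(2)] by (metis length_map)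
  have "X q (\<lambda>r. \<omega> r (ev r Ys)) = X q (\<lambda>r. \<omega>' r (ev r Ys'))"
    by (rule tan_cong'[OF VF_tan[OF X W(2)] W]) (simp add: eq)
  moreover have "br X (Ys ! j) q = br X' (Ys' ! j) q" if j: "j < length Ys" for j
  proof (rule br_cong[OF W X])
    show "VF W (Ys ! j)" using Ys j by simp
    fix r assume r: "r \<in> W"
    show "X r = X' r" by (rule eq(2)[OF r])
    show "(Ys ! j) r = (Ys' ! j) r"
      using arg_cong[OF eq(3)[OF r], of "\<lambda>zs. zs ! j"] j len by simp
  qed
  ultimately show ?thesis
    unfolding LL_def using eq(1,2)[OF W(2)] eq(3)[OF W(2)] len by simp
qed

text \<open>On \<open>W\<close> a field is a combination of coordinate fields with smooth
  coefficients. By linearity over functions, \<open>G Y\<close> is the combination with the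
  coefficients at \<open>q\<close>, and these depend only on \<open>Y q\<close>. The assumption
  \<open>cong\<close> removes the influence of the arbitrary values outside
  \<open>W\<close>.\<close>

lemma tensorial_value:
  assumes c: "(U, \<phi>) \<in> atlas M" and W: "opn W" "q \<in> W" "W \<subseteq> U"
    and add: "\<And>Y Z. VF W Y \<Longrightarrow> VF W Z \<Longrightarrow> G (\<lambda>r. Y r + Z r) = G Y + G Z"
    and scale: "\<And>g Y. C W g \<Longrightarrow> VF W Y \<Longrightarrow> G (\<lambda>r. g r *\<^sub>R Y r) = g q * (G Y :: real)"
    and cong: "\<And>Y Z. VF W Y \<Longrightarrow> VF W Z \<Longrightarrow> (\<And>r. r \<in> W \<Longrightarrow> Y r = Z r) \<Longrightarrow> G Y = G Z"
    and Y: "VF W Y" "VF W Y'" "Y q = Y' q"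
  shows "G Y = G Y'"
proof -
  have G0: "G (\<lambda>r. 0) = 0" using scale[OF C_const[OF W(1), of 0] Y(1)] by simp
  have sum: "G (\<lambda>r. \<Sum>i\<in>I. g i r *\<^sub>R X i r) = (\<Sum>i\<in>I. g i q * G (X i))"
    if "\<And>i. i \<in> I \<Longrightarrow> C W (g i)" "\<And>i. i \<in> I \<Longrightarrow> VF W (X i)" for g X and I :: "nat set"
    using that
  proof (induction I rule: infinite_finite_induct)
    case (insert i I)
    have "G (\<lambda>r. g i r *\<^sub>R X i r + (\<Sum>i\<in>I. g i r *\<^sub>R X i r)) =
        G (\<lambda>r. g i r *\<^sub>R X i r) + G (\<lambda>r. \<Sum>i\<in>I. g i r *\<^sub>R X i r)"
      using insert.prems by (intro add VF_sum VF_scale) auto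
    also have "G (\<lambda>r. g i r *\<^sub>R X i r) = g i q * G (X i)"
      using insert.prems by (intro scale) auto
    also have "G (\<lambda>r. \<Sum>i\<in>I. g i r *\<^sub>R X i r) = (\<Sum>i\<in>I. g i q * G (X i))"
      using insert.prems by (intro insert.IH) auto
    finally show ?case unfolding sum.insert[OF insert.hyps] .
  qed (simp_all add: G0)
  have "G Y = (\<Sum>i<mdim M. Y q (\<lambda>s. \<phi> s i) * G (coord_vec M (U, \<phi>) i))" if Y: "VF W Y" for Y
  proof -
    have 1: "C W (\<lambda>r. Y r (\<lambda>s. \<phi> s i))" for i
      using C_coord[OF c W(1,3)] by (intro VF_C[OF Y W(1)]) auto
    have 2: "VF W (coord_vec M (U, \<phi>) i)" if "i \<in> {..<mdim M}" for i
      using VF_coord_vec[OF c] that by (intro VF_subset[OF W(3)]) auto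
    have "G Y = G (\<lambda>r. \<Sum>i<mdim M. Y r (\<lambda>s. \<phi> s i) *\<^sub>R coord_vec M (U, \<phi>) i r)"
      using tangent_expand[OF c _ VF_tan[OF Y]] W(3)
      by (intro cong Y VF_sum VF_scale 1 2) auto
    also have "\<dots> = (\<Sum>i<mdim M. Y q (\<lambda>s. \<phi> s i) * G (coord_vec M (U, \<phi>) i))"
      by (rule sum[OF 1 2])
    finally show ?thesis .
  qed
  then show ?thesis using Y by simp
qed

text \<open>The entries are exchanged one at a time from the left; \<open>us\<close> collects those
  already exchanged. The assumptions are made for all smaller neighbourhoods because the argument
  shrinks \<open>W\<close> into a chart.\<close>

lemma tensorial_list:
  assumes W: "opn W" "q \<in> W"
    and add: "\<And>W' us ws Y Z. opn W' \<Longrightarrow> q \<in> W' \<Longrightarrow> W' \<subseteq> W \<Longrightarrow> VFs W' us \<Longrightarrow> VFs W' ws \<Longrightarrow> VF W' Y \<Longrightarrow> VF W' Z \<Longrightarrow>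
      F (us @ (\<lambda>r. Y r + Z r) # ws) = F (us @ Y # ws) + F (us @ Z # ws)"
    and scale: "\<And>W' us ws g Y. opn W' \<Longrightarrow> q \<in> W' \<Longrightarrow> W' \<subseteq> W \<Longrightarrow> VFs W' us \<Longrightarrow> VFs W' ws \<Longrightarrow> VF W' Y \<Longrightarrow> C W' g \<Longrightarrow>
      F (us @ (\<lambda>r. g r *\<^sub>R Y r) # ws) = g q * (F (us @ Y # ws) :: real)"
    and cong: "\<And>W' Ys Zs. opn W' \<Longrightarrow> q \<in> W' \<Longrightarrow> W' \<subseteq> W \<Longrightarrow> VFs W' Ys \<Longrightarrow> VFs W' Zs \<Longrightarrow>
      (\<And>r. r \<in> W' \<Longrightarrow> ev r Ys = ev r Zs) \<Longrightarrow> F Ys = F Zs"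
    and Ys: "VFs W Ys" "VFs W Ys'" "ev q Ys = ev q Ys'"
  shows "F Ys = F Ys'"
proof -
  obtain U \<phi> where c: "(U, \<phi>) \<in> atlas M" "q \<in> U"
    using chart_around W openin_subset by blast
  define W' where "W' = U \<inter> W"
  have W': "opn W'" "q \<in> W'" "W' \<subseteq> W" "W' \<subseteq> U"
    using W c chart_open by (auto simp: W'_def openin_Int)
  have "length Ys = length Ys'" using Ys(3) by (metis length_map)
  then have "F (us @ Ys) = F (us @ Ys')"
    if "VFs W' us" "VFs W' Ys" "VFs W' Ys'" "ev q Ys = ev q Ys'" for us
    using that
  proof (induction Ys Ys' arbitrary: us rule: list_induct2)
    case (Cons Y Ys Y' Ys')
    have "F (us @ Y # Ys) = F (us @ Y' # Ys)"
    proof (rule tensorial_value[OF c(1) W'(1,2,4), of "\<lambda>Y. F (us @ Y # Ys)"])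
      fix Z Z' assume z: "VF W' Z" "VF W' Z'"
      show "F (us @ (\<lambda>r. Z r + Z' r) # Ys) = F (us @ Z # Ys) + F (us @ Z' # Ys)"
        using Cons.prems z by (intro add[OF W'(1-3)]) auto
      show "F (us @ Z # Ys) = F (us @ Z' # Ys)" if "\<And>r. r \<in> W' \<Longrightarrow> Z r = Z' r"
        using Cons.prems z that by (intro cong[OF W'(1-3)]) auto
    next
      fix g Z assume "C W' g" "VF W' Z"
      then show "F (us @ (\<lambda>r. g r *\<^sub>R Z r) # Ys) = g q * F (us @ Z # Ys)"
        using Cons.prems by (intro scale[OF W'(1-3)]) auto
    qed (use Cons.prems in auto)
    also have "\<dots> = F (us @ Y' # Ys')"
      using Cons.IH[of "us @ [Y']"] Cons.prems by simp
    finally show ?case .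
  qed simp
  from this[of "[]"] show ?thesis using Ys VFs_subset[OF W'(3)] by simp
qed

text \<open>Tangent vectors at \<open>q\<close> extend to fields, so the algebraic laws of
  \<open>F\<close> are inherited from those of \<open>L\<close>. It is designed for
  \<open>LL\<close> and \<open>dd\<close> at a fixed point in the role of \<open>L\<close>.\<close>

lemma alt_formsI_fields:
  assumes W: "opn W" "q \<in> W"
    and supp: "\<And>vs. F vs \<noteq> 0 \<Longrightarrow> length vs = k \<and> set vs \<subseteq> T q"
    and FL: "\<And>W' Ys. opn W' \<Longrightarrow> q \<in> W' \<Longrightarrow> W' \<subseteq> W \<Longrightarrow> VFs W' Ys \<Longrightarrow> F (ev q Ys) = L Ys"
    and add: "\<And>W' us ws Y Z. opn W' \<Longrightarrow> q \<in> W' \<Longrightarrow> W' \<subseteq> W \<Longrightarrow> VFs W' us \<Longrightarrow> VFs W' ws \<Longrightarrow> VF W' Y \<Longrightarrow> VF W' Z \<Longrightarrow>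
      L (us @ (\<lambda>r. Y r + Z r) # ws) = L (us @ Y # ws) + L (us @ Z # ws)"
    and scale: "\<And>W' us ws g Y. opn W' \<Longrightarrow> q \<in> W' \<Longrightarrow> W' \<subseteq> W \<Longrightarrow> VFs W' us \<Longrightarrow> VFs W' ws \<Longrightarrow> VF W' Y \<Longrightarrow> C W' g \<Longrightarrow>
      L (us @ (\<lambda>r. g r *\<^sub>R Y r) # ws) = g q * (L (us @ Y # ws) :: real)"
    and adj: "\<And>W' us ws Y. opn W' \<Longrightarrow> q \<in> W' \<Longrightarrow> W' \<subseteq> W \<Longrightarrow> VFs W' us \<Longrightarrow> VFs W' ws \<Longrightarrow> VF W' Y \<Longrightarrow>
      L (us @ Y # Y # ws) = 0"
  shows "F \<in> alt_forms (T q) k"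
proof -
  obtain W' where W': "opn W'" "q \<in> W'" "W' \<subseteq> W" and E: "\<And>v. VF W' (coord_ext M q v)"
    using coord_ext_fields[OF W] by blast
  let ?E = "coord_ext M q"
  have Es: "VFs W' (map ?E vs)" for vs using E by simp
  have VFs1: "VF W' Y \<Longrightarrow> VFs W' ws \<Longrightarrow> VFs W' (Y # ws)" for Y ws by auto
  have VFs2: "VFs W' us \<Longrightarrow> VF W' Y \<Longrightarrow> VFs W' ws \<Longrightarrow> VFs W' (us @ Y # ws)" for us Y ws by auto
  have self: "map (\<lambda>v. ?E v q) vs = vs" if "set vs \<subseteq> T q" for vs
    using map_coord_ext[OF W that] .
  show ?thesis
  proof (rule alt_formsI[OF subspace_tangent supp])
    fix us ws x y d assume m: "set us \<subseteq> T q" "x \<in> T q" "set ws \<subseteq> T q"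
    have [simp]: "map (\<lambda>v. ?E v q) us = us" "map (\<lambda>v. ?E v q) ws = ws" "?E x q = x"
      using self[of us] self[of ws] self[of "[x]"] m by simp_all
    have "F (ev q (map ?E us @ (\<lambda>r. d *\<^sub>R ?E x r) # map ?E ws)) = d * F (ev q (map ?E us @ ?E x # map ?E ws))"
      unfolding FL[OF W' VFs2[OF Es VF_scale[OF E C_const[OF W'(1)]] Es]] FL[OF W' VFs2[OF Es E Es]]
      by (rule scale[OF W' Es Es E C_const[OF W'(1)]])
    then show "F (us @ (d *\<^sub>R x) # ws) = d * F (us @ x # ws)" by (simp add: comp_def)
    have "F (ev q (map ?E us @ ?E x # ?E x # map ?E ws)) = 0"
      unfolding FL[OF W' VFs2[OF Es E VFs1[OF E Es]]] by (rule adj[OF W' Es Es E])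
    then show "F (us @ x # x # ws) = 0" by (simp add: comp_def)
    assume y: "y \<in> T q"
    have [simp]: "?E y q = y" using self[of "[y]"] y by simp
    have "F (ev q (map ?E us @ (\<lambda>r. ?E x r + ?E y r) # map ?E ws)) =
        F (ev q (map ?E us @ ?E x # map ?E ws)) + F (ev q (map ?E us @ ?E y # map ?E ws))"
      unfolding FL[OF W' VFs2[OF Es VF_add[OF E E] Es]] FL[OF W' VFs2[OF Es E Es]]
      by (rule add[OF W' Es Es E E])
    then show "F (us @ (x + y) # ws) = F (us @ x # ws) + F (us @ y # ws)" by (simp add: comp_def)
  qed
qed

text \<open>The definition is \<open>LL\<close> on the coordinate extensions of the values at
  \<open>q\<close>. These have the same values there as \<open>Ys\<close>, and \<open>LL\<close> is
  tensorial.\<close>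

lemma lie_deriv_ev:
  assumes W: "opn W" "q \<in> W" and X: "VF W X" and \<omega>: "FM k W \<omega>" and Ys: "VFs W Ys"
  shows "lie_deriv M X \<omega> q (ev q Ys) = LL X \<omega> Ys q"
proof -
  obtain W' where W': "opn W'" "q \<in> W'" "W' \<subseteq> W" and E: "\<And>v. VF W' (coord_ext M q v)"
    using coord_ext_fields[OF W] by blast
  define Zs where "Zs = map (coord_ext M q) (ev q Ys)"
  have evZ: "ev q Zs = ev q Ys"
    using map_coord_ext[OF W ev_tan[OF Ys W(2)]] by (simp add: Zs_def comp_def)
  have evr: "ev r Zs = map (\<lambda>v. coord_ext M q v r) (ev q Ys)" for r by (simp add: Zs_def)
  have "LL X \<omega> Zs q = X q (\<lambda>r. \<omega> r (map (\<lambda>v. coord_ext M q v r) (ev q Ys))) -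
      (\<Sum>j<length (ev q Ys). \<omega> q ((ev q Ys)[j := br X (coord_ext M q (ev q Ys ! j)) q]))"
    unfolding LL_def evZ evr by (intro arg_cong2[where f="(-)"] refl sum.cong) (auto simp: Zs_def)
  then have "lie_deriv M X \<omega> q (ev q Ys) = LL X \<omega> Zs q"
    using ev_tan[OF Ys W(2)] by (simp add: lie_deriv_def del: map_map set_map length_map)
  also have "\<dots> = LL X \<omega> Ys q"
  proof (rule tensorial_list[OF W'(1,2)])
    show "VFs W' Zs" "VFs W' Ys" "ev q Zs = ev q Ys"
      using E VFs_subset[OF W'(3) Ys] evZ by (auto simp: Zs_def)
    fix V assume V: "opn V" "q \<in> V" "V \<subseteq> W'"
    note X' = VF_subset[OF order_trans[OF V(3) W'(3)] X]
    note \<omega>' = FM_subset[OF order_trans[OF V(3) W'(3)] \<omega>]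
    show "LL X \<omega> (us @ (\<lambda>r. Y r + Z r) # ws) q = LL X \<omega> (us @ Y # ws) q + LL X \<omega> (us @ Z # ws) q"
      if "VFs V us" "VFs V ws" "VF V Y" "VF V Z" for us ws Y Z
      by (rule LL_add_slot[OF V(1,2) X' \<omega>' that])
    show "LL X \<omega> (us @ (\<lambda>r. g r *\<^sub>R Y r) # ws) q = g q * LL X \<omega> (us @ Y # ws) q"
      if "VFs V us" "VFs V ws" "VF V Y" "C V g" for us ws Y g
      by (rule LL_scale_slot[OF V(1,2) X' \<omega>' that])
    show "LL X \<omega> Ys q = LL X \<omega> Zs q"
      if "VFs V Ys" "VFs V Zs" "\<And>r. r \<in> V \<Longrightarrow> ev r Ys = ev r Zs" for Ys Zs
      using that by (intro LL_cong[OF V(1,2) X' that(1)]) auto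
  qed
  finally show ?thesis .
qed

text \<open>Near different points the definition may use different charts, but by
  \<open>lie_deriv_ev\<close> its value on given fields is one expression on the whole open set,
  smooth by \<open>LL_C\<close>.\<close>

lemma FM_lie_deriv:
  assumes W: "opn W" and X: "VF W X" and \<omega>: "FM k W \<omega>"
  shows "FM k W (lie_deriv M X \<omega>)"
  unfolding FM_def
proof (intro conjI ballI allI impI, goal_cases)
  case (1 q)
  show ?case
  proof (rule alt_formsI_fields[OF W 1, of _ _ "\<lambda>Ys. LL X \<omega> Ys q"])
    fix V assume V: "opn V" "q \<in> V" "V \<subseteq> W"
    note X' = VF_subset[OF V(3) X] and \<omega>' = FM_subset[OF V(3) \<omega>]
    show "lie_deriv M X \<omega> q (ev q Ys) = LL X \<omega> Ys q" if "VFs V Ys" for Ys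
      by (rule lie_deriv_ev[OF V(1,2) X' \<omega>' that])
    show "LL X \<omega> (us @ (\<lambda>r. Y r + Z r) # ws) q = LL X \<omega> (us @ Y # ws) q + LL X \<omega> (us @ Z # ws) q"
      if "VFs V us" "VFs V ws" "VF V Y" "VF V Z" for us ws Y Z
      by (rule LL_add_slot[OF V(1,2) X' \<omega>' that])
    show "LL X \<omega> (us @ (\<lambda>r. g r *\<^sub>R Y r) # ws) q = g q * LL X \<omega> (us @ Y # ws) q"
      if "VFs V us" "VFs V ws" "VF V Y" "C V g" for us ws Y g
      by (rule LL_scale_slot[OF V(1,2) X' \<omega>' that])
    show "LL X \<omega> (us @ Y # Y # ws) q = 0" if "VFs V us" "VFs V ws" "VF V Y" for us ws Y
      by (rule LL_adjacent[OF V(1,2) X' \<omega>' that])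
  next
    fix vs assume nz: "lie_deriv M X \<omega> q vs \<noteq> 0"
    then have t: "set vs \<subseteq> T q" by (auto simp: lie_deriv_def split: if_splits)
    obtain W' where W': "opn W'" "q \<in> W'" "W' \<subseteq> W" and E: "\<And>v. VF W' (coord_ext M q v)"
      using coord_ext_fields[OF W 1] by blast
    have "lie_deriv M X \<omega> q vs = LL X \<omega> (map (coord_ext M q) vs) q"
      using lie_deriv_ev[OF W'(1,2) VF_subset[OF W'(3) X] FM_subset[OF W'(3) \<omega>], of "map (coord_ext M q) vs"]
        E map_coord_ext[OF W 1 t] by (simp add: comp_def)
    with nz have "LL X \<omega> (map (coord_ext M q) vs) q \<noteq> 0" by simp
    then have "length (map (coord_ext M q) vs) = k" using LL_length[OF W 1 X \<omega>] by blast
    then show "length vs = k \<and> set vs \<subseteq> T q" using t by simp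
  qed
next
  case (2 W' Ys)
  then have W': "opn W'" "W' \<subseteq> W" "VFs W' Ys" by auto
  note X' = VF_subset[OF W'(2) X] and \<omega>' = FM_subset[OF W'(2) \<omega>]
  show ?case
  \<comment> \<open>\<open>LL_C\<close> is stated relative to a point of the open set, so the empty
    set is treated apart.\<close>
  proof (cases "W' = {}")
    case True
    show ?thesis by (rule C_cong[OF W'(1) _ C_const[OF W'(1), of 0]]) (simp add: True)
  next
    case False
    then obtain q where "q \<in> W'" by blast
    from LL_C[OF W'(1) this X' \<omega>' W'(3)] have "C W' (LL X \<omega> Ys)" .
    then show ?thesis
      by (rule C_cong[OF W'(1), rotated]) (rule lie_deriv_ev[OF W'(1) _ X' \<omega>' W'(3), symmetric])
  qed
qed


section \<open>The exterior derivative on arbitrary vector fields\<close>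

text \<open>Cartan's formula \<open>i\<^sub>X d = L\<^sub>X - d i\<^sub>X\<close>, read as a recursion on the list of arguments.\<close>

primrec dd :: "('p \<Rightarrow> 'p tvec) list \<Rightarrow> ('p \<Rightarrow> 'p form) \<Rightarrow> 'p \<Rightarrow> real"
  where
    "dd [] \<omega> q = 0"
  | "dd (X # Ys) \<omega> q = LL X \<omega> Ys q - dd Ys (int_prod X \<omega>) q"

lemma dd_cong:
  assumes W: "opn W" "q \<in> W"
  shows "VFs W Ys \<Longrightarrow> (\<And>r. r \<in> W \<Longrightarrow> \<omega> r = \<omega>' r) \<Longrightarrow> (\<And>r. r \<in> W \<Longrightarrow> ev r Ys = ev r Ys') \<Longrightarrow>
    dd Ys \<omega> q = dd Ys' \<omega>' q"
proof (induction Ys arbitrary: Ys' \<omega> \<omega>')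
  case Nil
  then show ?case using W by (cases Ys') auto
next
  case (Cons X Ys)
  obtain X' Zs where Y': "Ys' = X' # Zs" using Cons.prems(3)[OF W(2)] by (cases Ys') auto
  have "LL X \<omega> Ys q = LL X' \<omega>' Zs q"
    using Cons.prems Y' by (intro LL_cong[OF W]) auto
  moreover have "dd Ys (int_prod X \<omega>) q = dd Zs (int_prod X' \<omega>') q"
    using Cons.prems Y' by (intro Cons.IH) (auto simp: int_prod_def)
  ultimately show ?case by (simp add: Y')
qed

lemma LL_zero: "q \<in> W \<Longrightarrow> VF W X \<Longrightarrow> LL X (\<lambda>_. 0) Ys q = 0"
  using tan_const[OF VF_tan] by (auto simp: LL_def)

lemma int_prod_zero: "int_prod X (\<lambda>_. 0) = (\<lambda>_. 0)"
  by (simp add: int_prod_def fun_eq_iff)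

lemma dd_zero: "q \<in> W \<Longrightarrow> VFs W Ys \<Longrightarrow> dd Ys (\<lambda>_. 0) q = 0"
  by (induction Ys) (auto simp: LL_zero int_prod_zero)

lemma dd_lincomb:
  assumes W: "opn W" "q \<in> W"
  shows "VFs W Ys \<Longrightarrow> FM k W \<omega> \<Longrightarrow> FM k' W \<eta> \<Longrightarrow>
    dd Ys (\<lambda>r. \<omega> r + c *\<^sub>R \<eta> r) q = dd Ys \<omega> q + c * dd Ys \<eta> q"
proof (induction Ys arbitrary: k k' \<omega> \<eta>)
  case (Cons X Ys)
  then have X: "VF W X" and Ys: "VFs W Ys" by auto
  have "int_prod X (\<lambda>r. \<omega> r + c *\<^sub>R \<eta> r) = (\<lambda>r. int_prod X \<omega> r + c *\<^sub>R int_prod X \<eta> r)"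
    by (simp add: int_prod_def fun_eq_iff scaleR_fun_def)
  then show ?case
    unfolding dd.simps LL_lincomb_form[OF W X Cons.prems(2) Ys Cons.prems(3)]
    using Cons.IH[OF Ys FM_int_prod[OF Cons.prems(2) X] FM_int_prod[OF Cons.prems(3) X]]
    by (metis (no_types, lifting) add_diff_add right_diff_distrib)
qed simp

text \<open>The product rule \<open>d(g \<omega>) = g d\<omega> + dg \<and> \<omega>\<close>, with
  the wedge product unfolded into an alternating sum. The first summand comes from the Lie
  derivative, the others from the recursion with the opposite sign.\<close>

lemma dd_scale_form:
  assumes W: "opn W" "q \<in> W" and g: "C W g"
  shows "VFs W Ys \<Longrightarrow> FM k W \<omega> \<Longrightarrow> dd Ys (\<lambda>r. g r *\<^sub>R \<omega> r) q =
    g q * dd Ys \<omega> q + (\<Sum>i<length Ys. (-1) ^ i * (Ys ! i) q g * \<omega> q (omit i (ev q Ys)))"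
proof (induction Ys arbitrary: k \<omega>)
  case (Cons X Ys)
  then have X: "VF W X" and Ys: "VFs W Ys" by auto
  have "int_prod X (\<lambda>r. g r *\<^sub>R \<omega> r) = (\<lambda>r. g r *\<^sub>R int_prod X \<omega> r)"
    by (simp add: int_prod_def fun_eq_iff scaleR_fun_def)
  moreover have "(\<Sum>i<length (X # Ys). (-1) ^ i * ((X # Ys) ! i) q g * \<omega> q (omit i (ev q (X # Ys)))) =
      X q g * \<omega> q (ev q Ys) - (\<Sum>i<length Ys. (-1) ^ i * (Ys ! i) q g * int_prod X \<omega> q (omit i (ev q Ys)))"
    by (simp add: sum.lessThan_Suc_shift int_prod_def sum_negf del: sum.lessThan_Suc)
  ultimately show ?case
    using Cons.IH[OF Ys FM_int_prod[OF Cons.prems(2) X]] LL_scale_form[OF W X Cons.prems(2) Ys g]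
    by (simp add: algebra_simps del: sum.lessThan_Suc)
qed simp

text \<open>Both terms of the recursion drop the leading field, and contraction also lowers the
  degree, so the mismatch persists; degree 0 is the exception.\<close>

lemma dd_length:
  assumes W: "opn W" "q \<in> W"
  shows "VFs W Ys \<Longrightarrow> FM k W \<omega> \<Longrightarrow> length Ys \<noteq> Suc k \<Longrightarrow> dd Ys \<omega> q = 0"
proof (induction Ys arbitrary: k \<omega>)
  case (Cons X Ys)
  then have X: "VF W X" and Ys: "VFs W Ys" by auto
  have "dd Ys (int_prod X \<omega>) q = 0"
  proof (cases k)
    \<comment> \<open>The truncated degree is again 0, so the induction hypothesis would miss the
      case of one remaining field; here the contraction itself vanishes.\<close>
    case 0
    have "dd Ys (int_prod X \<omega>) q = dd Ys (\<lambda>_. 0) q"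
      using Cons.prems 0 Ys by (intro dd_cong[OF W]) (auto simp: int_prod_degree_0)
    then show ?thesis using dd_zero[OF W(2) Ys] by simp
  next
    case (Suc j)
    then show ?thesis
      using Cons.IH[OF Ys FM_int_prod[OF Cons.prems(2) X]] Cons.prems(3) by simp
  qed
  then show ?case using LL_length[OF W X Cons.prems(2)] Cons.prems(3) by simp
qed simp

lemma dd_add_slot:
  assumes W: "opn W" "q \<in> W" and ws: "VFs W ws" and Y: "VF W Y" and Z: "VF W Z"
  shows "VFs W us \<Longrightarrow> FM k W \<omega> \<Longrightarrow>
    dd (us @ (\<lambda>r. Y r + Z r) # ws) \<omega> q = dd (us @ Y # ws) \<omega> q + dd (us @ Z # ws) \<omega> q"
proof (induction us arbitrary: k \<omega>)
  case Nil
  have "dd ws (int_prod (\<lambda>r. Y r + Z r) \<omega>) q = dd ws (\<lambda>r. int_prod Y \<omega> r + 1 *\<^sub>R int_prod Z \<omega> r) q"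
  proof (rule dd_cong[OF W ws _ refl])
    fix r assume r: "r \<in> W"
    show "int_prod (\<lambda>r. Y r + Z r) \<omega> r = int_prod Y \<omega> r + 1 *\<^sub>R int_prod Z \<omega> r"
    proof
      fix vs
      note a = FM_alt[OF Nil(2) r]
      show "int_prod (\<lambda>r. Y r + Z r) \<omega> r vs = (int_prod Y \<omega> r + 1 *\<^sub>R int_prod Z \<omega> r) vs"
      proof (cases "set vs \<subseteq> T r")
        case True
        then show ?thesis
          using alt_add[OF a, of "[]" "Y r" "Z r" vs] VF_tan[OF Y r] VF_tan[OF Z r]
          by (simp add: int_prod_def)
      next
        case False
        then show ?thesis using alt_support[OF a, of "_ # vs"] by (simp add: int_prod_def)
      qed
    qed
  qed
  also have "\<dots> = dd ws (int_prod Y \<omega>) q + dd ws (int_prod Z \<omega>) q"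
    using dd_lincomb[OF W ws FM_int_prod[OF Nil(2) Y] FM_int_prod[OF Nil(2) Z], of 1] by simp
  finally have "dd ws (int_prod (\<lambda>r. Y r + Z r) \<omega>) q = \<dots>" .
  then show ?case
    unfolding append_Nil dd.simps LL_add_field[OF W Y Nil(2) ws Z] by simp
next
  case (Cons X us)
  then have X: "VF W X" and us: "VFs W us" by auto
  show ?case
    unfolding append_Cons dd.simps LL_add_slot[OF W X Cons.prems(2) us ws Y Z]
      Cons.IH[OF us FM_int_prod[OF Cons.prems(2) X]]
    by simp
qed

text \<open>In the first slot the derivatives of \<open>g\<close> produced by \<open>L\<^bsub>g Y\<^esub>\<close> and by \<open>d (g i\<^sub>Y \<omega>)\<close> cancel.\<close>

lemma dd_scale_slot:
  assumes W: "opn W" "q \<in> W" and ws: "VFs W ws" and Y: "VF W Y" and g: "C W g"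
  shows "VFs W us \<Longrightarrow> FM k W \<omega> \<Longrightarrow> dd (us @ (\<lambda>r. g r *\<^sub>R Y r) # ws) \<omega> q = g q * dd (us @ Y # ws) \<omega> q"
proof (induction us arbitrary: k \<omega>)
  case Nil
  have "dd ws (int_prod (\<lambda>r. g r *\<^sub>R Y r) \<omega>) q = dd ws (\<lambda>r. g r *\<^sub>R int_prod Y \<omega> r) q"
  proof (rule dd_cong[OF W ws _ refl])
    fix r assume r: "r \<in> W"
    show "int_prod (\<lambda>r. g r *\<^sub>R Y r) \<omega> r = g r *\<^sub>R int_prod Y \<omega> r"
    proof
      fix vs
      note a = FM_alt[OF Nil(2) r]
      show "int_prod (\<lambda>r. g r *\<^sub>R Y r) \<omega> r vs = (g r *\<^sub>R int_prod Y \<omega> r) vs"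
      proof (cases "set vs \<subseteq> T r")
        case True
        then show ?thesis
          using alt_scale[OF a, of "[]" "Y r" vs "g r"] VF_tan[OF Y r]
          by (simp add: int_prod_def scaleR_fun_def[of _ "_ :: 'p tvec list \<Rightarrow> real"])
      next
        case False
        then show ?thesis using alt_support[OF a, of "_ # vs"]
          by (simp add: int_prod_def scaleR_fun_def[of _ "_ :: 'p tvec list \<Rightarrow> real"])
      qed
    qed
  qed
  also have "\<dots> = g q * dd ws (int_prod Y \<omega>) q +
      (\<Sum>i<length ws. (-1) ^ i * (ws ! i) q g * int_prod Y \<omega> q (omit i (ev q ws)))"
    by (rule dd_scale_form[OF W g ws FM_int_prod[OF Nil(2) Y]])
  \<comment> \<open>Moving \<open>Y\<close> into the omitted slot absorbs the sign and yields
    exactly the correction sum of \<open>LL_scale_field\<close>.\<close>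
  also have "(\<Sum>i<length ws. (-1) ^ i * (ws ! i) q g * int_prod Y \<omega> q (omit i (ev q ws))) =
      (\<Sum>i<length ws. (ws ! i) q g * \<omega> q ((ev q ws)[i := Y q]))"
    by (rule sum.cong) (auto simp: int_prod_def
        alt_update[OF subspace_tangent FM_alt[OF Nil(2) W(2)] ev_tan[OF ws W(2)] VF_tan[OF Y W(2)]])
  finally show ?case
    using LL_scale_field[OF W Y Nil(2) ws g] by (simp add: algebra_simps)
next
  case (Cons X us)
  then have X: "VF W X" and us: "VFs W us" by auto
  show ?case
    using LL_scale_slot[OF W X Cons.prems(2) us ws Y g] Cons.IH[OF us FM_int_prod[OF Cons.prems(2) X]]
    by (simp add: algebra_simps)
qed

text \<open>This is the commutator of \<open>L\<^sub>X\<close> with contraction by \<open>Y\<close>,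
  which is contraction by \<open>[X, Y]\<close>, at the level of fields.\<close>

lemma LL_Cons:
  "LL X \<omega> (Y # ws) q = LL X (int_prod Y \<omega>) ws q - \<omega> q (br X Y q # ev q ws)"
  using LL_split[of X \<omega> "[]" Y ws q] by (simp add: LL_def int_prod_def)

text \<open>For equal leading fields the recursion applied twice leaves \<open>L\<^sub>Y\<close> of
  the contraction with both signs, a term with \<open>[Y, Y] = 0\<close>, and \<open>dd\<close> of a
  double contraction by \<open>Y\<close>, which is zero.\<close>

lemma dd_adjacent:
  assumes W: "opn W" "q \<in> W" and ws: "VFs W ws" and Y: "VF W Y"
  shows "VFs W us \<Longrightarrow> FM k W \<omega> \<Longrightarrow> dd (us @ Y # Y # ws) \<omega> q = 0"
proof (induction us arbitrary: k \<omega>)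
  case Nil
  have "\<omega> q (br Y Y q # ev q ws) = 0"
    unfolding br_self using alt_zero_entry[OF FM_alt[OF Nil(2) W(2)] subspace_tangent, of "[]"] by simp
  moreover have "dd ws (int_prod Y (int_prod Y \<omega>)) q = dd ws (\<lambda>_. 0) q"
  proof (rule dd_cong[OF W ws _ refl])
    fix r assume "r \<in> W"
    then show "int_prod Y (int_prod Y \<omega>) r = 0"
      using alt_not_distinct[OF FM_alt[OF Nil(2)]] by (auto simp: int_prod_def fun_eq_iff)
  qed
  ultimately show ?case using dd_zero[OF W(2) ws] by (simp add: LL_Cons)
next
  case (Cons X us)
  then have X: "VF W X" and us: "VFs W us" by auto
  show ?case
    using LL_adjacent[OF W X Cons.prems(2) us ws Y] Cons.IH[OF us FM_int_prod[OF Cons.prems(2) X]]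
    by simp
qed

lemma dd_C:
  assumes W: "opn W" "q \<in> W"
  shows "VFs W Ys \<Longrightarrow> FM k W \<omega> \<Longrightarrow> C W (dd Ys \<omega>)"
proof (induction Ys arbitrary: k \<omega>)
  case Nil
  have "dd [] \<omega> = (\<lambda>_. 0)" by (simp add: fun_eq_iff)
  then show ?case using C_const[OF W(1)] by simp
next
  case (Cons X Ys)
  then have X: "VF W X" and Ys: "VFs W Ys" by auto
  have "dd (X # Ys) \<omega> = (\<lambda>q. LL X \<omega> Ys q - dd Ys (int_prod X \<omega>) q)" by (simp add: fun_eq_iff)
  then show ?case
    using C_diff[OF W(1) LL_C[OF W X Cons.prems(2) Ys] Cons.IH[OF Ys FM_int_prod[OF Cons.prems(2) X]]]
    by simp
qed

text \<open>When the brackets vanish, every Lie derivative in the recursion reduces to a directional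
  derivative, and unrolling gives the alternating sum of \<open>ext_deriv\<close>. Brackets enter
  only through their values at \<open>q\<close>, which is how \<open>coord_ext_commute\<close>
  provides them.\<close>

lemma dd_commuting:
  assumes W: "opn W" "q \<in> W"
  shows "VFs W Ys \<Longrightarrow> FM k W \<omega> \<Longrightarrow> \<forall>Y\<in>set Ys. \<forall>Z\<in>set Ys. br Y Z q = 0 \<Longrightarrow>
    dd Ys \<omega> q = (\<Sum>i<length Ys. (-1) ^ i * (Ys ! i) q (\<lambda>r. \<omega> r (omit i (ev r Ys))))"
proof (induction Ys arbitrary: k \<omega>)
  case (Cons X Ys)
  then have X: "VF W X" and Ys: "VFs W Ys" by auto
  have "\<omega> q ((ev q Ys)[j := br X (Ys ! j) q]) = 0" if j: "j < length Ys" for j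
  proof -
    have "br X (Ys ! j) q = 0" using j Cons.prems(3) nth_mem by (metis list.set_intros)
    moreover have "(ev q Ys)[j := 0] = take j (ev q Ys) @ 0 # drop (Suc j) (ev q Ys)"
      using j by (intro upd_conv_take_nth_drop) simp
    ultimately show ?thesis
      using alt_zero_entry[OF FM_alt[OF Cons.prems(2) W(2)] subspace_tangent] by metis
  qed
  then have "LL X \<omega> Ys q = X q (\<lambda>r. \<omega> r (ev r Ys))" by (simp add: LL_def)
  moreover have "dd Ys (int_prod X \<omega>) q =
      (\<Sum>i<length Ys. (-1) ^ i * (Ys ! i) q (\<lambda>r. int_prod X \<omega> r (omit i (ev r Ys))))"
    by (rule Cons.IH[OF Ys FM_int_prod[OF Cons.prems(2) X]]) (use Cons.prems(3) in simp)
  ultimately show ?case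
    by (simp add: sum.lessThan_Suc_shift int_prod_def sum_negf del: sum.lessThan_Suc)
qed simp

text \<open>Coordinate extensions commute at \<open>q\<close>, so on them \<open>dd\<close> is
  literally the definition; tensoriality of \<open>dd\<close> then replaces them by
  \<open>Ys\<close>.\<close>

lemma ext_deriv_ev:
  assumes W: "opn W" "q \<in> W" and \<omega>: "FM k W \<omega>" and Ys: "VFs W Ys"
  shows "ext_deriv M \<omega> q (ev q Ys) = dd Ys \<omega> q"
proof -
  obtain W' where W': "opn W'" "q \<in> W'" "W' \<subseteq> W" and E: "\<And>v. VF W' (coord_ext M q v)"
    using coord_ext_fields[OF W] by blast
  define Zs where "Zs = map (coord_ext M q) (ev q Ys)"
  have evZ: "ev q Zs = ev q Ys"
    using map_coord_ext[OF W ev_tan[OF Ys W(2)]] by (simp add: Zs_def comp_def)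
  have Zs: "VFs W' Zs" using E by (auto simp: Zs_def)
  have evr: "ev r Zs = map (\<lambda>v. coord_ext M q v r) (ev q Ys)" for r by (simp add: Zs_def)
  have q: "q \<in> topspace (mtop M)" using W openin_subset by blast
  have nth: "(Zs ! i) q = ev q Ys ! i" if "i < length Ys" for i
    using arg_cong[OF evZ, of "\<lambda>xs. xs ! i"] that by (simp add: Zs_def)
  have "dd Zs \<omega> q = (\<Sum>i<length Zs. (-1) ^ i * (Zs ! i) q (\<lambda>r. \<omega> r (omit i (ev r Zs))))"
    by (rule dd_commuting[OF W'(1,2) Zs FM_subset[OF W'(3) \<omega>]])
      (auto simp: Zs_def coord_ext_commute[OF q])
  also have "\<dots> = (\<Sum>i<length Ys. (-1) ^ i * (ev q Ys ! i) (\<lambda>r. \<omega> r (omit i (ev r Zs))))"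
    using nth by (intro sum.cong) (auto simp: Zs_def)
  also have "\<dots> = ext_deriv M \<omega> q (ev q Ys)"
  proof -
    have "omit i (ev r Zs) = map (\<lambda>v. coord_ext M q v r) (take i (ev q Ys) @ drop (Suc i) (ev q Ys))" for i r
      unfolding evr by (simp add: omit_def take_map drop_map)
    then show ?thesis
      unfolding ext_deriv_def if_P[OF ev_tan[OF Ys W(2)]] length_map by presburger
  qed
  also have "dd Zs \<omega> q = dd Ys \<omega> q"
  proof (rule tensorial_list[OF W'(1,2)])
    show "VFs W' Zs" "VFs W' Ys" "ev q Zs = ev q Ys"
      using Zs VFs_subset[OF W'(3) Ys] evZ by auto
    fix V assume V: "opn V" "q \<in> V" "V \<subseteq> W'"
    note \<omega>' = FM_subset[OF order_trans[OF V(3) W'(3)] \<omega>]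
    show "dd (us @ (\<lambda>r. Y r + Z r) # ws) \<omega> q = dd (us @ Y # ws) \<omega> q + dd (us @ Z # ws) \<omega> q"
      if "VFs V us" "VFs V ws" "VF V Y" "VF V Z" for us ws Y Z
      by (rule dd_add_slot[OF V(1,2) that(2,3,4,1) \<omega>'])
    show "dd (us @ (\<lambda>r. g r *\<^sub>R Y r) # ws) \<omega> q = g q * dd (us @ Y # ws) \<omega> q"
      if "VFs V us" "VFs V ws" "VF V Y" "C V g" for us ws Y g
      by (rule dd_scale_slot[OF V(1,2) that(2,3,4,1) \<omega>'])
    show "dd Ys \<omega> q = dd Zs \<omega> q"
      if "VFs V Ys" "VFs V Zs" "\<And>r. r \<in> V \<Longrightarrow> ev r Ys = ev r Zs" for Ys Zs
      by (rule dd_cong[OF V(1,2) that(1) refl that(3)])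
  qed
  finally show ?thesis by simp
qed

section \<open>Evaluation of derivatives on tangent vectors through fields\<close>

lemma ext_deriv_coord:
  assumes W: "opn W" "q \<in> W" and \<omega>: "FM k W \<omega>" and t: "set vs \<subseteq> T q"
  obtains W' where "opn W'" "q \<in> W'" "W' \<subseteq> W" "VFs W' (map (coord_ext M q) vs)"
    "ev q (map (coord_ext M q) vs) = vs"
    "ext_deriv M \<omega> q vs = dd (map (coord_ext M q) vs) \<omega> q"
proof -
  obtain W' where W': "opn W'" "q \<in> W'" "W' \<subseteq> W" and E: "\<And>v. VF W' (coord_ext M q v)"
    using coord_ext_fields[OF W] by blast
  have Es: "VFs W' (map (coord_ext M q) vs)" using E by auto
  have self: "ev q (map (coord_ext M q) vs) = vs"
    using map_coord_ext[OF W t] by (simp add: comp_def)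
  show ?thesis
    using ext_deriv_ev[OF W'(1,2) FM_subset[OF W'(3) \<omega>] Es] self by (intro that[OF W' Es]) auto
qed

lemma lie_deriv_coord:
  assumes W: "opn W" "q \<in> W" and X: "VF W X" and \<omega>: "FM k W \<omega>" and t: "set vs \<subseteq> T q"
  obtains W' where "opn W'" "q \<in> W'" "W' \<subseteq> W" "VFs W' (map (coord_ext M q) vs)"
    "ev q (map (coord_ext M q) vs) = vs"
    "lie_deriv M X \<omega> q vs = LL X \<omega> (map (coord_ext M q) vs) q"
proof -
  obtain W' where W': "opn W'" "q \<in> W'" "W' \<subseteq> W" and E: "\<And>v. VF W' (coord_ext M q v)"
    using coord_ext_fields[OF W] by blast
  have Es: "VFs W' (map (coord_ext M q) vs)" using E by auto
  have self: "ev q (map (coord_ext M q) vs) = vs"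
    using map_coord_ext[OF W t] by (simp add: comp_def)
  show ?thesis
    using lie_deriv_ev[OF W'(1,2) VF_subset[OF W'(3) X] FM_subset[OF W'(3) \<omega>] Es] self
    by (intro that[OF W' Es]) auto
qed

lemma FM_ext_deriv:
  assumes W: "opn W" and \<omega>: "FM k W \<omega>"
  shows "FM (Suc k) W (ext_deriv M \<omega>)"
  unfolding FM_def
proof (intro conjI ballI allI impI, goal_cases)
  case (1 q)
  show ?case
  proof (rule alt_formsI_fields[OF W 1, of _ _ "\<lambda>Ys. dd Ys \<omega> q"])
    fix V assume V: "opn V" "q \<in> V" "V \<subseteq> W"
    note \<omega>' = FM_subset[OF V(3) \<omega>]
    show "ext_deriv M \<omega> q (ev q Ys) = dd Ys \<omega> q" if "VFs V Ys" for Ys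
      by (rule ext_deriv_ev[OF V(1,2) \<omega>' that])
    show "dd (us @ (\<lambda>r. Y r + Z r) # ws) \<omega> q = dd (us @ Y # ws) \<omega> q + dd (us @ Z # ws) \<omega> q"
      if "VFs V us" "VFs V ws" "VF V Y" "VF V Z" for us ws Y Z
      by (rule dd_add_slot[OF V(1,2) that(2,3,4,1) \<omega>'])
    show "dd (us @ (\<lambda>r. g r *\<^sub>R Y r) # ws) \<omega> q = g q * dd (us @ Y # ws) \<omega> q"
      if "VFs V us" "VFs V ws" "VF V Y" "C V g" for us ws Y g
      by (rule dd_scale_slot[OF V(1,2) that(2,3,4,1) \<omega>'])
    show "dd (us @ Y # Y # ws) \<omega> q = 0" if "VFs V us" "VFs V ws" "VF V Y" for us ws Y
      by (rule dd_adjacent[OF V(1,2) that(2,3,1) \<omega>'])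
  next
    fix vs assume nz: "ext_deriv M \<omega> q vs \<noteq> 0"
    then have t: "set vs \<subseteq> T q" by (auto simp: ext_deriv_def split: if_splits)
    obtain V where V: "opn V" "q \<in> V" "V \<subseteq> W" "VFs V (map (coord_ext M q) vs)"
      "ext_deriv M \<omega> q vs = dd (map (coord_ext M q) vs) \<omega> q"
      using ext_deriv_coord[OF W 1 \<omega> t] by metis
    have "length (map (coord_ext M q) vs) = Suc k"
      using nz dd_length[OF V(1,2,4) FM_subset[OF V(3) \<omega>]] unfolding V(5) by blast
    then show "length vs = Suc k \<and> set vs \<subseteq> T q" using t by simp
  qed
next
  case (2 W' Ys)
  then have W': "opn W'" "W' \<subseteq> W" "VFs W' Ys" by auto
  note \<omega>' = FM_subset[OF W'(2) \<omega>]
  show ?case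
  proof (cases "W' = {}")
    case True
    show ?thesis by (rule C_cong[OF W'(1) _ C_const[OF W'(1), of 0]]) (simp add: True)
  next
    case False
    then obtain q where "q \<in> W'" by blast
    from dd_C[OF W'(1) this W'(3) \<omega>'] show ?thesis
      by (rule C_cong[OF W'(1), rotated]) (rule ext_deriv_ev[OF W'(1) _ \<omega>' W'(3), symmetric])
  qed
qed


section \<open>Cartan calculus\<close>

text \<open>A tangent vector sees only germs. Hence an identity of forms that holds merely on
  \<open>W\<close> may be used under a further derivative.\<close>

lemma lie_deriv_cong:
  assumes W: "opn W" "q \<in> W" and X: "VF W X" and eq: "\<And>r. r \<in> W \<Longrightarrow> \<omega> r = \<eta> r"
  shows "lie_deriv M X \<omega> q = lie_deriv M X \<eta> q"
proof
  fix vs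
  have "X q (\<lambda>r. \<omega> r (map (\<lambda>v. coord_ext M q v r) vs)) = X q (\<lambda>r. \<eta> r (map (\<lambda>v. coord_ext M q v r) vs))"
    by (rule tan_cong'[OF VF_tan[OF X W(2)] W]) (simp add: eq)
  then show "lie_deriv M X \<omega> q vs = lie_deriv M X \<eta> q vs"
    by (simp add: lie_deriv_def eq[OF W(2)])
qed

lemma ext_deriv_cong:
  assumes W: "opn W" "q \<in> W" and eq: "\<And>r. r \<in> W \<Longrightarrow> \<omega> r = \<eta> r"
  shows "ext_deriv M \<omega> q = ext_deriv M \<eta> q"
proof
  fix vs
  have "v (\<lambda>r. \<omega> r (f r)) = v (\<lambda>r. \<eta> r (f r))" if "v \<in> T q" for v f
    by (rule tan_cong'[OF that W]) (simp add: eq)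
  then show "ext_deriv M \<omega> q vs = ext_deriv M \<eta> q vs"
    unfolding ext_deriv_def by (auto intro!: sum.cong) (meson nth_mem subsetD)+
qed

lemma lie_deriv_zero: "q \<in> W \<Longrightarrow> VF W X \<Longrightarrow> lie_deriv M X (\<lambda>_. 0) q = 0"
  using tan_const[OF VF_tan] by (auto simp: lie_deriv_def fun_eq_iff)

lemma ext_deriv_zero: "ext_deriv M (\<lambda>_. 0) q = 0"
proof
  fix vs
  have "(vs ! i) (\<lambda>_. 0) = 0" if "set vs \<subseteq> T q" "i < length vs" for i
    using tan_const[of "vs ! i" q 0] that nth_mem by blast
  then show "ext_deriv M (\<lambda>_. 0) q vs = 0 vs" by (simp add: ext_deriv_def)
qed

lemma lie_deriv_lincomb:
  assumes W: "opn W" "q \<in> W" and X: "VF W X" and \<omega>: "FM k W \<omega>" and \<eta>: "FM k' W \<eta>"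
  shows "lie_deriv M X (\<lambda>r. \<omega> r + c *\<^sub>R \<eta> r) q = lie_deriv M X \<omega> q + c *\<^sub>R lie_deriv M X \<eta> q"
proof
  fix vs
  show "lie_deriv M X (\<lambda>r. \<omega> r + c *\<^sub>R \<eta> r) q vs = (lie_deriv M X \<omega> q + c *\<^sub>R lie_deriv M X \<eta> q) vs"
  proof (cases "set vs \<subseteq> T q")
    case True
    obtain V where V: "opn V" "q \<in> V" "V \<subseteq> W" and E: "\<And>v. VF V (coord_ext M q v)"
      using coord_ext_fields[OF W] by blast
    have o: "C V (\<lambda>r. \<omega> r (map (\<lambda>v. coord_ext M q v r) vs))" "C V (\<lambda>r. \<eta> r (map (\<lambda>v. coord_ext M q v r) vs))"
      using FM_C[OF \<omega> V(1,3), of "map (coord_ext M q) vs"] FM_C[OF \<eta> V(1,3), of "map (coord_ext M q) vs"] E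
      by (auto simp: comp_def)
    note Xq = VF_tan[OF X W(2)]
    show ?thesis
      using True tan_add[OF Xq V(1,2) o(1) C_mult[OF V(1) C_const[OF V(1), of c] o(2)]]
        tan_cmult[OF Xq V(1,2) o(2), of c]
      by (simp add: lie_deriv_def scaleR_fun_def[of _ "_ :: 'p tvec list \<Rightarrow> real"] sum.distrib
          sum_distrib_left algebra_simps)
  qed (simp add: lie_deriv_def scaleR_fun_def)
qed

lemma ext_deriv_lincomb:
  assumes W: "opn W" "q \<in> W" and \<omega>: "FM k W \<omega>" and \<eta>: "FM k' W \<eta>"
  shows "ext_deriv M (\<lambda>r. \<omega> r + c *\<^sub>R \<eta> r) q = ext_deriv M \<omega> q + c *\<^sub>R ext_deriv M \<eta> q"
proof
  fix vs
  show "ext_deriv M (\<lambda>r. \<omega> r + c *\<^sub>R \<eta> r) q vs = (ext_deriv M \<omega> q + c *\<^sub>R ext_deriv M \<eta> q) vs"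
  proof (cases "set vs \<subseteq> T q")
    case True
    obtain V where V: "opn V" "q \<in> V" "V \<subseteq> W" and E: "\<And>v. VF V (coord_ext M q v)"
      using coord_ext_fields[OF W] by blast
    have o: "C V (\<lambda>r. \<omega> r (map (\<lambda>v. coord_ext M q v r) us))" "C V (\<lambda>r. \<eta> r (map (\<lambda>v. coord_ext M q v r) us))" for us
      using FM_C[OF \<omega> V(1,3), of "map (coord_ext M q) us"] FM_C[OF \<eta> V(1,3), of "map (coord_ext M q) us"] E
      by (auto simp: comp_def)
    have "(vs ! i) (\<lambda>r. \<omega> r (map (\<lambda>v. coord_ext M q v r) us) + c * \<eta> r (map (\<lambda>v. coord_ext M q v r) us)) =
        (vs ! i) (\<lambda>r. \<omega> r (map (\<lambda>v. coord_ext M q v r) us)) + c * (vs ! i) (\<lambda>r. \<eta> r (map (\<lambda>v. coord_ext M q v r) us))"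
      if "i < length vs" for us i
    proof -
      have v: "vs ! i \<in> T q" using True that nth_mem by blast
      show ?thesis
        using tan_add[OF v V(1,2) o(1)[of us] C_mult[OF V(1) C_const[OF V(1), of c] o(2)[of us]]]
          tan_cmult[OF v V(1,2) o(2)[of us], of c] by simp
    qed
    then show ?thesis
      using True
      by (simp add: ext_deriv_def scaleR_fun_def sum.distrib sum_distrib_left algebra_simps del: map_append)
  qed (simp add: ext_deriv_def scaleR_fun_def)
qed

lemma lie_deriv_diff:
  assumes "opn W" "q \<in> W" "VF W X" "FM k W \<omega>" "FM k' W \<eta>"
  shows "lie_deriv M X (\<omega> - \<eta>) q = lie_deriv M X \<omega> q - lie_deriv M X \<eta> q"
  using lie_deriv_lincomb[OF assms, of "-1"] by (simp add: fun_diff_def)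

lemma lie_deriv_add:
  assumes "opn W" "q \<in> W" "VF W X" "FM k W \<omega>" "FM k' W \<eta>"
  shows "lie_deriv M X (\<omega> + \<eta>) q = lie_deriv M X \<omega> q + lie_deriv M X \<eta> q"
  using lie_deriv_lincomb[OF assms, of 1] by (simp add: plus_fun_def)

lemma ext_deriv_diff:
  assumes "opn W" "q \<in> W" "FM k W \<omega>" "FM k' W \<eta>"
  shows "ext_deriv M (\<omega> - \<eta>) q = ext_deriv M \<omega> q - ext_deriv M \<eta> q"
  using ext_deriv_lincomb[OF assms, of "-1"] by (simp add: fun_diff_def)

lemma ext_deriv_add:
  assumes "opn W" "q \<in> W" "FM k W \<omega>" "FM k' W \<eta>"
  shows "ext_deriv M (\<omega> + \<eta>) q = ext_deriv M \<omega> q + ext_deriv M \<eta> q"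
  using ext_deriv_lincomb[OF assms, of 1] by (simp add: plus_fun_def)

section \<open>Commutation rules for contraction, Lie derivative and exterior derivative\<close>

lemma int_prod_lie_deriv:
  assumes W: "opn W" "q \<in> W" and X: "VF W X" and Y: "VF W Y" and \<omega>: "FM k W \<omega>"
  shows "int_prod Y (lie_deriv M X \<omega>) q = lie_deriv M X (int_prod Y \<omega>) q - int_prod (br X Y) \<omega> q"
proof
  fix vs
  show "int_prod Y (lie_deriv M X \<omega>) q vs =
      (lie_deriv M X (int_prod Y \<omega>) q - int_prod (br X Y) \<omega> q) vs"
  proof (cases "set vs \<subseteq> T q")
    case True
    obtain V where V: "opn V" "q \<in> V" "V \<subseteq> W" and Z: "VFs V (map (coord_ext M q) vs)"
      "ev q (map (coord_ext M q) vs) = vs"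
      "lie_deriv M X (int_prod Y \<omega>) q vs = LL X (int_prod Y \<omega>) (map (coord_ext M q) vs) q"
      by (rule lie_deriv_coord[OF W X FM_int_prod[OF \<omega> Y] True])
    have "VFs V (Y # map (coord_ext M q) vs)" using VF_subset[OF V(3) Y] Z(1) by simp
    from lie_deriv_ev[OF V(1,2) VF_subset[OF V(3) X] FM_subset[OF V(3) \<omega>] this] show ?thesis
      using Z(2,3) by (simp add: LL_Cons int_prod_def del: map_map)
  next
    case False
    then show ?thesis
      using alt_support[OF FM_alt[OF \<omega> W(2)], of "br X Y q # vs"]
      by (auto simp: int_prod_def lie_deriv_def)
  qed
qed

lemma int_prod_ext_deriv:
  assumes W: "opn W" "q \<in> W" and Y: "VF W Y" and \<omega>: "FM k W \<omega>"
  shows "int_prod Y (ext_deriv M \<omega>) q = lie_deriv M Y \<omega> q - ext_deriv M (int_prod Y \<omega>) q"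
proof
  fix vs
  show "int_prod Y (ext_deriv M \<omega>) q vs = (lie_deriv M Y \<omega> q - ext_deriv M (int_prod Y \<omega>) q) vs"
  proof (cases "set vs \<subseteq> T q")
    case True
    obtain V where V: "opn V" "q \<in> V" "V \<subseteq> W" and Z: "VFs V (map (coord_ext M q) vs)"
      "ev q (map (coord_ext M q) vs) = vs"
      "lie_deriv M Y \<omega> q vs = LL Y \<omega> (map (coord_ext M q) vs) q"
      by (rule lie_deriv_coord[OF W Y \<omega> True])
    note Y' = VF_subset[OF V(3) Y] and \<omega>' = FM_subset[OF V(3) \<omega>]
    have "VFs V (Y # map (coord_ext M q) vs)" using Y' Z(1) by simp
    from ext_deriv_ev[OF V(1,2) \<omega>' this] ext_deriv_ev[OF V(1,2) FM_int_prod[OF \<omega>' Y'] Z(1)]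
    show ?thesis
      using Z(2,3) by (simp add: int_prod_def del: map_map)
  next
    case False
    then show ?thesis by (auto simp: int_prod_def lie_deriv_def ext_deriv_def)
  qed
qed

text \<open>The first argument extends to a local field, so a form of positive degree is determined
  by its contractions. This lowers the degree in the inductions below, at the price of a smaller
  open set \<open>V\<close>.\<close>

lemma FM_eqI_int_prod:
  assumes W: "opn W" and \<omega>: "FM (Suc k) W \<omega>" and \<eta>: "FM (Suc k) W \<eta>"
    and eq: "\<And>V Y r. opn V \<Longrightarrow> V \<subseteq> W \<Longrightarrow> VF V Y \<Longrightarrow> r \<in> V \<Longrightarrow> int_prod Y \<omega> r = int_prod Y \<eta> r"
    and q: "q \<in> W"
  shows "\<omega> q = \<eta> q"
proof
  fix vs
  show "\<omega> q vs = \<eta> q vs"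
  proof (cases "length vs = Suc k \<and> set vs \<subseteq> T q")
    case True
    then obtain v us where vs: "vs = v # us" "v \<in> T q" by (cases vs) auto
    obtain V where V: "opn V" "q \<in> V" "V \<subseteq> W" and E: "\<And>v. VF V (coord_ext M q v)"
      using coord_ext_fields[OF W q] by blast
    have "coord_ext M q v q = v" using map_coord_ext[OF W q, of "[v]"] vs by simp
    with eq[OF V(1,3) E V(2), of v] show ?thesis
      unfolding vs int_prod_def by (metis (no_types, lifting))
  next
    case False
    then show ?thesis
      using alt_length[OF FM_alt[OF \<omega> q]] alt_length[OF FM_alt[OF \<eta> q]]
        alt_support[OF FM_alt[OF \<omega> q]] alt_support[OF FM_alt[OF \<eta> q]] by metis
  qed
qed

lemma FM_eqI_0:
  assumes "FM 0 W \<omega>" "FM 0 W \<eta>" "q \<in> W" "\<omega> q [] = \<eta> q []"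
  shows "\<omega> q = \<eta> q"
proof
  fix vs
  show "\<omega> q vs = \<eta> q vs"
    using alt_length[OF FM_alt[OF assms(1,3)], of vs] alt_length[OF FM_alt[OF assms(2,3)], of vs] assms(4)
    by (cases vs) auto
qed

lemma int_prod_diff: "int_prod Y (\<omega> - \<eta>) r = int_prod Y \<omega> r - int_prod Y \<eta> r"
  by (simp add: int_prod_def fun_eq_iff)

lemma int_prod_add_field:
  assumes \<omega>: "FM k W \<omega>" and q: "q \<in> W" and A: "A q \<in> T q" and B: "B q \<in> T q" and D: "D q = A q + B q"
  shows "int_prod D \<omega> q = int_prod A \<omega> q + int_prod B \<omega> q"
proof
  fix vs
  show "int_prod D \<omega> q vs = (int_prod A \<omega> q + int_prod B \<omega> q) vs"
  proof (cases "set vs \<subseteq> T q")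
    case True
    then show ?thesis
      using alt_add[OF FM_alt[OF \<omega> q], of "[]" "A q" "B q" vs] A B D by (simp add: int_prod_def)
  next
    case False
    then show ?thesis
      using alt_support[OF FM_alt[OF \<omega> q], of "_ # vs"] by (simp add: int_prod_def)
  qed
qed

text \<open>Contraction with \<open>Z\<close> reduces the identity to the one for the contracted
  form, of smaller degree, up to contractions with double brackets, which the Jacobi identity
  balances. Open set and fields are generalised because \<open>Z\<close> lives on a smaller
  set.\<close>

lemma lie_deriv_br:
  assumes "opn W" "VF W X" "VF W Y" "FM k W \<omega>" "q \<in> W"
  shows "lie_deriv M (br X Y) \<omega> q = lie_deriv M X (lie_deriv M Y \<omega>) q - lie_deriv M Y (lie_deriv M X \<omega>) q"
  using assms
proof (induction k arbitrary: W X Y \<omega> q)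
  \<comment> \<open>A form of degree 0 is its value at the empty list, and there the claim is the
    definition of the bracket.\<close>
  case (0 W X Y \<omega> q)
  note W = 0(1) and X = 0(2) and Y = 0(3) and \<omega> = 0(4) and q = 0(5)
  have "lie_deriv M X (lie_deriv M Y \<omega>) q - lie_deriv M Y (lie_deriv M X \<omega>) q =
      (lie_deriv M X (lie_deriv M Y \<omega>) - lie_deriv M Y (lie_deriv M X \<omega>)) q" by simp
  moreover have "lie_deriv M (br X Y) \<omega> q = (lie_deriv M X (lie_deriv M Y \<omega>) - lie_deriv M Y (lie_deriv M X \<omega>)) q"
  proof (rule FM_eqI_0[OF _ _ q])
    show "FM 0 W (lie_deriv M (br X Y) \<omega>)"
      by (intro FM_lie_deriv W VF_br X Y \<omega>)
    show "FM 0 W (lie_deriv M X (lie_deriv M Y \<omega>) - lie_deriv M Y (lie_deriv M X \<omega>))"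
      by (intro FM_diff FM_lie_deriv W X Y \<omega>)
    have "C W (\<lambda>r. \<omega> r [])" using FM_C[OF \<omega> W subset_refl, of "[]"] by simp
    then show "lie_deriv M (br X Y) \<omega> q [] = (lie_deriv M X (lie_deriv M Y \<omega>) - lie_deriv M Y (lie_deriv M X \<omega>)) q []"
      by (simp add: lie_deriv_def br_eq[OF W q])
  qed
  ultimately show ?case by simp
next
  case (Suc k W X Y \<omega> q)
  note W = Suc.prems(1) and X = Suc.prems(2) and Y = Suc.prems(3) and \<omega> = Suc.prems(4) and q = Suc.prems(5)
  have "lie_deriv M (br X Y) \<omega> q = (lie_deriv M X (lie_deriv M Y \<omega>) - lie_deriv M Y (lie_deriv M X \<omega>)) q"
  proof (rule FM_eqI_int_prod[OF W _ _ _ q])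
    show "FM (Suc k) W (lie_deriv M (br X Y) \<omega>)"
      by (intro FM_lie_deriv W VF_br X Y \<omega>)
    show "FM (Suc k) W (lie_deriv M X (lie_deriv M Y \<omega>) - lie_deriv M Y (lie_deriv M X \<omega>))"
      by (intro FM_diff FM_lie_deriv W X Y \<omega>)
    fix V Z r assume V: "opn V" "V \<subseteq> W" and Z: "VF V Z" and r: "r \<in> V"
    note X = VF_subset[OF V(2) X] and Y = VF_subset[OF V(2) Y] and \<omega> = FM_subset[OF V(2) \<omega>]
    \<comment> \<open>The two middle terms are exchanged when \<open>X\<close> and \<open>Y\<close>
      are, so they drop out of the difference of the two orders.\<close>
    have key: "int_prod Z (lie_deriv M X (lie_deriv M Y \<omega>)) r =
        lie_deriv M X (lie_deriv M Y (int_prod Z \<omega>)) r - lie_deriv M X (int_prod (br Y Z) \<omega>) r -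
        lie_deriv M Y (int_prod (br X Z) \<omega>) r + int_prod (br Y (br X Z)) \<omega> r"
      if X: "VF V X" and Y: "VF V Y" for X Y
    proof -
      have "int_prod Z (lie_deriv M X (lie_deriv M Y \<omega>)) r =
          lie_deriv M X (int_prod Z (lie_deriv M Y \<omega>)) r - int_prod (br X Z) (lie_deriv M Y \<omega>) r"
        by (rule int_prod_lie_deriv[OF V(1) r X Z FM_lie_deriv[OF V(1) Y \<omega>]])
      also have "lie_deriv M X (int_prod Z (lie_deriv M Y \<omega>)) r =
          lie_deriv M X (lie_deriv M Y (int_prod Z \<omega>) - int_prod (br Y Z) \<omega>) r"
        by (rule lie_deriv_cong[OF V(1) r X]) (simp add: int_prod_lie_deriv[OF V(1) _ Y Z \<omega>])
      also have "\<dots> = lie_deriv M X (lie_deriv M Y (int_prod Z \<omega>)) r - lie_deriv M X (int_prod (br Y Z) \<omega>) r"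
        by (rule lie_deriv_diff[OF V(1) r X FM_lie_deriv[OF V(1) Y FM_int_prod[OF \<omega> Z]]
              FM_int_prod[OF \<omega> VF_br[OF V(1) Y Z]]])
      also have "int_prod (br X Z) (lie_deriv M Y \<omega>) r =
          lie_deriv M Y (int_prod (br X Z) \<omega>) r - int_prod (br Y (br X Z)) \<omega> r"
        by (rule int_prod_lie_deriv[OF V(1) r Y VF_br[OF V(1) X Z] \<omega>])
      finally show ?thesis by (simp add: fun_eq_iff)
    qed
    have "int_prod (br X (br Y Z)) \<omega> r = int_prod (br (br X Y) Z) \<omega> r + int_prod (br Y (br X Z)) \<omega> r"
      using br_tangent[OF V(1) r VF_br[OF V(1) X Y] Z] br_tangent[OF V(1) r Y VF_br[OF V(1) X Z]]
      by (rule int_prod_add_field[OF \<omega> r]) (rule br_jacobi[OF V(1) r X Y Z])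
    moreover have "int_prod Z (lie_deriv M (br X Y) \<omega>) r =
        lie_deriv M (br X Y) (int_prod Z \<omega>) r - int_prod (br (br X Y) Z) \<omega> r"
      by (rule int_prod_lie_deriv[OF V(1) r VF_br[OF V(1) X Y] Z \<omega>])
    moreover have "lie_deriv M (br X Y) (int_prod Z \<omega>) r =
        lie_deriv M X (lie_deriv M Y (int_prod Z \<omega>)) r - lie_deriv M Y (lie_deriv M X (int_prod Z \<omega>)) r"
    proof (rule Suc.IH[OF V(1) X Y _ r])
      show "FM k V (int_prod Z \<omega>)" using FM_int_prod[OF \<omega> Z] by simp
    qed
    ultimately show "int_prod Z (lie_deriv M (br X Y) \<omega>) r =
        int_prod Z (lie_deriv M X (lie_deriv M Y \<omega>) - lie_deriv M Y (lie_deriv M X \<omega>)) r"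
      unfolding int_prod_diff key[OF X Y] key[OF Y X] by simp
  qed
  then show ?case by simp
qed

text \<open>After contraction with \<open>Y\<close>, Cartan's formula and
  \<open>lie_deriv_br\<close> express both sides by the same Lie derivatives and the same
  contraction with \<open>[X, Y]\<close>. What remains is the claim for the contracted form; as an
  assumption it can come from an induction hypothesis or, in degree 0, from the vanishing of
  contractions.\<close>

lemma lie_deriv_ext_deriv_step:
  assumes W: "opn W" and X: "VF W X" and \<omega>: "FM k W \<omega>" and q: "q \<in> W"
    and IH: "\<And>V Y r. opn V \<Longrightarrow> V \<subseteq> W \<Longrightarrow> VF V Y \<Longrightarrow> r \<in> V \<Longrightarrow>
      lie_deriv M X (ext_deriv M (int_prod Y \<omega>)) r = ext_deriv M (lie_deriv M X (int_prod Y \<omega>)) r"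
  shows "lie_deriv M X (ext_deriv M \<omega>) q = ext_deriv M (lie_deriv M X \<omega>) q"
proof (rule FM_eqI_int_prod[OF W _ _ _ q])
  show "FM (Suc k) W (lie_deriv M X (ext_deriv M \<omega>))"
    by (intro FM_lie_deriv FM_ext_deriv W X \<omega>)
  show "FM (Suc k) W (ext_deriv M (lie_deriv M X \<omega>))"
    by (intro FM_lie_deriv FM_ext_deriv W X \<omega>)
  fix V Y r assume V: "opn V" "V \<subseteq> W" and Y: "VF V Y" and r: "r \<in> V"
  note IH = IH[OF V Y r]
  note X = VF_subset[OF V(2) X] and \<omega> = FM_subset[OF V(2) \<omega>]
  note i = FM_int_prod[OF \<omega> Y] and b = VF_br[OF V(1) X Y]
  have "int_prod Y (lie_deriv M X (ext_deriv M \<omega>)) r =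
      lie_deriv M X (int_prod Y (ext_deriv M \<omega>)) r - int_prod (br X Y) (ext_deriv M \<omega>) r"
    by (rule int_prod_lie_deriv[OF V(1) r X Y FM_ext_deriv[OF V(1) \<omega>]])
  also have "lie_deriv M X (int_prod Y (ext_deriv M \<omega>)) r =
      lie_deriv M X (lie_deriv M Y \<omega> - ext_deriv M (int_prod Y \<omega>)) r"
    by (rule lie_deriv_cong[OF V(1) r X]) (simp add: int_prod_ext_deriv[OF V(1) _ Y \<omega>])
  also have "\<dots> = lie_deriv M X (lie_deriv M Y \<omega>) r - lie_deriv M X (ext_deriv M (int_prod Y \<omega>)) r"
    by (rule lie_deriv_diff[OF V(1) r X FM_lie_deriv[OF V(1) Y \<omega>] FM_ext_deriv[OF V(1) i]])
  also have "int_prod (br X Y) (ext_deriv M \<omega>) r =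
      lie_deriv M (br X Y) \<omega> r - ext_deriv M (int_prod (br X Y) \<omega>) r"
    by (rule int_prod_ext_deriv[OF V(1) r b \<omega>])
  also have "lie_deriv M (br X Y) \<omega> r = lie_deriv M X (lie_deriv M Y \<omega>) r - lie_deriv M Y (lie_deriv M X \<omega>) r"
    by (rule lie_deriv_br[OF V(1) X Y \<omega> r])
  finally have 1: "int_prod Y (lie_deriv M X (ext_deriv M \<omega>)) r =
      lie_deriv M Y (lie_deriv M X \<omega>) r - ext_deriv M (lie_deriv M X (int_prod Y \<omega>)) r +
      ext_deriv M (int_prod (br X Y) \<omega>) r" using IH by (simp add: fun_eq_iff)
  have "int_prod Y (ext_deriv M (lie_deriv M X \<omega>)) r =
      lie_deriv M Y (lie_deriv M X \<omega>) r - ext_deriv M (int_prod Y (lie_deriv M X \<omega>)) r"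
    by (rule int_prod_ext_deriv[OF V(1) r Y FM_lie_deriv[OF V(1) X \<omega>]])
  also have "ext_deriv M (int_prod Y (lie_deriv M X \<omega>)) r =
      ext_deriv M (lie_deriv M X (int_prod Y \<omega>) - int_prod (br X Y) \<omega>) r"
    by (rule ext_deriv_cong[OF V(1) r]) (simp add: int_prod_lie_deriv[OF V(1) _ X Y \<omega>])
  also have "\<dots> = ext_deriv M (lie_deriv M X (int_prod Y \<omega>)) r - ext_deriv M (int_prod (br X Y) \<omega>) r"
    by (rule ext_deriv_diff[OF V(1) r FM_lie_deriv[OF V(1) X i] FM_int_prod[OF \<omega> b]])
  finally show "int_prod Y (lie_deriv M X (ext_deriv M \<omega>)) r = int_prod Y (ext_deriv M (lie_deriv M X \<omega>)) r"
    unfolding 1 by (simp add: fun_eq_iff)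
qed

lemma lie_deriv_ext_deriv:
  assumes "opn W" "VF W X" "FM k W \<omega>" "q \<in> W"
  shows "lie_deriv M X (ext_deriv M \<omega>) q = ext_deriv M (lie_deriv M X \<omega>) q"
  using assms
proof (induction k arbitrary: W \<omega> q)
  case (0 W \<omega> q)
  show ?case
  proof (rule lie_deriv_ext_deriv_step[OF 0(1-4)])
    fix V Y r assume V: "opn V" "V \<subseteq> W" "VF V Y" "r \<in> V"
    note X = VF_subset[OF V(2) 0(2)]
    \<comment> \<open>Contractions of functions vanish, so the assumption of the step reads
      \<open>0 = 0\<close>.\<close>
    have z: "int_prod Y \<omega> s = 0" if "s \<in> V" for s
      using int_prod_degree_0[OF 0(3)] that V(2) by blast
    have "lie_deriv M X (ext_deriv M (int_prod Y \<omega>)) r = lie_deriv M X (\<lambda>_. 0) r"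
    proof (rule lie_deriv_cong[OF V(1,4) X])
      fix s assume s: "s \<in> V"
      show "ext_deriv M (int_prod Y \<omega>) s = 0"
        using ext_deriv_cong[OF V(1) s, of "int_prod Y \<omega>" "\<lambda>_. 0"] z ext_deriv_zero by simp
    qed
    moreover have "ext_deriv M (lie_deriv M X (int_prod Y \<omega>)) r = ext_deriv M (\<lambda>_. 0) r"
    proof (rule ext_deriv_cong[OF V(1,4)])
      fix s assume s: "s \<in> V"
      show "lie_deriv M X (int_prod Y \<omega>) s = 0"
        using lie_deriv_cong[OF V(1) s X, of "int_prod Y \<omega>" "\<lambda>_. 0"] z lie_deriv_zero[OF s X] by simp
    qed
    ultimately show "lie_deriv M X (ext_deriv M (int_prod Y \<omega>)) r = ext_deriv M (lie_deriv M X (int_prod Y \<omega>)) r"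
      using lie_deriv_zero[OF V(4) X] ext_deriv_zero by simp
  qed
next
  case (Suc k W \<omega> q)
  show ?case
  proof (rule lie_deriv_ext_deriv_step[OF Suc.prems])
    fix V Y r assume V: "opn V" "V \<subseteq> W" "VF V Y" "r \<in> V"
    show "lie_deriv M X (ext_deriv M (int_prod Y \<omega>)) r = ext_deriv M (lie_deriv M X (int_prod Y \<omega>)) r"
      using Suc.IH[OF V(1) VF_subset[OF V(2) Suc.prems(2)] _ V(4)]
        FM_int_prod[OF FM_subset[OF V(2) Suc.prems(3)] V(3)] by simp
  qed
qed

text \<open>By Cartan's formula the contraction of \<open>d\<^sup>2 \<omega>\<close> is
  \<open>L\<^sub>Y d\<omega> - d(L\<^sub>Y \<omega> - d i\<^sub>Y \<omega>)\<close>. Since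
  \<open>L\<^sub>Y\<close> and d commute, only \<open>d\<^sup>2 i\<^sub>Y \<omega>\<close> is
  left.\<close>

lemma ext_deriv_ext_deriv_step:
  assumes W: "opn W" and \<omega>: "FM k W \<omega>" and q: "q \<in> W"
    and IH: "\<And>V Y r. opn V \<Longrightarrow> V \<subseteq> W \<Longrightarrow> VF V Y \<Longrightarrow> r \<in> V \<Longrightarrow> ext_deriv M (ext_deriv M (int_prod Y \<omega>)) r = 0"
  shows "ext_deriv M (ext_deriv M \<omega>) q = 0"
proof -
  have "ext_deriv M (ext_deriv M \<omega>) q = (\<lambda>_. 0) q"
  proof (rule FM_eqI_int_prod[OF W FM_ext_deriv[OF W FM_ext_deriv[OF W \<omega>]] FM_zero _ q])
    fix V Y r assume V: "opn V" "V \<subseteq> W" and Y: "VF V Y" and r: "r \<in> V"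
    note IH = IH[OF V Y r]
    note \<omega> = FM_subset[OF V(2) \<omega>]
    have "int_prod Y (ext_deriv M (ext_deriv M \<omega>)) r =
        lie_deriv M Y (ext_deriv M \<omega>) r - ext_deriv M (int_prod Y (ext_deriv M \<omega>)) r"
      by (rule int_prod_ext_deriv[OF V(1) r Y FM_ext_deriv[OF V(1) \<omega>]])
    also have "ext_deriv M (int_prod Y (ext_deriv M \<omega>)) r =
        ext_deriv M (lie_deriv M Y \<omega> - ext_deriv M (int_prod Y \<omega>)) r"
      by (rule ext_deriv_cong[OF V(1) r]) (simp add: int_prod_ext_deriv[OF V(1) _ Y \<omega>])
    also have "\<dots> = ext_deriv M (lie_deriv M Y \<omega>) r - ext_deriv M (ext_deriv M (int_prod Y \<omega>)) r"
      by (rule ext_deriv_diff[OF V(1) r FM_lie_deriv[OF V(1) Y \<omega>] FM_ext_deriv[OF V(1) FM_int_prod[OF \<omega> Y]]])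
    finally show "int_prod Y (ext_deriv M (ext_deriv M \<omega>)) r = int_prod Y (\<lambda>_. 0) r"
      using IH lie_deriv_ext_deriv[OF V(1) Y \<omega> r] by (simp add: int_prod_zero fun_eq_iff)
  qed
  then show ?thesis .
qed

lemma ext_deriv_ext_deriv:
  assumes "opn W" "FM k W \<omega>" "q \<in> W"
  shows "ext_deriv M (ext_deriv M \<omega>) q = 0"
  using assms
proof (induction k arbitrary: W \<omega> q)
  case (0 W \<omega> q)
  show ?case
  proof (rule ext_deriv_ext_deriv_step[OF 0(1-3)])
    fix V Y r assume V: "opn V" "V \<subseteq> W" "VF V Y" "r \<in> V"
    have "ext_deriv M (ext_deriv M (int_prod Y \<omega>)) r = ext_deriv M (\<lambda>_. 0) r"
    proof (rule ext_deriv_cong[OF V(1,4)])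
      fix s assume s: "s \<in> V"
      have "ext_deriv M (int_prod Y \<omega>) s = ext_deriv M (\<lambda>_. 0) s"
        by (rule ext_deriv_cong[OF V(1) s]) (rule int_prod_degree_0[OF FM_subset[OF V(2) 0(2)]])
      then show "ext_deriv M (int_prod Y \<omega>) s = 0" using ext_deriv_zero by simp
    qed
    then show "ext_deriv M (ext_deriv M (int_prod Y \<omega>)) r = 0" using ext_deriv_zero by simp
  qed
next
  case (Suc k W \<omega> q)
  show ?case
  proof (rule ext_deriv_ext_deriv_step[OF Suc.prems])
    fix V Y r assume V: "opn V" "V \<subseteq> W" "VF V Y" "r \<in> V"
    have "FM k V (int_prod Y \<omega>)"
      using FM_int_prod[OF FM_subset[OF V(2) Suc.prems(2)] V(3)] by simp
    from Suc.IH[OF V(1) this V(4)] show "ext_deriv M (ext_deriv M (int_prod Y \<omega>)) r = 0" .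
  qed
qed

end


section \<open>Local frames\<close>

text \<open>A repeated member of the family would satisfy a relation with coefficients 1 and -1, so
  the vanishing of coefficients gives injectivity as well as independence of the image set;
  \<open>vector_bundle\<close> asks for both.\<close>

lemma frame_independent:
  fixes e :: "'i \<Rightarrow> 'v::real_vector"
  assumes I: "finite I"
    and zero: "\<And>a i. (\<Sum>i\<in>I. a i *\<^sub>R e i) = 0 \<Longrightarrow> i \<in> I \<Longrightarrow> a i = 0"
  shows "inj_on e I" "independent (e ` I)"
proof -
  show inj: "inj_on e I"
  proof (rule inj_onI, rule ccontr)
    fix i j assume ij: "i \<in> I" "j \<in> I" "e i = e j" "i \<noteq> j"
    define a :: "'i \<Rightarrow> real" where "a k = (if k = i then 1 else if k = j then -1 else 0)" for k
    have "(\<Sum>k\<in>I. a k *\<^sub>R e k) = (\<Sum>k\<in>{i, j}. a k *\<^sub>R e k)"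
      by (rule sum.mono_neutral_right) (use ij I in \<open>auto simp: a_def\<close>)
    also have "\<dots> = 0" using ij by (simp add: a_def)
    finally have "a i = 0" using zero ij by blast
    then show False by (simp add: a_def)
  qed
  show "independent (e ` I)"
  proof (rule independent_if_scalars_zero)
    show "finite (e ` I)" using I by simp
    fix f x assume "(\<Sum>x\<in>e ` I. f x *\<^sub>R x) = 0" "x \<in> e ` I"
    then show "f x = 0" using zero[of "f \<circ> e"] by (auto simp: sum.reindex[OF inj])
  qed
qed

lemma span_frame:
  fixes e :: "'i \<Rightarrow> 'v::real_vector"
  assumes "subspace F" "\<And>i. i \<in> I \<Longrightarrow> e i \<in> F" "\<And>v. v \<in> F \<Longrightarrow> \<exists>a. v = (\<Sum>i\<in>I. a i *\<^sub>R e i)"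
  shows "span (e ` I) = F"
proof
  show "span (e ` I) \<subseteq> F" using assms(1,2) by (intro span_minimal) auto
  show "F \<subseteq> span (e ` I)"
  proof
    fix v assume "v \<in> F"
    then obtain a where "v = (\<Sum>i\<in>I. a i *\<^sub>R e i)" using assms(3) by blast
    then show "v \<in> span (e ` I)" by (auto intro: span_sum span_scale span_base)
  qed
qed

abbreviation sum_frame :: "('i \<Rightarrow> 'p \<Rightarrow> 'v::real_vector) \<Rightarrow> ('j \<Rightarrow> 'p \<Rightarrow> 'w::real_vector) \<Rightarrow> 'i + 'j \<Rightarrow> 'p \<Rightarrow> 'v \<times> 'w"
  where "sum_frame e e' \<equiv> case_sum (\<lambda>i p. (e i p, 0)) (\<lambda>j p. (0, e' j p))"

lemma sum_frame_lincomb: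
  assumes "finite I" "finite J"
  shows "(\<Sum>k\<in>I <+> J. c k p *\<^sub>R sum_frame e e' k p) =
    (\<Sum>i\<in>I. c (Inl i) p *\<^sub>R e i p, \<Sum>j\<in>J. c (Inr j) p *\<^sub>R e' j p)"
  by (simp add: sum.Plus assms prod_eq_iff fst_sum snd_sum)

lemma smooth_in_sum_frame:
  assumes "finite I" "finite J"
  shows "smooth_in_frame M (I <+> J) (sum_frame e e') W s \<longleftrightarrow>
    smooth_in_frame M I e W (\<lambda>p. fst (s p)) \<and> smooth_in_frame M J e' W (\<lambda>p. snd (s p))"
proof
  assume "smooth_in_frame M (I <+> J) (sum_frame e e') W s"
  then obtain c where c: "\<forall>k\<in>I <+> J. smooth_fun_on M W (c k)"
    "\<forall>p\<in>W. s p = (\<Sum>k\<in>I <+> J. c k p *\<^sub>R sum_frame e e' k p)"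
    unfolding smooth_in_frame_def by blast
  then show "smooth_in_frame M I e W (\<lambda>p. fst (s p)) \<and> smooth_in_frame M J e' W (\<lambda>p. snd (s p))"
    unfolding smooth_in_frame_def sum_frame_lincomb[OF assms]
    by (intro conjI exI[of _ "c \<circ> Inl"] exI[of _ "c \<circ> Inr"]) auto
next
  assume "smooth_in_frame M I e W (\<lambda>p. fst (s p)) \<and> smooth_in_frame M J e' W (\<lambda>p. snd (s p))"
  then obtain c d where "\<forall>i\<in>I. smooth_fun_on M W (c i)" "\<forall>p\<in>W. fst (s p) = (\<Sum>i\<in>I. c i p *\<^sub>R e i p)"
    "\<forall>j\<in>J. smooth_fun_on M W (d j)" "\<forall>p\<in>W. snd (s p) = (\<Sum>j\<in>J. d j p *\<^sub>R e' j p)"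
    unfolding smooth_in_frame_def by blast
  then show "smooth_in_frame M (I <+> J) (sum_frame e e') W s"
    unfolding smooth_in_frame_def sum_frame_lincomb[OF assms]
    by (intro exI[of _ "case_sum c d"]) (auto simp: prod_eq_iff)
qed

definition index_lists :: "nat \<Rightarrow> nat \<Rightarrow> nat list set"
  where "index_lists m n = {I. length I = n \<and> sorted_wrt (<) I \<and> set I \<subseteq> {..<m}}"

lemma finite_index_lists: "finite (index_lists m n)"
  by (rule finite_subset[OF _ finite_lists_length_eq[of "{..<m}" n]]) (auto simp: index_lists_def)

context smooth_mfd begin

text \<open>The coefficients of a field in the coordinate frame are its values on the coordinate
  functions. This connects the frame-based sections with the chart-free notion
  \<open>VF\<close>.\<close>

lemma smooth_in_coord_vec_iff:
  assumes c: "(U, \<phi>) \<in> atlas M" and W: "opn W" "W \<subseteq> U"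
  shows "smooth_in_frame M {..<mdim M} (coord_vec M (U, \<phi>)) W X \<longleftrightarrow> VF W X"
proof
  assume "smooth_in_frame M {..<mdim M} (coord_vec M (U, \<phi>)) W X"
  then obtain a where a: "\<And>i. i \<in> {..<mdim M} \<Longrightarrow> C W (a i)"
    "\<And>p. p \<in> W \<Longrightarrow> X p = (\<Sum>i<mdim M. a i p *\<^sub>R coord_vec M (U, \<phi>) i p)"
    unfolding smooth_in_frame_def by blast
  have "VF W (\<lambda>p. \<Sum>i<mdim M. a i p *\<^sub>R coord_vec M (U, \<phi>) i p)"
    using a(1) VF_coord_vec[OF c] by (intro VF_sum VF_scale VF_subset[OF W(2)]) auto
  then show "VF W X" by (rule VF_cong) (simp add: a(2))
next
  assume X: "VF W X"
  have "C W (\<lambda>p. X p (\<lambda>r. \<phi> r i))" for i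
    by (rule VF_C[OF X W(1) subset_refl C_coord[OF c W]])
  then show "smooth_in_frame M {..<mdim M} (coord_vec M (U, \<phi>)) W X"
    unfolding smooth_in_frame_def
    using tangent_expand[OF c _ VF_tan[OF X]] W(2)
    by (intro exI[of _ "\<lambda>i p. X p (\<lambda>r. \<phi> r i)"]) auto
qed

lemma coord_vec_coeff:
  assumes "(U, \<phi>) \<in> atlas M" "p \<in> U" "(\<Sum>i<mdim M. a i *\<^sub>R coord_vec M (U, \<phi>) i p) = 0" "i < mdim M"
  shows "a i = 0"
proof -
  have "0 = (\<Sum>j<mdim M. a j *\<^sub>R coord_vec M (U, \<phi>) j p) (\<lambda>r. \<phi> r i)" using assms(3) by simp
  also have "\<dots> = (\<Sum>j<mdim M. if j = i then a i else 0)"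
    unfolding sum_fun_apply scaleR_fun_def
    by (rule sum.cong) (auto simp: coord_vec_coord[OF assms(1,2)])
  finally show ?thesis using assms(4) by simp
qed


section \<open>Coordinate forms\<close>

text \<open>In the permutation sum each product contains every entry exactly once, hence linearity.
  If two adjacent entries agree, composing each permutation with their transposition reverses all
  signs, so the sum equals its negative.\<close>

lemma coord_form_alt: "coord_form M c I p \<in> alt_forms (T p) (length I)"
proof (rule alt_formsI[OF subspace_tangent])
  define G where "G vs = (\<Sum>\<sigma> | \<sigma> permutes {..<length I}. of_int (sign \<sigma>) *
    (\<Prod>j<length I. (vs ! j) (\<lambda>q. snd c q (I ! \<sigma> j))))" for vs :: "'p tvec list"
  have cf: "coord_form M c I p vs = (if length vs = length I \<and> set vs \<subseteq> T p then G vs else 0)" for vs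
    by (simp add: coord_form_def G_def)
  show "coord_form M c I p vs \<noteq> 0 \<Longrightarrow> length vs = length I \<and> set vs \<subseteq> T p" for vs
    by (auto simp: cf split: if_splits)
  fix us ws x y d assume m: "set us \<subseteq> T p" "x \<in> T p" "set ws \<subseteq> T p"
  define k where "k = length us"
  \<comment> \<open>The other factors do not see slot \<open>k\<close>; the dummy entry 0 makes
    their independence of \<open>z\<close> visible.\<close>
  have fac: "(\<Prod>j<length I. ((us @ z # ws) ! j) (h j)) = z (h k) * (\<Prod>j\<in>{..<length I} - {k}. ((us @ 0 # ws) ! j) (h j))"
    if "k < length I" for z and h :: "nat \<Rightarrow> 'p \<Rightarrow> real"
  proof -
    have "(\<Prod>j<length I. ((us @ z # ws) ! j) (h j)) =
        ((us @ z # ws) ! k) (h k) * (\<Prod>j\<in>{..<length I} - {k}. ((us @ z # ws) ! j) (h j))"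
      using that by (intro prod.remove) auto
    also have "(\<Prod>j\<in>{..<length I} - {k}. ((us @ z # ws) ! j) (h j)) =
        (\<Prod>j\<in>{..<length I} - {k}. ((us @ 0 # ws) ! j) (h j))"
      by (rule prod.cong) (auto simp: nth_append k_def nth_Cons')
    finally show ?thesis by (simp add: k_def)
  qed
  show "coord_form M c I p (us @ (d *\<^sub>R x) # ws) = d * coord_form M c I p (us @ x # ws)"
  proof (cases "length (us @ x # ws) = length I")
    case True
    then have k: "k < length I" by (simp add: k_def)
    have "G (us @ (d *\<^sub>R x) # ws) = d * G (us @ x # ws)"
      unfolding G_def fac[OF k] sum_distrib_left by (rule sum.cong) (auto simp: scaleR_fun_def)
    then show ?thesis using m True subspace_scale[OF subspace_tangent m(2)] by (simp add: cf)
  qed (auto simp: cf)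
  show "coord_form M c I p (us @ x # x # ws) = 0"
  proof (cases "length (us @ x # x # ws) = length I")
    case True
    let ?vs = "us @ x # x # ws" and ?t = "Transposition.transpose k (Suc k)"
    have k: "k < length I" "Suc k < length I" using True by (auto simp: k_def)
    have t: "?t permutes {..<length I}" using k by (intro permutes_swap_id) auto
    have sym: "?vs ! ?t j = ?vs ! j" for j
      by (cases "j = k \<or> j = Suc k") (auto simp: k_def nth_append Transposition.transpose_def)
    have "G ?vs = (\<Sum>\<sigma> | \<sigma> permutes {..<length I}. of_int (sign (\<sigma> \<circ> ?t)) *
        (\<Prod>j<length I. (?vs ! j) (\<lambda>q. snd c q (I ! (\<sigma> \<circ> ?t) j))))"
      unfolding G_def by (rule sum_permutations_compose_right[OF t])
    also have "\<dots> = (\<Sum>\<sigma> | \<sigma> permutes {..<length I}. - (of_int (sign \<sigma>) *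
        (\<Prod>j<length I. (?vs ! j) (\<lambda>q. snd c q (I ! \<sigma> j)))))"
    proof (rule sum.cong[OF refl])
      fix \<sigma> assume "\<sigma> \<in> {\<sigma>. \<sigma> permutes {..<length I}}"
      then have \<sigma>: "\<sigma> permutes {..<length I}" by simp
      have "sign (\<sigma> \<circ> ?t) = - sign \<sigma>"
        using sign_compose[OF permutes_imp_permutation[OF _ \<sigma>] permutes_imp_permutation[OF _ t]]
        by (simp add: sign_swap_id)
      moreover have "(\<Prod>j<length I. (?vs ! j) (\<lambda>q. snd c q (I ! \<sigma> j))) =
          (\<Prod>j<length I. (?vs ! ?t j) (\<lambda>q. snd c q (I ! \<sigma> (?t j))))"
        using prod.permute[OF t, of "\<lambda>j. (?vs ! j) (\<lambda>q. snd c q (I ! \<sigma> j))"] by (simp add: comp_def)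
      ultimately show "of_int (sign (\<sigma> \<circ> ?t)) * (\<Prod>j<length I. (?vs ! j) (\<lambda>q. snd c q (I ! (\<sigma> \<circ> ?t) j))) =
          - (of_int (sign \<sigma>) * (\<Prod>j<length I. (?vs ! j) (\<lambda>q. snd c q (I ! \<sigma> j))))"
        by (simp add: sym)
    qed
    also have "\<dots> = - G ?vs" by (simp add: G_def sum_negf)
    finally show ?thesis by (simp add: cf)
  qed (auto simp: cf)
  assume y: "y \<in> T p"
  show "coord_form M c I p (us @ (x + y) # ws) = coord_form M c I p (us @ x # ws) + coord_form M c I p (us @ y # ws)"
  proof (cases "length (us @ x # ws) = length I")
    case True
    then have k: "k < length I" by (simp add: k_def)
    have "G (us @ (x + y) # ws) = G (us @ x # ws) + G (us @ y # ws)"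
      unfolding G_def fac[OF k] sum.distrib[symmetric] by (rule sum.cong) (auto simp: algebra_simps)
    then show ?thesis using m y True subspace_add[OF subspace_tangent m(2) y] by (simp add: cf)
  qed (auto simp: cf)
qed

text \<open>A product in the permutation sum is nonzero only if the permutation carries
  \<open>I\<close> entrywise to \<open>K\<close>. Then both strictly increasing lists have the same
  set, so they coincide, and distinctness makes the permutation the identity.\<close>

lemma coord_form_coord_vec:
  assumes c: "(U, \<phi>) \<in> atlas M" and p: "p \<in> U"
    and I: "I \<in> index_lists (mdim M) n" and K: "K \<in> index_lists (mdim M) n"
  shows "coord_form M (U, \<phi>) I p (map (\<lambda>i. coord_vec M (U, \<phi>) i p) K) = (if I = K then 1 else 0)"
proof -
  let ?e = "\<lambda>i. coord_vec M (U, \<phi>) i p"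
  have len: "length I = n" "length K = n" and sI: "sorted_wrt (<) I" and sK: "sorted_wrt (<) K"
    and rK: "set K \<subseteq> {..<mdim M}" using I K by (auto simp: index_lists_def)
  have t: "set (map ?e K) \<subseteq> T p" using coord_vec_tangent[OF c p] rK by auto
  have trm: "(\<Prod>j<n. (map ?e K ! j) (\<lambda>q. \<phi> q (I ! \<sigma> j))) = (if I = K \<and> \<sigma> = id then 1 else 0)"
    if \<sigma>: "\<sigma> permutes {..<n}" for \<sigma>
  proof -
    have f: "(map ?e K ! j) (\<lambda>q. \<phi> q (I ! \<sigma> j)) = (if K ! j = I ! \<sigma> j then 1 else 0)" if "j < n" for j
    proof -
      have "K ! j \<in> set K" using that len by simp
      then have "K ! j < mdim M" using rK by auto
      from coord_vec_coord[OF c p this, of "I ! \<sigma> j"] show ?thesis using that len by simp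
    qed
    show ?thesis
    proof (cases "\<forall>j<n. K ! j = I ! \<sigma> j")
      case True
      have "set K = set I"
      proof -
        have "set K = (\<lambda>j. K ! j) ` {..<n}" using len by (auto simp: set_conv_nth)
        also have "\<dots> = (\<lambda>j. I ! \<sigma> j) ` {..<n}" using True by auto
        also have "\<dots> = (\<lambda>j. I ! j) ` \<sigma> ` {..<n}" by auto
        also have "\<dots> = set I" unfolding permutes_image[OF \<sigma>] using len by (auto simp: set_conv_nth)
        finally show ?thesis .
      qed
      then have IK: "I = K" using sI sK by (intro sorted_distinct_set_unique) (auto simp: strict_sorted_iff)
      have "\<sigma> j = j" for j
      proof (cases "j < n")
        case True
        then have "\<sigma> j < n" using permutes_in_image[OF \<sigma>, of j] by simp
        moreover have "I ! j = I ! \<sigma> j" using \<open>\<forall>j<n. K ! j = I ! \<sigma> j\<close> True IK by simp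
        moreover have "distinct I" using sI by (simp add: strict_sorted_iff)
        ultimately show ?thesis using True len nth_eq_iff_index_eq by metis
      next
        case False
        then show ?thesis using permutes_not_in[OF \<sigma>] by simp
      qed
      then have "\<sigma> = id" by auto
      then show ?thesis using IK True f by (auto intro!: prod.neutral)
    next
      case False
      then obtain j where "j < n" "K ! j \<noteq> I ! \<sigma> j" by blast
      then have "(\<Prod>j<n. (map ?e K ! j) (\<lambda>q. \<phi> q (I ! \<sigma> j))) = 0"
        using f by (intro prod_zero) auto
      moreover have "\<not> (I = K \<and> \<sigma> = id)" using False by auto
      ultimately show ?thesis by (simp only: if_False)
    qed
  qed
  have "coord_form M (U, \<phi>) I p (map ?e K) =
      (\<Sum>\<sigma> | \<sigma> permutes {..<n}. of_int (sign \<sigma>) * (\<Prod>j<n. (map ?e K ! j) (\<lambda>q. \<phi> q (I ! \<sigma> j))))"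
    using t len by (simp add: coord_form_def)
  also have "\<dots> = (\<Sum>\<sigma> | \<sigma> permutes {..<n}. if \<sigma> = id then (if I = K then 1 else 0) else 0)"
    by (rule sum.cong[OF refl]) (auto simp: trm sign_id)
  also have "\<dots> = (if I = K then 1 else 0)"
    using permutes_id[of "{..<n}"] finite_permutations[of "{..<n}"] by (subst sum.delta) auto
  finally show ?thesis .
qed

text \<open>Expanding every argument in coordinate vectors leaves index lists. Those with
  repetitions contribute nothing, and the others can be sorted without affecting vanishing.\<close>

lemma alt_zero_if_coord_zero:
  assumes c: "(U, \<phi>) \<in> atlas M" and p: "p \<in> U" and \<omega>: "\<omega> \<in> alt_forms (T p) n"
    and z: "\<And>K. K \<in> index_lists (mdim M) n \<Longrightarrow> \<omega> (map (\<lambda>i. coord_vec M (U, \<phi>) i p) K) = 0"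
  shows "\<omega> = 0"
proof
  let ?e = "\<lambda>i. coord_vec M (U, \<phi>) i p"
  have t: "set (map ?e L) \<subseteq> T p" if "set L \<subseteq> {..<mdim M}" for L
    using coord_vec_tangent[OF c p] that by auto
  have idx: "\<omega> (map ?e L) = 0" if L: "set L \<subseteq> {..<mdim M}" for L
  proof (cases "length L = n \<and> distinct L")
    case True
    then have "sort L \<in> index_lists (mdim M) n"
      using L by (simp add: index_lists_def strict_sorted_iff)
    moreover have "mset (map ?e L) = mset (map ?e (sort L))" by simp
    ultimately show ?thesis
      using alt_mset_zero_iff[OF subspace_tangent \<omega>, of "map ?e L" "map ?e (sort L)" "[]"] z t[OF L] by simp
  next
    case False
    then show ?thesis
      using alt_length[OF \<omega>, of "map ?e L"] alt_not_distinct[OF \<omega>, of "map ?e L"] by (auto simp: distinct_map)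
  qed
  \<comment> \<open>\<open>L\<close> records the leading arguments already replaced by coordinate
    vectors.\<close>
  have "\<omega> (map ?e L @ vs) = 0" if "set L \<subseteq> {..<mdim M}" "set vs \<subseteq> T p" for L vs
    using that
  proof (induction vs arbitrary: L)
    case Nil
    then show ?case using idx by simp
  next
    case (Cons v vs)
    have "\<omega> (map ?e L @ v # vs) = \<omega> (map ?e L @ (\<Sum>i<mdim M. v (\<lambda>r. \<phi> r i) *\<^sub>R ?e i) # vs)"
      using tangent_expand[OF c p, of v] Cons.prems(2) by simp
    also have "\<dots> = (\<Sum>i<mdim M. v (\<lambda>r. \<phi> r i) * \<omega> (map ?e L @ ?e i # vs))"
      using Cons.prems t[OF Cons.prems(1)] coord_vec_tangent[OF c p]
      by (intro alt_sum_entry[OF subspace_tangent \<omega>]) auto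
    also have "\<dots> = 0"
    proof (intro sum.neutral ballI)
      fix i assume "i \<in> {..<mdim M}"
      then show "v (\<lambda>r. \<phi> r i) * \<omega> (map ?e L @ ?e i # vs) = 0"
        using Cons.IH[of "L @ [i]"] Cons.prems by simp
    qed
    finally show ?case .
  qed
  from this[of "[]"] show "\<omega> vs = 0 vs" for vs
    using alt_support[OF \<omega>, of vs] by (cases "set vs \<subseteq> T p") auto
qed

lemma coord_form_apply_sum:
  assumes c: "(U, \<phi>) \<in> atlas M" and p: "p \<in> U" and K: "K \<in> index_lists (mdim M) n"
  shows "(\<Sum>I\<in>index_lists (mdim M) n. a I *\<^sub>R coord_form M (U, \<phi>) I p) (map (\<lambda>i. coord_vec M (U, \<phi>) i p) K) = a K"
proof -
  have "(\<Sum>I\<in>index_lists (mdim M) n. a I *\<^sub>R coord_form M (U, \<phi>) I p) (map (\<lambda>i. coord_vec M (U, \<phi>) i p) K) =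
      (\<Sum>I\<in>index_lists (mdim M) n. if I = K then a K else 0)"
    unfolding sum_fun_apply scaleR_fun_def
    by (rule sum.cong) (auto simp: coord_form_coord_vec[OF c p _ K])
  then show ?thesis using K finite_index_lists by simp
qed

lemma coord_form_sum_alt:
  "(\<Sum>I\<in>index_lists (mdim M) n. a I *\<^sub>R coord_form M c I p) \<in> alt_forms (T p) n"
proof (intro subspace_sum subspace_scale subspace_alt_forms subspace_tangent)
  fix I assume "I \<in> index_lists (mdim M) n"
  then show "coord_form M c I p \<in> alt_forms (T p) n"
    using coord_form_alt[of c I p] by (simp add: index_lists_def)
qed

text \<open>By duality the difference of both sides vanishes on increasing tuples of coordinate
  vectors, hence altogether.\<close>

lemma alt_expand:
  assumes c: "(U, \<phi>) \<in> atlas M" and p: "p \<in> U" and \<omega>: "\<omega> \<in> alt_forms (T p) n"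
  shows "\<omega> = (\<Sum>I\<in>index_lists (mdim M) n.
    \<omega> (map (\<lambda>i. coord_vec M (U, \<phi>) i p) I) *\<^sub>R coord_form M (U, \<phi>) I p)" (is "\<omega> = ?S")
proof -
  have "\<omega> - ?S = 0"
  proof (rule alt_zero_if_coord_zero[OF c p])
    show "\<omega> - ?S \<in> alt_forms (T p) n"
      by (intro subspace_diff subspace_alt_forms subspace_tangent \<omega> coord_form_sum_alt)
    show "(\<omega> - ?S) (map (\<lambda>i. coord_vec M (U, \<phi>) i p) K) = 0" if "K \<in> index_lists (mdim M) n" for K
      using coord_form_apply_sum[OF c p that] by simp
  qed
  then show ?thesis by (rule eq_iff_diff_eq_0[THEN iffD2])
qed

lemma FM_coord_form:
  assumes c: "(U, \<phi>) \<in> atlas M" and n: "length I = n"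
  shows "FM n U (coord_form M (U, \<phi>) I)"
  unfolding FM_def
proof (intro conjI ballI allI impI, goal_cases)
  case (1 q)
  then show ?case using coord_form_alt n by blast
next
  case (2 W Ys)
  then have W: "opn W" "W \<subseteq> U" and Ys: "VFs W Ys" by auto
  show ?case
  proof (cases "length Ys = length I")
    case True
    have "C W (\<lambda>q. (ev q Ys ! j) (\<lambda>r. \<phi> r i))" if "j < length I" for i j
      using VF_C[OF _ W(1) subset_refl C_coord[OF c W], of "Ys ! j" i] Ys that True by simp
    then have "C W (\<lambda>q. \<Sum>\<sigma> | \<sigma> permutes {..<length I}. of_int (sign \<sigma>) *
        (\<Prod>j<length I. (ev q Ys ! j) (\<lambda>r. \<phi> r (I ! \<sigma> j))))"
      by (intro C_sum C_mult C_const C_prod W(1)) auto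
    then show ?thesis
      by (rule C_cong[OF W(1), rotated]) (use True ev_tan[OF Ys] in \<open>simp add: coord_form_def\<close>)
  next
    case False
    show ?thesis
      by (rule C_cong[OF W(1) _ C_const[OF W(1), of 0]]) (simp add: coord_form_def False)
  qed
qed

lemma FM_sum: "(\<And>i. i \<in> I \<Longrightarrow> FM n W (\<omega> i)) \<Longrightarrow> (\<And>i. i \<in> I \<Longrightarrow> C W (a i)) \<Longrightarrow>
  FM n W (\<lambda>q. \<Sum>i\<in>I. a i q *\<^sub>R \<omega> i q)"
proof (induction I rule: infinite_finite_induct)
  case (insert i I)
  have "FM n W (\<lambda>q. (\<Sum>i\<in>I. a i q *\<^sub>R \<omega> i q) + a i q *\<^sub>R \<omega> i q)"
    using insert by (intro FM_lincomb) auto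
  moreover have "(\<lambda>q. (\<Sum>i\<in>I. a i q *\<^sub>R \<omega> i q) + a i q *\<^sub>R \<omega> i q) =
      (\<lambda>q. \<Sum>i\<in>insert i I. a i q *\<^sub>R \<omega> i q)"
    unfolding sum.insert[OF insert.hyps] by (rule ext) (rule add.commute)
  ultimately show ?case by metis
qed (simp_all add: FM_zero)

lemma smooth_in_coord_form_iff:
  assumes c: "(U, \<phi>) \<in> atlas M" and W: "opn W" "W \<subseteq> U"
  shows "smooth_in_frame M (index_lists (mdim M) n) (coord_form M (U, \<phi>)) W \<omega> \<longleftrightarrow> FM n W \<omega>"
proof
  assume "smooth_in_frame M (index_lists (mdim M) n) (coord_form M (U, \<phi>)) W \<omega>"
  then obtain a where a: "\<And>I. I \<in> index_lists (mdim M) n \<Longrightarrow> C W (a I)"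
    "\<And>p. p \<in> W \<Longrightarrow> \<omega> p = (\<Sum>I\<in>index_lists (mdim M) n. a I p *\<^sub>R coord_form M (U, \<phi>) I p)"
    unfolding smooth_in_frame_def by blast
  have "FM n W (\<lambda>p. \<Sum>I\<in>index_lists (mdim M) n. a I p *\<^sub>R coord_form M (U, \<phi>) I p)"
    using a(1) by (intro FM_sum FM_subset[OF W(2) FM_coord_form[OF c]]) (auto simp: index_lists_def)
  then show "FM n W \<omega>" by (rule FM_cong) (simp add: a(2))
next
  assume \<omega>: "FM n W \<omega>"
  have "C W (\<lambda>p. \<omega> p (map (\<lambda>i. coord_vec M (U, \<phi>) i p) I))" if "I \<in> index_lists (mdim M) n" for I
  proof -
    have "VFs W (map (\<lambda>i. coord_vec M (U, \<phi>) i) I)"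
      using VF_subset[OF W(2) VF_coord_vec[OF c]] that by (auto simp: index_lists_def)
    from FM_C[OF \<omega> W(1) subset_refl this] show ?thesis by (simp add: comp_def)
  qed
  then show "smooth_in_frame M (index_lists (mdim M) n) (coord_form M (U, \<phi>)) W \<omega>"
    unfolding smooth_in_frame_def
    using alt_expand[OF c _ FM_alt[OF \<omega>]] W(2)
    by (intro exI[of _ "\<lambda>I p. \<omega> p (map (\<lambda>i. coord_vec M (U, \<phi>) i p) I)"]) auto
qed


section \<open>The bundle \<open>TM \<oplus> \<Lambda>\<^sup>n T\<^sup>*M\<close>\<close>

lemma higher_bundle_fidx: "fidx (higher_bundle M n) = {..<mdim M} <+> index_lists (mdim M) n"
  and higher_bundle_fibre: "fibre (higher_bundle M n) p = T p \<times> alt_forms (T p) n"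
  by (simp_all add: higher_bundle_def bundle_sum_def tangent_bundle_def form_bundle_def index_lists_def)

lemma higher_bundle_frames: "frames (higher_bundle M n) =
  {(U \<inter> V, sum_frame (coord_vec M (U, \<phi>)) (coord_form M (V, \<psi>))) | U \<phi> V \<psi>. (U, \<phi>) \<in> atlas M \<and> (V, \<psi>) \<in> atlas M}"
  by (fastforce simp: higher_bundle_def bundle_sum_def tangent_bundle_def form_bundle_def)

lemma smooth_in_higher_frame_iff:
  assumes c: "(U, \<phi>) \<in> atlas M" and d: "(V, \<psi>) \<in> atlas M" and W: "opn W" "W \<subseteq> U \<inter> V"
  shows "smooth_in_frame M ({..<mdim M} <+> index_lists (mdim M) n)
      (sum_frame (coord_vec M (U, \<phi>)) (coord_form M (V, \<psi>))) W e \<longleftrightarrow>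
    VF W (\<lambda>p. fst (e p)) \<and> FM n W (\<lambda>p. snd (e p))"
proof -
  have "W \<subseteq> U" "W \<subseteq> V" using W(2) by auto
  then show ?thesis
    unfolding smooth_in_sum_frame[OF finite_lessThan finite_index_lists]
    by (simp only: smooth_in_coord_vec_iff[OF c W(1)] smooth_in_coord_form_iff[OF d W(1)])
qed

text \<open>Being a smooth field or form is a local property, so frames built from one chart suffice
  in one direction. In the other, two charts occur, since the frames of the sum combine any frame of
  one bundle with any frame of the other.\<close>

lemma higher_section_iff:
  "e \<in> sections M (higher_bundle M n) \<longleftrightarrow>
    VF (topspace (mtop M)) (vf_part e) \<and> FM n (topspace (mtop M)) (form_part e) \<and>
    (\<forall>p. p \<notin> topspace (mtop M) \<longrightarrow> e p = 0)" (is "_ \<longleftrightarrow> ?R")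
proof
  have X: "vf_part e = (\<lambda>p. fst (e p))" by (simp add: on_sections_def anchor_def)
  have F: "form_part e = (\<lambda>p. snd (e p))" by (simp add: form_part_def)
  {
    assume e: "e \<in> sections M (higher_bundle M n)"
    have *: "VF U (\<lambda>p. fst (e p)) \<and> FM n U (\<lambda>p. snd (e p))" if c: "(U, \<phi>) \<in> atlas M" for U \<phi>
    proof -
      have "(U \<inter> U, sum_frame (coord_vec M (U, \<phi>)) (coord_form M (U, \<phi>))) \<in> frames (higher_bundle M n)"
        unfolding higher_bundle_frames using c by blast
      then have "smooth_in_frame M (fidx (higher_bundle M n))
          (sum_frame (coord_vec M (U, \<phi>)) (coord_form M (U, \<phi>))) (U \<inter> U \<inter> topspace (mtop M)) e"
        using e unfolding sections_def smooth_section_on_def by blast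
      moreover have "U \<inter> U \<inter> topspace (mtop M) = U" using chart_subset[OF c] by blast
      ultimately show ?thesis
        using smooth_in_higher_frame_iff[OF c c chart_open[OF c], of n e] by (simp add: higher_bundle_fidx)
    qed
    have "VF (topspace (mtop M)) (\<lambda>p. fst (e p))"
      by (rule VF_local) (metis * chart_around chart_open)
    moreover have "FM n (topspace (mtop M)) (\<lambda>p. snd (e p))"
      by (rule FM_local) (metis * chart_around chart_open)
    ultimately show ?R using e unfolding X F sections_def by blast
  next
    assume r: ?R
    then have V: "VF (topspace (mtop M)) (\<lambda>p. fst (e p))" and \<omega>: "FM n (topspace (mtop M)) (\<lambda>p. snd (e p))"
      unfolding X F by auto
    have "e p \<in> fibre (higher_bundle M n) p" if "p \<in> topspace (mtop M)" for p
      using VF_tan[OF V that] FM_alt[OF \<omega> that] by (simp add: higher_bundle_fibre mem_Times_iff)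
    moreover have "smooth_in_frame M (fidx (higher_bundle M n)) fr (O' \<inter> topspace (mtop M)) e"
      if mem: "(O', fr) \<in> frames (higher_bundle M n)" for O' fr
    proof -
      obtain U \<phi> V' \<psi> where c: "(U, \<phi>) \<in> atlas M" "(V', \<psi>) \<in> atlas M" and
        fr: "O' = U \<inter> V'" "fr = sum_frame (coord_vec M (U, \<phi>)) (coord_form M (V', \<psi>))"
        using mem unfolding higher_bundle_frames by blast
      have "opn (U \<inter> V')" using c chart_open by blast
      moreover have "U \<inter> V' \<inter> topspace (mtop M) = U \<inter> V'" using chart_subset[OF c(1)] by blast
      moreover have "U \<inter> V' \<subseteq> topspace (mtop M)" using chart_subset[OF c(1)] by blast
      ultimately show ?thesis
        unfolding fr higher_bundle_fidx
        using smooth_in_higher_frame_iff[OF c, of "U \<inter> V'" n e] VF_subset[OF _ V] FM_subset[OF _ \<omega>] by simp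
    qed
    ultimately show "e \<in> sections M (higher_bundle M n)"
      unfolding sections_def smooth_section_on_def using r by blast
  }
qed

text \<open>No transition function is computed: the members of a frame are smooth fields and forms,
  and such are smooth in every other frame.\<close>

lemma higher_bundle_vector_bundle: "vector_bundle M (higher_bundle M n)"
  unfolding vector_bundle_def
proof (intro conjI ballI, goal_cases)
  case 1
  show ?case by (simp add: higher_bundle_fidx finite_index_lists)
next
  case (2 p)
  show ?case unfolding higher_bundle_fibre
    by (intro subspace_Times subspace_tangent subspace_alt_forms)
next
  case 3
  show ?case
  proof
    show "(\<Union>(U, e)\<in>frames (higher_bundle M n). U) \<subseteq> topspace (mtop M)"
      unfolding higher_bundle_frames using chart_subset by fast
    show "topspace (mtop M) \<subseteq> (\<Union>(U, e)\<in>frames (higher_bundle M n). U)"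
    proof
      fix p assume "p \<in> topspace (mtop M)"
      then obtain U \<phi> where c: "(U, \<phi>) \<in> atlas M" "p \<in> U" using chart_around by blast
      then have "(U \<inter> U, sum_frame (coord_vec M (U, \<phi>)) (coord_form M (U, \<phi>))) \<in> frames (higher_bundle M n)"
        unfolding higher_bundle_frames by blast
      then show "p \<in> (\<Union>(U, e)\<in>frames (higher_bundle M n). U)" using c(2) by force
    qed
  qed
next
  case (4 x)
  then obtain U \<phi> V \<psi> where c: "(U, \<phi>) \<in> atlas M" and d: "(V, \<psi>) \<in> atlas M" and
    x: "x = (U \<inter> V, sum_frame (coord_vec M (U, \<phi>)) (coord_form M (V, \<psi>)))"
    unfolding higher_bundle_frames by blast
  let ?e = "sum_frame (coord_vec M (U, \<phi>)) (coord_form M (V, \<psi>))"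
  let ?I = "{..<mdim M}" and ?J = "index_lists (mdim M) n"
  have "inj_on (\<lambda>k. ?e k p) (?I <+> ?J) \<and> independent ((\<lambda>k. ?e k p) ` (?I <+> ?J)) \<and>
      span ((\<lambda>k. ?e k p) ` (?I <+> ?J)) = T p \<times> alt_forms (T p) n" if p: "p \<in> U" "p \<in> V" for p
  proof -
    have lin: "(\<Sum>k\<in>?I <+> ?J. a k *\<^sub>R ?e k p) = (\<Sum>i\<in>?I. a (Inl i) *\<^sub>R coord_vec M (U, \<phi>) i p,
        \<Sum>K\<in>?J. a (Inr K) *\<^sub>R coord_form M (V, \<psi>) K p)" for a
      by (rule sum_frame_lincomb[of _ _ "\<lambda>k _. a k"]) (simp_all add: finite_index_lists)
    have fin: "finite (?I <+> ?J)" by (simp add: finite_index_lists)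
    have zero: "a k = 0" if "(\<Sum>k\<in>?I <+> ?J. a k *\<^sub>R ?e k p) = 0" and k: "k \<in> ?I <+> ?J" for a k
    proof -
      have 1: "(\<Sum>i<mdim M. a (Inl i) *\<^sub>R coord_vec M (U, \<phi>) i p) = 0"
        and 2: "(\<Sum>K\<in>?J. a (Inr K) *\<^sub>R coord_form M (V, \<psi>) K p) = 0"
        using that(1) unfolding lin zero_prod_def by auto
      show ?thesis using k
      proof
        fix i assume "k = Inl i" "i \<in> ?I"
        then show ?thesis using coord_vec_coeff[OF c p(1) 1] by simp
      next
        fix K assume "k = Inr K" "K \<in> ?J"
        then show ?thesis using coord_form_apply_sum[OF d p(2), of K n "\<lambda>K. a (Inr K)"] 2 by simp
      qed
    qed
    have "span ((\<lambda>k. ?e k p) ` (?I <+> ?J)) = T p \<times> alt_forms (T p) n"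
    proof (rule span_frame)
      show "subspace (T p \<times> alt_forms (T p) n)"
        by (intro subspace_Times subspace_tangent subspace_alt_forms)
      show "?e k p \<in> T p \<times> alt_forms (T p) n" if "k \<in> ?I <+> ?J" for k
        using that
      proof
        fix i assume "k = Inl i" "i \<in> ?I"
        then show ?thesis using coord_vec_tangent[OF c p(1)] by (simp add: zero_alt)
      next
        fix K assume "k = Inr K" "K \<in> ?J"
        then show ?thesis
          using coord_form_alt[of "(V, \<psi>)" K p] subspace_0[OF subspace_tangent] by (simp add: index_lists_def)
      qed
      fix v assume "v \<in> T p \<times> alt_forms (T p) n"
      then have v: "fst v \<in> T p" "snd v \<in> alt_forms (T p) n" by auto
      show "\<exists>a. v = (\<Sum>k\<in>?I <+> ?J. a k *\<^sub>R ?e k p)"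
        unfolding lin
        using tangent_expand[OF c p(1) v(1)] alt_expand[OF d p(2) v(2)]
        by (intro exI[of _ "case_sum (\<lambda>i. fst v (\<lambda>r. \<phi> r i))
          (\<lambda>K. snd v (map (\<lambda>i. coord_vec M (V, \<psi>) i p) K))"]) (auto simp: prod_eq_iff)
    qed
    then show ?thesis using frame_independent[OF fin, of "\<lambda>k. ?e k p"] zero by blast
  qed
  then show ?case
    unfolding x higher_bundle_fidx higher_bundle_fibre using chart_open c d by (auto intro: openin_Int)
next
  case (5 x)
  then obtain U \<phi> V \<psi> where c: "(U, \<phi>) \<in> atlas M" and d: "(V, \<psi>) \<in> atlas M" and
    x: "x = (U \<inter> V, sum_frame (coord_vec M (U, \<phi>)) (coord_form M (V, \<psi>)))"
    unfolding higher_bundle_frames by blast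
  have "smooth_in_frame M (fidx (higher_bundle M n)) e' (U \<inter> V \<inter> V')
      (sum_frame (coord_vec M (U, \<phi>)) (coord_form M (V, \<psi>)) k)"
    if fr: "(V', e') \<in> frames (higher_bundle M n)" and k: "k \<in> fidx (higher_bundle M n)" for V' e' k
  proof -
    obtain A \<alpha> B \<beta> where a: "(A, \<alpha>) \<in> atlas M" and b: "(B, \<beta>) \<in> atlas M" and
      e': "V' = A \<inter> B" "e' = sum_frame (coord_vec M (A, \<alpha>)) (coord_form M (B, \<beta>))"
      using fr unfolding higher_bundle_frames by blast
    have o: "opn (U \<inter> V \<inter> (A \<inter> B))" using chart_open[OF a] chart_open[OF b] chart_open[OF c] chart_open[OF d]
      by (intro openin_Int)
    have s: "U \<inter> V \<inter> (A \<inter> B) \<subseteq> U" "U \<inter> V \<inter> (A \<inter> B) \<subseteq> V" "U \<inter> V \<inter> (A \<inter> B) \<subseteq> A \<inter> B" by auto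
    show ?thesis
      using k unfolding e' higher_bundle_fidx smooth_in_higher_frame_iff[OF a b o s(3)]
    proof
      fix i assume "k = Inl i" "i \<in> {..<mdim M}"
      then show "VF (U \<inter> V \<inter> (A \<inter> B)) (\<lambda>p. fst (sum_frame (coord_vec M (U, \<phi>)) (coord_form M (V, \<psi>)) k p)) \<and>
          FM n (U \<inter> V \<inter> (A \<inter> B)) (\<lambda>p. snd (sum_frame (coord_vec M (U, \<phi>)) (coord_form M (V, \<psi>)) k p))"
        using VF_subset[OF s(1) VF_coord_vec[OF c, of i]] FM_zero by (simp only: sum.case fst_conv snd_conv lessThan_iff)
    next
      fix K assume "k = Inr K" "K \<in> index_lists (mdim M) n"
      then show "VF (U \<inter> V \<inter> (A \<inter> B)) (\<lambda>p. fst (sum_frame (coord_vec M (U, \<phi>)) (coord_form M (V, \<psi>)) k p)) \<and>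
          FM n (U \<inter> V \<inter> (A \<inter> B)) (\<lambda>p. snd (sum_frame (coord_vec M (U, \<phi>)) (coord_form M (V, \<psi>)) k p))"
        using FM_subset[OF s(2) FM_coord_form[OF d, of K n]] VF_zero
        by (simp add: index_lists_def del: zero_fun_apply)
    qed
  qed
  then show ?case unfolding x by auto
qed

lemma anchor_morphism: "bundle_morphism M (higher_bundle M n) (tangent_bundle M) anchor"
  unfolding bundle_morphism_def
proof (rule conjI, goal_cases)
  case 1
  show ?case by (simp add: higher_bundle_fibre tangent_bundle_def anchor_def)
next
  case 2
  show ?case
  proof
    fix x assume "x \<in> frames (higher_bundle M n)"
    then obtain U \<phi> V \<psi> where c: "(U, \<phi>) \<in> atlas M" and d: "(V, \<psi>) \<in> atlas M" and
      x: "x = (U \<inter> V, sum_frame (coord_vec M (U, \<phi>)) (coord_form M (V, \<psi>)))"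
      unfolding higher_bundle_frames by blast
    have "smooth_section_on M (tangent_bundle M) (U \<inter> V)
        (\<lambda>p. anchor p (sum_frame (coord_vec M (U, \<phi>)) (coord_form M (V, \<psi>)) k p))"
      if k: "k \<in> fidx (higher_bundle M n)" for k
    proof -
      let ?X = "\<lambda>p. anchor p (sum_frame (coord_vec M (U, \<phi>)) (coord_form M (V, \<psi>)) k p)"
      have X: "VF (U \<inter> V) ?X"
        using k unfolding higher_bundle_fidx
      proof
        fix i assume "k = Inl i" "i \<in> {..<mdim M}"
        then show ?thesis using VF_subset[OF _ VF_coord_vec[OF c, of i], of "U \<inter> V"] by (simp add: anchor_def)
      next
        fix K assume "k = Inr K"
        then show ?thesis using VF_zero[of "U \<inter> V"] by (simp only: anchor_def sum.case fst_conv)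
      qed
      have "smooth_in_frame M {..<mdim M} (coord_vec M (A, \<alpha>)) (A \<inter> (U \<inter> V)) ?X" if a: "(A, \<alpha>) \<in> atlas M" for A \<alpha>
      proof -
        have o: "opn (A \<inter> (U \<inter> V))" using chart_open[OF a] chart_open[OF c] chart_open[OF d] by (intro openin_Int)
        show ?thesis
          unfolding smooth_in_coord_vec_iff[OF a o Int_lower1] by (rule VF_subset[OF Int_lower2 X])
      qed
      then show ?thesis
        unfolding smooth_section_on_def using VF_tan[OF X] by (auto simp: tangent_bundle_def)
    qed
    then show "case x of (U, e) \<Rightarrow> \<forall>i\<in>fidx (higher_bundle M n).
        smooth_section_on M (tangent_bundle M) U (\<lambda>p. anchor p (e i p))" unfolding x by auto
  qed
qed

end


section \<open>The wedge product with a 1-form\<close>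

text \<open>Polarisation: expand the vanishing value with \<open>x + y\<close> in both
  slots.\<close>

lemma alt_swap_entries:
  assumes V: "subspace V" and \<omega>: "\<omega> \<in> alt_forms V k"
    and m: "set us \<subseteq> V" "x \<in> V" "set ms \<subseteq> V" "y \<in> V" "set ws \<subseteq> V"
  shows "\<omega> (us @ y # ms @ x # ws) = - \<omega> (us @ x # ms @ y # ws)"
proof -
  have xy: "x + y \<in> V" using V m subspace_add by blast
  note nd = alt_not_distinct[OF \<omega>]
  have "0 = \<omega> (us @ (x + y) # ms @ (x + y) # ws)" by (rule nd[symmetric]) simp
  also have "\<dots> = \<omega> (us @ x # ms @ (x + y) # ws) + \<omega> (us @ y # ms @ (x + y) # ws)"
    by (rule alt_add[OF \<omega>]) (use m xy in auto)
  also have "\<omega> (us @ x # ms @ (x + y) # ws) = \<omega> (us @ x # ms @ x # ws) + \<omega> (us @ x # ms @ y # ws)"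
    using alt_add[OF \<omega>, of "us @ x # ms" x y ws] m by simp
  also have "\<omega> (us @ y # ms @ (x + y) # ws) = \<omega> (us @ y # ms @ x # ws) + \<omega> (us @ y # ms @ y # ws)"
    using alt_add[OF \<omega>, of "us @ y # ms" x y ws] m by simp
  also have "\<omega> (us @ x # ms @ x # ws) = 0" by (rule nd) simp
  also have "\<omega> (us @ y # ms @ y # ws) = 0" by (rule nd) simp
  finally show ?thesis by simp
qed

text \<open>Permutations are built from transpositions, and each transposition contributes one sign.
  General bounds \<open>a\<close> and \<open>b\<close> admit the interval starting at 1, where the
  0-th argument is left to another form.\<close>

lemma alt_permute:
  assumes V: "subspace V" and \<omega>: "\<omega> \<in> alt_forms V k"
    and \<tau>: "\<tau> permutes {a..<b}" and g: "\<And>j. j \<in> {a..<b} \<Longrightarrow> g j \<in> V"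
  shows "\<omega> (map (g \<circ> \<tau>) [a..<b]) = of_int (sign \<tau>) * \<omega> (map g [a..<b])"
proof -
  have swap: "\<omega> (map (g \<circ> Transposition.transpose x y) [a..<b]) = - \<omega> (map g [a..<b])"
    if g: "\<And>j. j \<in> {a..<b} \<Longrightarrow> g j \<in> V" and xy: "a \<le> x" "x < y" "y < b" for g x y
  proof -
    let ?t = "Transposition.transpose x y"
    have s: "[a..<b] = [a..<x] @ x # [Suc x..<y] @ y # [Suc y..<b]"
    proof -
      have "[a..<b] = [a..<x] @ [x..<b]" using xy upt_add_eq_append[of a x "b - x"] by simp
      also have "[x..<b] = x # [Suc x..<b]" using xy by (simp add: upt_conv_Cons)
      also have "[Suc x..<b] = [Suc x..<y] @ [y..<b]" using xy upt_add_eq_append[of "Suc x" y "b - y"] by simp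
      also have "[y..<b] = y # [Suc y..<b]" using xy by (simp add: upt_conv_Cons)
      finally show ?thesis .
    qed
    have e: "map (g \<circ> ?t) [i..<j] = map g [i..<j]" if "x \<notin> {i..<j}" "y \<notin> {i..<j}" for i j
      using that by (intro map_cong) (auto simp: Transposition.transpose_def)
    have "map (g \<circ> ?t) [a..<b] = map g [a..<x] @ g y # map g [Suc x..<y] @ g x # map g [Suc y..<b]"
      unfolding s map_append list.map e using xy by (simp add: e)
    also have "\<omega> \<dots> = - \<omega> (map g [a..<x] @ g x # map g [Suc x..<y] @ g y # map g [Suc y..<b])"
      by (rule alt_swap_entries[OF V \<omega>]) (use xy g in auto)
    also have "map g [a..<x] @ g x # map g [Suc x..<y] @ g y # map g [Suc y..<b] = map g [a..<b]"
      unfolding s by simp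
    finally show ?thesis .
  qed
  have swap': "\<omega> (map (g \<circ> Transposition.transpose x y) [a..<b]) = - \<omega> (map g [a..<b])"
    if g: "\<And>j. j \<in> {a..<b} \<Longrightarrow> g j \<in> V" and xy: "x \<in> {a..<b}" "y \<in> {a..<b}" "x \<noteq> y" for g x y
  proof (cases "x < y")
    case True
    then show ?thesis using xy by (intro swap g) auto
  next
    case False
    then show ?thesis using xy by (subst transpose_commute, intro swap g) auto
  qed
  have "finite {a..<b}" by simp
  from \<tau> this show ?thesis
    using g
  proof (induction \<tau> arbitrary: g rule: permutes_induct)
    case id
    then show ?case by (simp add: sign_id)
  next
    case (swap x y p)
    let ?t = "Transposition.transpose x y"
    have t: "?t permutes {a..<b}" using swap.hyps by (intro permutes_swap_id) auto
    have "\<omega> (map (g \<circ> (?t \<circ> p)) [a..<b]) = of_int (sign p) * \<omega> (map (g \<circ> ?t) [a..<b])"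
    proof -
      have "\<omega> (map ((g \<circ> ?t) \<circ> p) [a..<b]) = of_int (sign p) * \<omega> (map (g \<circ> ?t) [a..<b])"
      proof (rule swap.IH)
        show "(g \<circ> ?t) j \<in> V" if "j \<in> {a..<b}" for j
          using swap.prems permutes_in_image[OF t, of j] that by simp
      qed
      then show ?thesis by (simp only: comp_assoc)
    qed
    also have "\<omega> (map (g \<circ> ?t) [a..<b]) = - \<omega> (map g [a..<b])"
      using swap.prems swap.hyps by (intro swap') auto
    also have "of_int (sign p) * - \<omega> (map g [a..<b]) = of_int (sign (?t \<circ> p)) * \<omega> (map g [a..<b])"
      using swap.hyps permutes_imp_permutation[OF _ t] permutes_imp_permutation[of "{a..<b}" p]
      by (simp add: sign_compose sign_swap_id)
    finally show ?case .
  qed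
qed

text \<open>The cycle that sends 0 to \<open>i\<close> and every \<open>j\<close> from 1 to
  \<open>i\<close> down by one. A list read through it has its \<open>i\<close>-th entry in front
  and the others in their old order; \<open>i\<close> transpositions produce it.\<close>

definition front_cycle :: "nat \<Rightarrow> nat \<Rightarrow> nat"
  where "front_cycle i j = (if j = 0 then i else if j \<le> i then j - 1 else j)"

lemma front_cycle_Suc: "front_cycle (Suc i) = Transposition.transpose i (Suc i) \<circ> front_cycle i"
  by (auto simp: front_cycle_def fun_eq_iff Transposition.transpose_def)

lemma front_cycle:
  shows "i < N \<Longrightarrow> front_cycle i permutes {..<N}" and "i < N \<Longrightarrow> sign (front_cycle i) = (-1) ^ i"
proof (induction i)
  case 0
  have "front_cycle 0 = id" by (auto simp: front_cycle_def fun_eq_iff)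
  {
    case 1
    then show ?case unfolding \<open>front_cycle 0 = id\<close> by (intro permutes_id)
  next
    case 2
    then show ?case using \<open>front_cycle 0 = id\<close> by (simp add: sign_id)
  }
next
  case (Suc i)
  {
    case 1
    then show ?case
      unfolding front_cycle_Suc by (intro permutes_compose Suc permutes_swap_id) auto
  next
    case 2
    then have p: "front_cycle i permutes {..<N}" and s: "sign (front_cycle i) = (-1) ^ i"
      using Suc by auto
    have t: "Transposition.transpose i (Suc i) permutes {..<N}" using 2 by (intro permutes_swap_id) auto
    show ?case
      unfolding front_cycle_Suc
      using sign_compose[OF permutes_imp_permutation[OF _ t] permutes_imp_permutation[OF _ p]] s
      by (simp add: sign_swap_id comp_def)
  }
qed

lemma map_front_cycle:
  assumes "i < length vs"
  shows "map (\<lambda>j. vs ! front_cycle i j) [1..<length vs] = omit i vs"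
  using assms by (intro nth_equalityI) (auto simp: length_omit omit_def front_cycle_def nth_append min_def)

text \<open>Factor \<open>\<sigma>\<close> as the front cycle of \<open>\<sigma> 0\<close> after a
  permutation \<open>\<tau>\<close> fixing 0. The latter only permutes the arguments of
  \<open>\<omega>\<close>, so its sign occurs twice and cancels; the sign of the cycle
  remains.\<close>

lemma alt_permute_front:
  assumes V: "subspace V" and \<omega>: "\<omega> \<in> alt_forms V k"
    and \<sigma>: "\<sigma> permutes {..<length vs}" and vs: "set vs \<subseteq> V" "vs \<noteq> []"
  shows "of_int (sign \<sigma>) * \<omega> (map (\<lambda>j. vs ! \<sigma> j) [1..<length vs]) =
    (-1) ^ \<sigma> 0 * \<omega> (omit (\<sigma> 0) vs)"
proof -
  define N where "N = length vs"
  define c where "c = front_cycle (\<sigma> 0)"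
  have i: "\<sigma> 0 < N" using permutes_in_image[OF \<sigma>, of 0] vs(2) by (simp add: N_def)
  have \<sigma>: "\<sigma> permutes {..<N}" using \<sigma> by (simp add: N_def)
  have c: "c permutes {..<N}" "sign c = (-1) ^ \<sigma> 0" using front_cycle[OF i] by (auto simp: c_def)
  define \<tau> where "\<tau> = inv c \<circ> \<sigma>"
  have \<tau>N: "\<tau> permutes {..<N}" unfolding \<tau>_def by (intro permutes_compose \<sigma> permutes_inv c)
  have "c 0 = \<sigma> 0" by (simp add: c_def front_cycle_def)
  then have "\<tau> 0 = 0" unfolding \<tau>_def using permutes_inverses(2)[OF c(1), of 0] by simp
  then have \<tau>: "\<tau> permutes {1..<N}"
    by (intro permutes_superset[OF \<tau>N]) (auto simp: not_less_eq_eq)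
  have \<sigma>c: "\<sigma> j = c (\<tau> j)" for j
    unfolding \<tau>_def using permutes_inverses(1)[OF c(1)] by simp
  have mem: "vs ! c j \<in> V" if "j \<in> {1..<N}" for j
    using permutes_in_image[OF c(1), of j] that vs(1) nth_mem[of "c j" vs] by (auto simp: N_def)
  have "sign \<sigma> = sign c * sign \<tau>"
  proof -
    have "\<sigma> = c \<circ> \<tau>" using \<sigma>c by auto
    then show ?thesis
      using sign_compose[OF permutes_imp_permutation[OF _ c(1)] permutes_imp_permutation[OF _ \<tau>N]] by simp
  qed
  moreover have "\<omega> (map (\<lambda>j. vs ! \<sigma> j) [1..<N]) = of_int (sign \<tau>) * \<omega> (map (\<lambda>j. vs ! c j) [1..<N])"
    using alt_permute[OF V \<omega> \<tau>, of "\<lambda>j. vs ! c j"] mem by (simp add: \<sigma>c comp_def)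
  moreover have "map (\<lambda>j. vs ! c j) [1..<N] = omit (\<sigma> 0) vs"
    unfolding c_def N_def using map_front_cycle i by (simp add: N_def)
  moreover have "(of_int (sign \<tau>) :: real) * of_int (sign \<tau>) = 1"
    by (metis of_int_1 of_int_mult sign_idempotent)
  ultimately show ?thesis unfolding N_def[symmetric] c(2) by (simp add: mult.assoc[symmetric])
qed

text \<open>By symmetry \<open>0\<close> may be replaced by any other index; average over all of them.\<close>

lemma sum_permutes_at_0:
  fixes h :: "nat \<Rightarrow> real"
  assumes "0 < N"
  shows "(\<Sum>\<sigma> | \<sigma> permutes {..<N}. h (\<sigma> 0)) = fact (N - 1) * (\<Sum>i<N. h i)"
proof -
  let ?P = "{\<sigma>. \<sigma> permutes {..<N}}"
  have "(\<Sum>\<sigma>\<in>?P. h (\<sigma> j)) = (\<Sum>\<sigma>\<in>?P. h (\<sigma> 0))" if "j < N" for j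
  proof -
    have "Transposition.transpose 0 j permutes {..<N}" using that assms by (intro permutes_swap_id) auto
    from sum_permutations_compose_right[OF this, of "\<lambda>\<sigma>. h (\<sigma> 0)"] show ?thesis by simp
  qed
  then have "(\<Sum>j<N. \<Sum>\<sigma>\<in>?P. h (\<sigma> j)) = (\<Sum>j<N. \<Sum>\<sigma>\<in>?P. h (\<sigma> 0))"
    by (rule sum.cong[OF refl, of "{..<N}", unfolded lessThan_iff])
  then have "real N * (\<Sum>\<sigma>\<in>?P. h (\<sigma> 0)) = (\<Sum>j<N. \<Sum>\<sigma>\<in>?P. h (\<sigma> j))"
    by (simp only: sum_constant card_lessThan)
  also have "\<dots> = (\<Sum>\<sigma>\<in>?P. \<Sum>j<N. h (\<sigma> j))" by (rule sum.swap)
  also have "\<dots> = (\<Sum>\<sigma>\<in>?P. \<Sum>j<N. h j)"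
  proof (rule sum.cong[OF refl])
    fix \<sigma> assume "\<sigma> \<in> ?P"
    then have "sum h {..<N} = sum (h \<circ> \<sigma>) {..<N}" by (intro sum.permute) simp
    then show "(\<Sum>j<N. h (\<sigma> j)) = (\<Sum>j<N. h j)" by (simp add: comp_def)
  qed
  also have "\<dots> = fact N * (\<Sum>i<N. h i)"
    using card_permutations[of "{..<N}" N] by simp
  also have "fact N = (real N * fact (N - 1))" using assms by (simp add: fact_reduce)
  finally show ?thesis using assms by simp
qed

text \<open>Only splittings into 1 and \<open>length vs - 1\<close> arguments contribute. Each
  summand depends on \<open>\<sigma>\<close> through \<open>\<sigma> 0\<close> alone, and every
  value is attained equally often, which cancels the factorial of the normalisation.\<close>

lemma wedge_1_form:
  assumes V: "subspace V" and \<omega>: "\<omega> \<in> alt_forms V k"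
    and \<theta>: "\<And>ws. length ws \<noteq> 1 \<Longrightarrow> \<theta> ws = 0" and vs: "set vs \<subseteq> V"
  shows "wedge \<theta> \<omega> vs = (\<Sum>i<length vs. (-1) ^ i * \<theta> [vs ! i] * \<omega> (omit i vs))"
proof (cases "vs = []")
  case True
  then show ?thesis by (simp add: wedge_def \<theta>)
next
  case False
  define N where "N = length vs"
  define S where "S k = (\<Sum>\<sigma> | \<sigma> permutes {..<N}. of_int (sign \<sigma>) *
    \<theta> (map (\<lambda>i. vs ! \<sigma> i) [0..<k]) * \<omega> (map (\<lambda>i. vs ! \<sigma> i) [k..<N]))" for k
  have N: "0 < N" using False by (simp add: N_def)
  have "wedge \<theta> \<omega> vs = (\<Sum>k\<le>N. 1 / (fact k * fact (N - k)) * S k)"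
    by (simp add: wedge_def N_def S_def)
  also have "\<dots> = (\<Sum>k\<in>{1}. 1 / (fact k * fact (N - k)) * S k)"
    by (rule sum.mono_neutral_right) (use N \<theta> in \<open>auto simp: S_def\<close>)
  also have "\<dots> = S 1 / fact (N - 1)" by simp
  also have "S 1 = (\<Sum>\<sigma> | \<sigma> permutes {..<N}. (-1) ^ \<sigma> 0 * \<theta> [vs ! \<sigma> 0] * \<omega> (omit (\<sigma> 0) vs))"
    unfolding S_def
  proof (rule sum.cong[OF refl])
    fix \<sigma> assume "\<sigma> \<in> {\<sigma>. \<sigma> permutes {..<N}}"
    then have "\<sigma> permutes {..<length vs}" by (simp add: N_def)
    from alt_permute_front[OF V \<omega> this vs False]
    show "of_int (sign \<sigma>) * \<theta> (map (\<lambda>i. vs ! \<sigma> i) [0..<1]) * \<omega> (map (\<lambda>i. vs ! \<sigma> i) [1..<N]) =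
        (-1) ^ \<sigma> 0 * \<theta> [vs ! \<sigma> 0] * \<omega> (omit (\<sigma> 0) vs)"
      by (simp add: N_def algebra_simps)
  qed
  also have "\<dots> = fact (N - 1) * (\<Sum>i<N. (-1) ^ i * \<theta> [vs ! i] * \<omega> (omit i vs))"
    by (rule sum_permutes_at_0[OF N])
  finally show ?thesis by (simp add: N_def)
qed

text \<open>In a nonzero summand the arguments of both factors lie in \<open>V\<close>, and a
  permutation distributes all entries of \<open>vs\<close> among them.\<close>

lemma wedge_support:
  assumes "\<And>ws. \<not> set ws \<subseteq> V \<Longrightarrow> \<theta> ws = 0" "\<And>ws. \<not> set ws \<subseteq> V \<Longrightarrow> \<omega> ws = 0" "\<not> set vs \<subseteq> V"
  shows "wedge \<theta> \<omega> vs = 0"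
proof -
  define N where "N = length vs"
  have "\<theta> (map (\<lambda>i. vs ! \<sigma> i) [0..<k]) * \<omega> (map (\<lambda>i. vs ! \<sigma> i) [k..<N]) = 0"
    if \<sigma>: "\<sigma> permutes {..<N}" for \<sigma> k
  proof (rule ccontr)
    assume "\<not> ?thesis"
    then have "\<theta> (map (\<lambda>i. vs ! \<sigma> i) [0..<k]) \<noteq> 0" "\<omega> (map (\<lambda>i. vs ! \<sigma> i) [k..<N]) \<noteq> 0" by auto
    then have 1: "set (map (\<lambda>i. vs ! \<sigma> i) [0..<k]) \<subseteq> V" and 2: "set (map (\<lambda>i. vs ! \<sigma> i) [k..<N]) \<subseteq> V"
      using assms(1,2) by blast+
    have "vs ! i \<in> V" if i: "i < N" for i
    proof -
      obtain j where j: "i = \<sigma> j" "j < N"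
      proof -
        have "i \<in> \<sigma> ` {..<N}" unfolding permutes_image[OF \<sigma>] using i by simp
        then show ?thesis using that by auto
      qed
      then show ?thesis using 1 2 by (cases "j < k") auto
    qed
    then show False using assms(3) by (auto simp: N_def in_set_conv_nth)
  qed
  then have "(\<Sum>\<sigma> | \<sigma> permutes {..<N}. of_int (sign \<sigma>) *
      \<theta> (map (\<lambda>i. vs ! \<sigma> i) [0..<k]) * \<omega> (map (\<lambda>i. vs ! \<sigma> i) [k..<N])) = 0" for k
    by (intro sum.neutral ballI) (simp add: mult.assoc)
  then have "(\<Sum>k\<le>N. 1 / (fact k * fact (N - k)) * (\<Sum>\<sigma> | \<sigma> permutes {..<N}. of_int (sign \<sigma>) *
      \<theta> (map (\<lambda>i. vs ! \<sigma> i) [0..<k]) * \<omega> (map (\<lambda>i. vs ! \<sigma> i) [k..<N]))) = 0"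
    by (intro sum.neutral ballI) simp
  then show ?thesis unfolding wedge_def N_def .
qed

context smooth_mfd begin


section \<open>Products with functions\<close>

lemma lie_deriv_scale_form:
  assumes W: "opn W" "q \<in> W" and X: "VF W X" and \<omega>: "FM k W \<omega>" and g: "C W g"
  shows "lie_deriv M X (\<lambda>r. g r *\<^sub>R \<omega> r) q = g q *\<^sub>R lie_deriv M X \<omega> q + X q g *\<^sub>R \<omega> q"
proof
  fix vs
  show "lie_deriv M X (\<lambda>r. g r *\<^sub>R \<omega> r) q vs = (g q *\<^sub>R lie_deriv M X \<omega> q + X q g *\<^sub>R \<omega> q) vs"
  proof (cases "set vs \<subseteq> T q")
    case True
    obtain V where V: "opn V" "q \<in> V" "V \<subseteq> W" and E: "\<And>v. VF V (coord_ext M q v)"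
      using coord_ext_fields[OF W] by blast
    let ?Es = "map (coord_ext M q) vs"
    have Es: "VFs V ?Es" using E by auto
    have self: "ev q ?Es = vs" using map_coord_ext[OF W True] by (simp add: comp_def)
    note X' = VF_subset[OF V(3) X] and \<omega>' = FM_subset[OF V(3) \<omega>] and g' = C_subset[OF V(3) g]
    have "lie_deriv M X (\<lambda>r. g r *\<^sub>R \<omega> r) q (ev q ?Es) = g q * lie_deriv M X \<omega> q (ev q ?Es) + X q g * \<omega> q (ev q ?Es)"
      unfolding lie_deriv_ev[OF V(1,2) X' \<omega>' Es] lie_deriv_ev[OF V(1,2) X' FM_scale[OF \<omega>' g'] Es]
      by (rule LL_scale_form[OF V(1,2) X' \<omega>' Es g'])
    then show ?thesis unfolding self by (simp add: scaleR_fun_def)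
  next
    case False
    then show ?thesis using alt_support[OF FM_alt[OF \<omega> W(2)] False]
      by (simp add: lie_deriv_def scaleR_fun_def)
  qed
qed

lemma lie_deriv_add_field:
  assumes W: "opn W" "q \<in> W" and X: "VF W X" and Y: "VF W Y" and \<omega>: "FM k W \<omega>"
  shows "lie_deriv M (\<lambda>r. X r + Y r) \<omega> q = lie_deriv M X \<omega> q + lie_deriv M Y \<omega> q"
proof
  fix vs
  show "lie_deriv M (\<lambda>r. X r + Y r) \<omega> q vs = (lie_deriv M X \<omega> q + lie_deriv M Y \<omega> q) vs"
  proof (cases "set vs \<subseteq> T q")
    case True
    obtain V where V: "opn V" "q \<in> V" "V \<subseteq> W" and E: "\<And>v. VF V (coord_ext M q v)"
      using coord_ext_fields[OF W] by blast
    let ?Es = "map (coord_ext M q) vs"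
    have Es: "VFs V ?Es" using E by auto
    have self: "ev q ?Es = vs" using map_coord_ext[OF W True] by (simp add: comp_def)
    note X' = VF_subset[OF V(3) X] and Y' = VF_subset[OF V(3) Y] and \<omega>' = FM_subset[OF V(3) \<omega>]
    have "lie_deriv M (\<lambda>r. X r + Y r) \<omega> q (ev q ?Es) = lie_deriv M X \<omega> q (ev q ?Es) + lie_deriv M Y \<omega> q (ev q ?Es)"
      unfolding lie_deriv_ev[OF V(1,2) X' \<omega>' Es] lie_deriv_ev[OF V(1,2) Y' \<omega>' Es]
        lie_deriv_ev[OF V(1,2) VF_add[OF X' Y'] \<omega>' Es]
      by (rule LL_add_field[OF V(1,2) X' \<omega>' Es Y'])
    then show ?thesis unfolding self by simp
  qed (simp add: lie_deriv_def)
qed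

text \<open>The alternating sum is the wedge product of dg with the contraction of
  \<open>\<omega>\<close>, in the form given by \<open>wedge_1_form\<close>; likewise with
  \<open>\<omega>\<close> itself in \<open>ext_deriv_scale_form\<close>.\<close>

lemma lie_deriv_scale_field:
  assumes W: "opn W" "q \<in> W" and X: "VF W X" and \<omega>: "FM k W \<omega>" and g: "C W g" and t: "set vs \<subseteq> T q"
  shows "lie_deriv M (\<lambda>r. g r *\<^sub>R X r) \<omega> q vs = g q * lie_deriv M X \<omega> q vs +
    (\<Sum>i<length vs. (-1) ^ i * (vs ! i) g * int_prod X \<omega> q (omit i vs))"
proof -
  obtain V where V: "opn V" "q \<in> V" "V \<subseteq> W" and E: "\<And>v. VF V (coord_ext M q v)"
    using coord_ext_fields[OF W] by blast
  define Es where "Es = map (coord_ext M q) vs"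
  have Es: "VFs V Es" using E by (auto simp: Es_def)
  have self: "ev q Es = vs" using map_coord_ext[OF W t] by (simp add: comp_def Es_def)
  have nth: "(Es ! j) q = vs ! j" if "j < length vs" for j
    using arg_cong[OF self, of "\<lambda>xs. xs ! j"] that by (simp add: Es_def)
  note X' = VF_subset[OF V(3) X] and \<omega>' = FM_subset[OF V(3) \<omega>] and g' = C_subset[OF V(3) g]
  have "lie_deriv M (\<lambda>r. g r *\<^sub>R X r) \<omega> q (ev q Es) = g q * lie_deriv M X \<omega> q (ev q Es) +
      (\<Sum>j<length Es. (Es ! j) q g * \<omega> q ((ev q Es)[j := X q]))"
    unfolding lie_deriv_ev[OF V(1,2) X' \<omega>' Es] lie_deriv_ev[OF V(1,2) VF_scale[OF X' g'] \<omega>' Es]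
    by (rule LL_scale_field[OF V(1,2) X' \<omega>' Es g'])
  also have "(\<Sum>j<length Es. (Es ! j) q g * \<omega> q ((ev q Es)[j := X q])) =
      (\<Sum>i<length vs. (-1) ^ i * (vs ! i) g * int_prod X \<omega> q (omit i vs))"
    unfolding self
    by (rule sum.cong) (auto simp: Es_def[symmetric] nth int_prod_def
        alt_update[OF subspace_tangent FM_alt[OF \<omega> W(2)] t VF_tan[OF X W(2)]], simp add: Es_def)
  finally show ?thesis unfolding self .
qed

lemma ext_deriv_scale_form:
  assumes W: "opn W" "q \<in> W" and \<omega>: "FM k W \<omega>" and g: "C W g" and t: "set vs \<subseteq> T q"
  shows "ext_deriv M (\<lambda>r. g r *\<^sub>R \<omega> r) q vs = g q * ext_deriv M \<omega> q vs +
    (\<Sum>i<length vs. (-1) ^ i * (vs ! i) g * \<omega> q (omit i vs))"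
proof -
  obtain V where V: "opn V" "q \<in> V" "V \<subseteq> W" and E: "\<And>v. VF V (coord_ext M q v)"
    using coord_ext_fields[OF W] by blast
  define Es where "Es = map (coord_ext M q) vs"
  have Es: "VFs V Es" using E by (auto simp: Es_def)
  have self: "ev q Es = vs" using map_coord_ext[OF W t] by (simp add: comp_def Es_def)
  have len: "length Es = length vs" by (simp add: Es_def)
  have nth: "(Es ! j) q = vs ! j" if "j < length vs" for j
    using arg_cong[OF self, of "\<lambda>xs. xs ! j"] that len by simp
  note \<omega>' = FM_subset[OF V(3) \<omega>] and g' = C_subset[OF V(3) g]
  have "ext_deriv M (\<lambda>r. g r *\<^sub>R \<omega> r) q (ev q Es) = g q * ext_deriv M \<omega> q (ev q Es) +
      (\<Sum>i<length Es. (-1) ^ i * (Es ! i) q g * \<omega> q (omit i (ev q Es)))"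
    unfolding ext_deriv_ev[OF V(1,2) \<omega>' Es] ext_deriv_ev[OF V(1,2) FM_scale[OF \<omega>' g'] Es]
    by (rule dd_scale_form[OF V(1,2) g' Es \<omega>'])
  also have "(\<Sum>i<length Es. (-1) ^ i * (Es ! i) q g * \<omega> q (omit i (ev q Es))) =
      (\<Sum>i<length vs. (-1) ^ i * (vs ! i) g * \<omega> q (omit i vs))"
    unfolding self len by (rule sum.cong) (auto simp: nth)
  finally show ?thesis unfolding self .
qed

lemma int_prod_scale_field:
  assumes \<omega>: "FM k W \<omega>" and q: "q \<in> W" and Y: "Y q \<in> T q"
  shows "int_prod (\<lambda>r. g r *\<^sub>R Y r) \<omega> q = g q *\<^sub>R int_prod Y \<omega> q"
proof
  fix vs
  show "int_prod (\<lambda>r. g r *\<^sub>R Y r) \<omega> q vs = (g q *\<^sub>R int_prod Y \<omega> q) vs"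
  proof (cases "set vs \<subseteq> T q")
    case True
    then show ?thesis
      using alt_scale[OF FM_alt[OF \<omega> q], of "[]" "Y q" vs "g q"] Y
      by (simp add: int_prod_def scaleR_fun_def[of _ "_ :: 'p tvec list \<Rightarrow> real"])
  next
    case False
    then show ?thesis using alt_support[OF FM_alt[OF \<omega> q], of "_ # vs"]
      by (simp add: int_prod_def scaleR_fun_def[of _ "_ :: 'p tvec list \<Rightarrow> real"])
  qed
qed

lemma int_prod_swap:
  assumes \<omega>: "FM k W \<omega>" and q: "q \<in> W" and Y: "Y q \<in> T q" and Z: "Z q \<in> T q"
  shows "int_prod Z (int_prod Y \<omega>) q = - int_prod Y (int_prod Z \<omega>) q"
proof
  fix vs
  show "int_prod Z (int_prod Y \<omega>) q vs = (- int_prod Y (int_prod Z \<omega>) q) vs"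
  proof (cases "set vs \<subseteq> T q")
    case True
    then show ?thesis
      using alt_swap[OF subspace_tangent FM_alt[OF \<omega> q], of "[]" "Y q" "Z q" vs] Y Z
      by (simp add: int_prod_def)
  next
    case False
    then show ?thesis using alt_support[OF FM_alt[OF \<omega> q], of "_ # _ # vs"]
      by (simp add: int_prod_def)
  qed
qed

text \<open>The first two facts are what \<open>wedge_1_form\<close> and
  \<open>wedge_support\<close> ask of a 1-form; the third evaluates it.\<close>

lemma ext_deriv_zero_form:
  shows "length vs \<noteq> 1 \<Longrightarrow> ext_deriv M (zero_form f) q vs = 0"
    and "\<not> set vs \<subseteq> T q \<Longrightarrow> ext_deriv M (zero_form f) q vs = 0"
    and "v \<in> T q \<Longrightarrow> ext_deriv M (zero_form f) q [v] = v f"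
proof -
  assume len: "length vs \<noteq> 1"
  show "ext_deriv M (zero_form f) q vs = 0"
  proof (cases "set vs \<subseteq> T q")
    case True
    have "(vs ! i) (\<lambda>r. zero_form f r (map (\<lambda>v. coord_ext M q v r) (take i vs @ drop (Suc i) vs))) = 0"
      if i: "i < length vs" for i
    proof -
      have "map (\<lambda>v. coord_ext M q v r) (take i vs @ drop (Suc i) vs) \<noteq> []" for r
        using i len by auto
      moreover have "vs ! i \<in> T q" using True i nth_mem by blast
      ultimately show ?thesis using tan_const[of "vs ! i" q 0] by (simp only: zero_form_def if_False)
    qed
    then show ?thesis unfolding ext_deriv_def by (auto intro!: sum.neutral)
  qed (simp add: ext_deriv_def)
next
  show "\<not> set vs \<subseteq> T q \<Longrightarrow> ext_deriv M (zero_form f) q vs = 0"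
    by (simp add: ext_deriv_def)
  show "v \<in> T q \<Longrightarrow> ext_deriv M (zero_form f) q [v] = v f"
    by (simp add: ext_deriv_def zero_form_def)
qed


section \<open>The higher-order Dorfman bracket\<close>

abbreviation S :: "'p set" where "S \<equiv> topspace (mtop M)"

lemma S_open: "opn S" by simp

lemma vf_part_dorfman: "vf_part (dorfman M e\<^sub>1 e\<^sub>2) = br (vf_part e\<^sub>1) (vf_part e\<^sub>2)"
  by (simp add: fun_eq_iff dorfman_def on_sections_def anchor_def)

lemma vf_part_fmult: "vf_part (fmult f e) = (\<lambda>q. f q *\<^sub>R vf_part e q)"
  by (simp add: fun_eq_iff fmult_def on_sections_def anchor_def)

lemma form_part_fmult: "form_part (fmult f e) = (\<lambda>q. f q *\<^sub>R form_part e q)"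
  by (simp add: fun_eq_iff fmult_def form_part_def)

lemma vf_part_add: "vf_part (a + b) = (\<lambda>q. vf_part a q + vf_part b q)"
  by (simp add: fun_eq_iff on_sections_def anchor_def)

lemma form_part_add: "form_part (a + b) = form_part a + form_part b"
  by (simp add: fun_eq_iff form_part_def)

lemma section_eqI:
  assumes "vf_part a q = vf_part b q" "form_part a q = form_part b q"
  shows "a q = b q"
  using assms by (simp add: on_sections_def anchor_def form_part_def prod_eq_iff)

lemma secD:
  assumes "e \<in> sections M (higher_bundle M n)"
  shows "VF S (vf_part e)" "FM n S (form_part e)" "p \<notin> S \<Longrightarrow> e p = 0"
  using assms higher_section_iff by blast+

lemma fmult_section:
  assumes "e \<in> sections M (higher_bundle M n)" "f \<in> smooth_functions M"
  shows "fmult f e \<in> sections M (higher_bundle M n)"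
proof -
  have f: "C S f" using assms(2) by (simp add: smooth_functions_def)
  show ?thesis
    unfolding higher_section_iff vf_part_fmult form_part_fmult
    using VF_scale[OF secD(1)[OF assms(1)] f] FM_scale[OF secD(2)[OF assms(1)] f] secD(3)[OF assms(1)]
    by (simp add: fmult_def)
qed

lemma form_part_dorfman_eq: "form_part (dorfman M e\<^sub>1 e\<^sub>2) q =
  lie_deriv M (vf_part e\<^sub>1) (form_part e\<^sub>2) q - lie_deriv M (vf_part e\<^sub>2) (form_part e\<^sub>1) q +
  ext_deriv M (int_prod (vf_part e\<^sub>2) (form_part e\<^sub>1)) q"
  by (simp add: form_part_def dorfman_def)

text \<open>Cartan's formula turns \<open>- L\<^sub>Y \<alpha> + d i\<^sub>Y \<alpha>\<close> into \<open>- i\<^sub>Y d\<alpha>\<close>.\<close>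

lemma form_part_dorfman:
  assumes "e\<^sub>1 \<in> sections M (higher_bundle M n)" "e\<^sub>2 \<in> sections M (higher_bundle M n)" "q \<in> S"
  shows "form_part (dorfman M e\<^sub>1 e\<^sub>2) q =
    lie_deriv M (vf_part e\<^sub>1) (form_part e\<^sub>2) q - int_prod (vf_part e\<^sub>2) (ext_deriv M (form_part e\<^sub>1)) q"
  using int_prod_ext_deriv[OF S_open assms(3) secD(1)[OF assms(2)] secD(2)[OF assms(1)]]
  by (simp add: form_part_dorfman_eq fun_eq_iff)

text \<open>Sections are functions on the whole type, so identities between them must also hold off
  the manifold. There no function is smooth near the point, and all tangent vectors are 0.\<close>

lemma dorfman_outside:
  assumes p: "p \<notin> S" and e: "e\<^sub>1 p = 0" "e\<^sub>2 p = 0"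
  shows "dorfman M e\<^sub>1 e\<^sub>2 p = 0"
proof -
  have z: "vf_part e\<^sub>1 p = 0" "vf_part e\<^sub>2 p = 0" "form_part e\<^sub>1 p = 0" "form_part e\<^sub>2 p = 0"
    using e by (simp_all add: on_sections_def anchor_def form_part_def)
  have "lie_bracket M (vf_part e\<^sub>1) (vf_part e\<^sub>2) p = 0"
    using p smooth_near_topspace by (auto simp: lie_bracket_def fun_eq_iff)
  moreover have "lie_deriv M (vf_part e\<^sub>1) (form_part e\<^sub>2) p = 0" "lie_deriv M (vf_part e\<^sub>2) (form_part e\<^sub>1) p = 0"
    using z by (auto simp: lie_deriv_def fun_eq_iff)
  moreover have "ext_deriv M \<omega> p = 0" for \<omega>
  proof
    fix vs
    have "vs ! i = 0" if "set vs \<subseteq> T p" "i < length vs" for i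
      using tan_outside[OF _ p] that nth_mem by blast
    then show "ext_deriv M \<omega> p vs = 0 vs" by (simp add: ext_deriv_def)
  qed
  ultimately show ?thesis by (simp add: dorfman_def zero_prod_def fun_eq_iff)
qed

lemma dorfman_section:
  assumes a: "e\<^sub>1 \<in> sections M (higher_bundle M n)" and b: "e\<^sub>2 \<in> sections M (higher_bundle M n)"
  shows "dorfman M e\<^sub>1 e\<^sub>2 \<in> sections M (higher_bundle M n)"
  unfolding higher_section_iff
proof (intro conjI allI impI)
  show "VF S (vf_part (dorfman M e\<^sub>1 e\<^sub>2))"
    unfolding vf_part_dorfman by (intro VF_br secD(1)[OF a] secD(1)[OF b]) simp
  \<comment> \<open>Differentiating before contracting keeps the degree bookkeeping correct: for
    \<open>n = 0\<close> contraction first would record degree 0, and d would then record degree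
    1.\<close>
  have "FM (Suc n - 1) S (int_prod (vf_part e\<^sub>2) (ext_deriv M (form_part e\<^sub>1)))"
    by (intro FM_int_prod FM_ext_deriv S_open secD(2)[OF a] secD(1)[OF b])
  then have "FM n S (lie_deriv M (vf_part e\<^sub>1) (form_part e\<^sub>2) - int_prod (vf_part e\<^sub>2) (ext_deriv M (form_part e\<^sub>1)))"
    by (intro FM_diff S_open FM_lie_deriv secD(1)[OF a] secD(2)[OF b]) simp
  then show "FM n S (form_part (dorfman M e\<^sub>1 e\<^sub>2))"
    by (rule FM_cong) (simp add: form_part_dorfman[OF a b])
  show "dorfman M e\<^sub>1 e\<^sub>2 p = 0" if "p \<notin> S" for p
    using dorfman_outside[of p e\<^sub>1 e\<^sub>2] secD(3)[OF a that] secD(3)[OF b that] that by blast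
qed

text \<open>The term \<open>- i\<^sub>Y d\<alpha>\<close> is linear over functions in the second
  argument, so derivatives of \<open>f\<close> come only from \<open>[X, f Y]\<close> and
  \<open>L\<^sub>X (f \<beta>)\<close>.\<close>

lemma dorfman_fmult_right:
  assumes a: "e\<^sub>1 \<in> sections M (higher_bundle M n)" and b: "e\<^sub>2 \<in> sections M (higher_bundle M n)"
    and f: "f \<in> smooth_functions M"
  shows "dorfman M e\<^sub>1 (fmult f e\<^sub>2) = fmult f (dorfman M e\<^sub>1 e\<^sub>2) + fmult (vf_apply (vf_part e\<^sub>1) f) e\<^sub>2"
proof
  fix q
  show "dorfman M e\<^sub>1 (fmult f e\<^sub>2) q = (fmult f (dorfman M e\<^sub>1 e\<^sub>2) + fmult (vf_apply (vf_part e\<^sub>1) f) e\<^sub>2) q"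
  proof (cases "q \<in> S")
    case q: True
    have fC: "C S f" using f by (simp add: smooth_functions_def)
    note X = secD(1)[OF a] and Y = secD(1)[OF b] and \<alpha> = secD(2)[OF a] and \<beta> = secD(2)[OF b]
    show ?thesis
    proof (rule section_eqI)
      show "vf_part (dorfman M e\<^sub>1 (fmult f e\<^sub>2)) q =
          vf_part (fmult f (dorfman M e\<^sub>1 e\<^sub>2) + fmult (vf_apply (vf_part e\<^sub>1) f) e\<^sub>2) q"
        unfolding vf_part_dorfman vf_part_add vf_part_fmult br_scale_right[OF S_open q X Y fC]
        by (simp add: vf_apply_def)
      show "form_part (dorfman M e\<^sub>1 (fmult f e\<^sub>2)) q =
          form_part (fmult f (dorfman M e\<^sub>1 e\<^sub>2) + fmult (vf_apply (vf_part e\<^sub>1) f) e\<^sub>2) q"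
        unfolding form_part_dorfman[OF a fmult_section[OF b f] q] form_part_add vf_part_fmult form_part_fmult
          lie_deriv_scale_form[OF S_open q X \<beta> fC] plus_fun_apply form_part_dorfman[OF a b q]
          int_prod_scale_field[where Y="vf_part e\<^sub>2", OF FM_ext_deriv[OF S_open \<alpha>] q VF_tan[OF Y q]]
        by (simp add: vf_apply_def scaleR_fun_def fun_eq_iff algebra_simps)
    qed
  next
    case False
    note z = secD(3)[OF a False] secD(3)[OF b False]
    show ?thesis
      using dorfman_outside[of q e\<^sub>1 e\<^sub>2] dorfman_outside[of q e\<^sub>1 "fmult f e\<^sub>2"] z False
      by (simp add: fmult_def)
  qed
qed

lemma dorfman_fmult_left:
  assumes a: "e\<^sub>1 \<in> sections M (higher_bundle M n)" and b: "e\<^sub>2 \<in> sections M (higher_bundle M n)"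
    and f: "f \<in> smooth_functions M"
  shows "dorfman M (fmult f e\<^sub>1) e\<^sub>2 = fmult f (dorfman M e\<^sub>1 e\<^sub>2) - fmult (vf_apply (vf_part e\<^sub>2) f) e\<^sub>1
    + form_section (\<lambda>p. wedge (ext_deriv M (zero_form f) p) ((2 *\<^sub>R pairing e\<^sub>1 e\<^sub>2) p))"
proof
  fix q
  let ?X = "vf_part e\<^sub>1" and ?Y = "vf_part e\<^sub>2" and ?\<alpha> = "form_part e\<^sub>1" and ?\<beta> = "form_part e\<^sub>2"
  \<comment> \<open>The factor 2 removes the one half in \<open>pairing\<close>.\<close>
  define h where "h = int_prod ?X ?\<beta> q + int_prod ?Y ?\<alpha> q"
  have pair: "(2 *\<^sub>R pairing e\<^sub>1 e\<^sub>2) q = h"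
    by (simp add: pairing_def h_def scaleR_fun_def fun_eq_iff)
  let ?R = "fmult f (dorfman M e\<^sub>1 e\<^sub>2) - fmult (vf_apply ?Y f) e\<^sub>1
    + form_section (\<lambda>p. wedge (ext_deriv M (zero_form f) p) ((2 *\<^sub>R pairing e\<^sub>1 e\<^sub>2) p))"
  show "dorfman M (fmult f e\<^sub>1) e\<^sub>2 q = ?R q"
  proof (cases "q \<in> S")
    case q: True
    have fC: "C S f" using f by (simp add: smooth_functions_def)
    note X = secD(1)[OF a] and Y = secD(1)[OF b] and \<alpha> = secD(2)[OF a] and \<beta> = secD(2)[OF b]
    have \<eta>: "h \<in> alt_forms (T q) (n - 1)"
      unfolding h_def
      using subspace_add[OF subspace_alt_forms[OF subspace_tangent] FM_alt[OF FM_int_prod[OF \<beta> X] q]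
          FM_alt[OF FM_int_prod[OF \<alpha> Y] q]] .
    have vR: "vf_part ?R q = f q *\<^sub>R br ?X ?Y q - ?Y q f *\<^sub>R ?X q"
      by (simp add: on_sections_def anchor_def fmult_def form_section_def dorfman_def vf_apply_def)
    have fR: "form_part ?R q = f q *\<^sub>R form_part (dorfman M e\<^sub>1 e\<^sub>2) q - ?Y q f *\<^sub>R ?\<alpha> q +
        wedge (ext_deriv M (zero_form f) q) h"
      unfolding pair[symmetric]
      by (simp add: form_part_def fmult_def form_section_def vf_apply_def)
    show ?thesis
    proof (rule section_eqI)
      show "vf_part (dorfman M (fmult f e\<^sub>1) e\<^sub>2) q = vf_part ?R q"
        unfolding vR vf_part_dorfman vf_part_fmult br_scale_left[OF S_open q Y X fC] ..
      show "form_part (dorfman M (fmult f e\<^sub>1) e\<^sub>2) q = form_part ?R q"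
      proof
        fix vs
        show "form_part (dorfman M (fmult f e\<^sub>1) e\<^sub>2) q vs = form_part ?R q vs"
        proof (cases "set vs \<subseteq> T q")
          case t: True
          have i: "int_prod ?Y (\<lambda>r. f r *\<^sub>R ?\<alpha> r) = (\<lambda>r. f r *\<^sub>R int_prod ?Y ?\<alpha> r)"
            by (simp add: int_prod_def fun_eq_iff scaleR_fun_def)
          have "form_part (dorfman M (fmult f e\<^sub>1) e\<^sub>2) q vs =
              lie_deriv M (\<lambda>r. f r *\<^sub>R ?X r) ?\<beta> q vs - lie_deriv M ?Y (\<lambda>r. f r *\<^sub>R ?\<alpha> r) q vs +
              ext_deriv M (\<lambda>r. f r *\<^sub>R int_prod ?Y ?\<alpha> r) q vs"
            unfolding form_part_dorfman_eq vf_part_fmult form_part_fmult i by simp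
          also have "\<dots> = f q * (lie_deriv M ?X ?\<beta> q vs - lie_deriv M ?Y ?\<alpha> q vs + ext_deriv M (int_prod ?Y ?\<alpha>) q vs)
              - ?Y q f * ?\<alpha> q vs +
              ((\<Sum>i<length vs. (-1) ^ i * (vs ! i) f * int_prod ?X ?\<beta> q (omit i vs)) +
               (\<Sum>i<length vs. (-1) ^ i * (vs ! i) f * int_prod ?Y ?\<alpha> q (omit i vs)))"
            unfolding lie_deriv_scale_field[OF S_open q X \<beta> fC t] lie_deriv_scale_form[OF S_open q Y \<alpha> fC]
              ext_deriv_scale_form[OF S_open q FM_int_prod[OF \<alpha> Y] fC t]
            by (simp add: scaleR_fun_def algebra_simps)
          also have "(\<Sum>i<length vs. (-1) ^ i * (vs ! i) f * int_prod ?X ?\<beta> q (omit i vs)) +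
              (\<Sum>i<length vs. (-1) ^ i * (vs ! i) f * int_prod ?Y ?\<alpha> q (omit i vs)) =
              wedge (ext_deriv M (zero_form f) q) h vs"
          proof -
            have "ext_deriv M (zero_form f) q [vs ! i] = (vs ! i) f" if "i < length vs" for i
              using t that nth_mem by (intro ext_deriv_zero_form(3)) blast
            moreover have "wedge (ext_deriv M (zero_form f) q) h vs =
                (\<Sum>i<length vs. (-1) ^ i * ext_deriv M (zero_form f) q [vs ! i] * h (omit i vs))"
              using ext_deriv_zero_form(1) t by (rule wedge_1_form[OF subspace_tangent \<eta>])
            ultimately show ?thesis
              by (simp add: h_def sum.distrib[symmetric] algebra_simps)
          qed
          also have "lie_deriv M ?X ?\<beta> q vs - lie_deriv M ?Y ?\<alpha> q vs + ext_deriv M (int_prod ?Y ?\<alpha>) q vs =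
              form_part (dorfman M e\<^sub>1 e\<^sub>2) q vs"
            by (simp add: form_part_dorfman_eq)
          finally show ?thesis
            unfolding fR by (simp add: scaleR_fun_def)
        next
          case False
          have "wedge (ext_deriv M (zero_form f) q) h vs = 0"
            using ext_deriv_zero_form(2) alt_support[OF \<eta>] False by (rule wedge_support)
          moreover have "form_part e q vs = 0" if "e \<in> sections M (higher_bundle M n)" for e
            using alt_support[OF FM_alt[OF secD(2)[OF that] q] False] .
          ultimately show ?thesis
            unfolding fR using dorfman_section[OF a b] dorfman_section[OF fmult_section[OF a f] b] a
            by (simp add: scaleR_fun_def)
        qed
      qed
    qed
  next
    case False
    note z = secD(3)[OF a False] secD(3)[OF b False]
    have "h = (\<lambda>_. 0)"
      using z by (simp add: h_def int_prod_def on_sections_def anchor_def form_part_def fun_eq_iff)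
    then have "wedge (ext_deriv M (zero_form f) q) h = (\<lambda>_. 0)"
      by (simp add: wedge_def fun_eq_iff)
    then have "form_section (\<lambda>p. wedge (ext_deriv M (zero_form f) p) ((2 *\<^sub>R pairing e\<^sub>1 e\<^sub>2) p)) q = 0"
      unfolding form_section_def pair by (simp add: zero_prod_def fun_eq_iff)
    then show ?thesis
      using dorfman_outside[of q e\<^sub>1 e\<^sub>2] dorfman_outside[of q "fmult f e\<^sub>1" e\<^sub>2] z False
      by (simp add: fmult_def)
  qed
qed

text \<open>The field parts are the Jacobi identity. On form parts, the iterated Lie derivatives
  match by \<open>lie_deriv_br\<close>. The contractions of \<open>d\<alpha>\<close> and
  \<open>d\<beta>\<close> with brackets occur in both nested terms with the outer arguments
  exchanged, and the contractions with \<open>Z\<close> match the derivative of the inner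
  bracket.\<close>

lemma dorfman_leibniz:
  assumes a: "e\<^sub>1 \<in> sections M (higher_bundle M n)" and b: "e\<^sub>2 \<in> sections M (higher_bundle M n)"
    and c: "e\<^sub>3 \<in> sections M (higher_bundle M n)"
  shows "dorfman M e\<^sub>1 (dorfman M e\<^sub>2 e\<^sub>3) =
    dorfman M (dorfman M e\<^sub>1 e\<^sub>2) e\<^sub>3 + dorfman M e\<^sub>2 (dorfman M e\<^sub>1 e\<^sub>3)" (is "?L = ?R")
proof
  fix q
  let ?X = "vf_part e\<^sub>1" and ?Y = "vf_part e\<^sub>2" and ?Z = "vf_part e\<^sub>3"
  let ?\<alpha> = "form_part e\<^sub>1" and ?\<beta> = "form_part e\<^sub>2" and ?\<gamma> = "form_part e\<^sub>3"
  let ?L1 = "lie_deriv M" and ?d = "ext_deriv M" and ?i = int_prod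
  show "?L q = ?R q"
  proof (cases "q \<in> S")
    case q: True
    note X = secD(1)[OF a] and Y = secD(1)[OF b] and Z = secD(1)[OF c]
    note \<alpha> = secD(2)[OF a] and \<beta> = secD(2)[OF b] and \<gamma> = secD(2)[OF c]
    note dF = FM_ext_deriv[OF S_open] and LF = FM_lie_deriv[OF S_open]
    have lie: "?L1 X' (form_part (dorfman M e e')) q =
        ?L1 X' (?L1 (vf_part e) (form_part e')) q - ?i (vf_part e') (?L1 X' (?d (form_part e))) q
        - ?i (br X' (vf_part e')) (?d (form_part e)) q"
      if X': "VF S X'" and e: "e \<in> sections M (higher_bundle M n)" and e': "e' \<in> sections M (higher_bundle M n)"
      for X' e e'
    proof -
      note Xe = secD(1)[OF e] and Xe' = secD(1)[OF e'] and \<omega> = secD(2)[OF e] and \<omega>' = secD(2)[OF e']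
      have "?L1 X' (form_part (dorfman M e e')) q =
          ?L1 X' (?L1 (vf_part e) (form_part e') - ?i (vf_part e') (?d (form_part e))) q"
        by (rule lie_deriv_cong[OF S_open q X']) (simp add: form_part_dorfman[OF e e'])
      also have "\<dots> = ?L1 X' (?L1 (vf_part e) (form_part e')) q - ?L1 X' (?i (vf_part e') (?d (form_part e))) q"
        by (rule lie_deriv_diff[OF S_open q X' LF[OF Xe \<omega>'] FM_int_prod[OF dF[OF \<omega>] Xe']])
      finally show ?thesis
        using int_prod_lie_deriv[OF S_open q X' Xe' dF[OF \<omega>]] by (simp add: fun_eq_iff)
    qed
    \<comment> \<open>Here \<open>d\<^sup>2 = 0\<close> removes the doubly differentiated term, and
      d is moved past \<open>L\<^sub>X\<close>.\<close>
    have ext: "?d (form_part (dorfman M e\<^sub>1 e\<^sub>2)) r = ?L1 ?X (?d ?\<beta>) r - ?L1 ?Y (?d ?\<alpha>) r" if r: "r \<in> S" for r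
    proof -
      have "?d (form_part (dorfman M e\<^sub>1 e\<^sub>2)) r = ?d (?L1 ?X ?\<beta> - ?i ?Y (?d ?\<alpha>)) r"
        by (rule ext_deriv_cong[OF S_open r]) (simp add: form_part_dorfman[OF a b])
      also have "\<dots> = ?d (?L1 ?X ?\<beta>) r - ?d (?i ?Y (?d ?\<alpha>)) r"
        by (rule ext_deriv_diff[OF S_open r LF[OF X \<beta>] FM_int_prod[OF dF[OF \<alpha>] Y]])
      also have "?d (?i ?Y (?d ?\<alpha>)) r = ?L1 ?Y (?d ?\<alpha>) r - ?i ?Y (?d (?d ?\<alpha>)) r"
        using int_prod_ext_deriv[OF S_open r Y dF[OF \<alpha>]] by (simp add: fun_eq_iff)
      also have "?i ?Y (?d (?d ?\<alpha>)) r = 0"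
        using ext_deriv_ext_deriv[OF S_open \<alpha> r] by (simp add: int_prod_def fun_eq_iff)
      also have "?d (?L1 ?X ?\<beta>) r = ?L1 ?X (?d ?\<beta>) r"
        using lie_deriv_ext_deriv[OF S_open X \<beta> r] by simp
      finally show ?thesis by (simp add: fun_eq_iff)
    qed
    have 1: "form_part ?L q = ?L1 ?X (?L1 ?Y ?\<gamma>) q - ?i ?Z (?L1 ?X (?d ?\<beta>)) q - ?i (br ?X ?Z) (?d ?\<beta>) q
        - ?i (br ?Y ?Z) (?d ?\<alpha>) q"
      unfolding form_part_dorfman[OF a dorfman_section[OF b c] q] lie[OF X b c] vf_part_dorfman by simp
    have 2: "form_part (dorfman M e\<^sub>2 (dorfman M e\<^sub>1 e\<^sub>3)) q =
        ?L1 ?Y (?L1 ?X ?\<gamma>) q - ?i ?Z (?L1 ?Y (?d ?\<alpha>)) q - ?i (br ?Y ?Z) (?d ?\<alpha>) q - ?i (br ?X ?Z) (?d ?\<beta>) q"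
      unfolding form_part_dorfman[OF b dorfman_section[OF a c] q] lie[OF Y a c] vf_part_dorfman by simp
    have 3: "form_part (dorfman M (dorfman M e\<^sub>1 e\<^sub>2) e\<^sub>3) q =
        ?L1 ?X (?L1 ?Y ?\<gamma>) q - ?L1 ?Y (?L1 ?X ?\<gamma>) q - (?i ?Z (?L1 ?X (?d ?\<beta>)) q - ?i ?Z (?L1 ?Y (?d ?\<alpha>)) q)"
    proof -
      have "?i ?Z (?d (form_part (dorfman M e\<^sub>1 e\<^sub>2))) q = ?i ?Z (?L1 ?X (?d ?\<beta>)) q - ?i ?Z (?L1 ?Y (?d ?\<alpha>)) q"
        using ext[OF q] by (simp add: int_prod_def fun_eq_iff)
      then show ?thesis
        unfolding form_part_dorfman[OF dorfman_section[OF a b] c q] vf_part_dorfman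
          lie_deriv_br[OF S_open X Y \<gamma> q] by metis
    qed
    show ?thesis
    proof (rule section_eqI)
      show "vf_part ?L q = vf_part ?R q"
        unfolding vf_part_add vf_part_dorfman by (rule br_jacobi[OF S_open q X Y Z])
      show "form_part ?L q = form_part ?R q"
        unfolding form_part_add plus_fun_apply 1 2 3 by (simp add: fun_eq_iff)
    qed
  next
    case False
    note z = secD(3)[OF _ False]
    show ?thesis
      using z[OF dorfman_section[OF a dorfman_section[OF b c]]] z[OF dorfman_section[OF dorfman_section[OF a b] c]]
        z[OF dorfman_section[OF b dorfman_section[OF a c]]] by simp
  qed
qed

text \<open>Commuting \<open>L\<^sub>X\<close> with the contractions produces terms with
  \<open>[X, Y]\<close> and \<open>[X, Z]\<close>, which are the field parts of the inner brackets.
  The two double contractions of \<open>d\<alpha>\<close> cancel by skew symmetry.\<close>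

lemma lie_deriv_pairing:
  assumes a: "e\<^sub>1 \<in> sections M (higher_bundle M n)" and b: "e\<^sub>2 \<in> sections M (higher_bundle M n)"
    and c: "e\<^sub>3 \<in> sections M (higher_bundle M n)"
  shows "lie_deriv M (vf_part e\<^sub>1) (pairing e\<^sub>2 e\<^sub>3) =
    pairing (dorfman M e\<^sub>1 e\<^sub>2) e\<^sub>3 + pairing e\<^sub>2 (dorfman M e\<^sub>1 e\<^sub>3)"
proof
  fix q
  let ?X = "vf_part e\<^sub>1" and ?Y = "vf_part e\<^sub>2" and ?Z = "vf_part e\<^sub>3"
  let ?\<alpha> = "form_part e\<^sub>1" and ?\<beta> = "form_part e\<^sub>2" and ?\<gamma> = "form_part e\<^sub>3"
  have pair: "pairing e e' r = (1/2) *\<^sub>R (int_prod (vf_part e) (form_part e') r + int_prod (vf_part e') (form_part e) r)"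
    for e e' :: "'p \<Rightarrow> 'p tvec \<times> 'p form" and r
    by (simp add: pairing_def scaleR_fun_def fun_eq_iff)
  show "lie_deriv M ?X (pairing e\<^sub>2 e\<^sub>3) q = (pairing (dorfman M e\<^sub>1 e\<^sub>2) e\<^sub>3 + pairing e\<^sub>2 (dorfman M e\<^sub>1 e\<^sub>3)) q"
  proof (cases "q \<in> S")
    case q: True
    note X = secD(1)[OF a] and Y = secD(1)[OF b] and Z = secD(1)[OF c]
    note \<alpha> = secD(2)[OF a] and \<beta> = secD(2)[OF b] and \<gamma> = secD(2)[OF c]
    note i1 = FM_int_prod[OF \<gamma> Y] and i2 = FM_int_prod[OF \<beta> Z]
    \<comment> \<open>The summand 0 brings the factor one half into the shape of
      \<open>lie_deriv_lincomb\<close>.\<close>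
    have "lie_deriv M ?X (pairing e\<^sub>2 e\<^sub>3) q =
        lie_deriv M ?X (\<lambda>r. 0 + (1/2) *\<^sub>R (int_prod ?Y ?\<gamma> + int_prod ?Z ?\<beta>) r) q"
      by (rule lie_deriv_cong[OF S_open q X]) (simp add: pair)
    also have "\<dots> = lie_deriv M ?X (\<lambda>_. 0) q + (1/2) *\<^sub>R lie_deriv M ?X (int_prod ?Y ?\<gamma> + int_prod ?Z ?\<beta>) q"
      by (rule lie_deriv_lincomb[OF S_open q X FM_zero FM_add[OF S_open i1 i2]])
    also have "lie_deriv M ?X (int_prod ?Y ?\<gamma> + int_prod ?Z ?\<beta>) q =
        lie_deriv M ?X (int_prod ?Y ?\<gamma>) q + lie_deriv M ?X (int_prod ?Z ?\<beta>) q"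
      by (rule lie_deriv_add[OF S_open q X i1 i2])
    finally have 1: "lie_deriv M ?X (pairing e\<^sub>2 e\<^sub>3) q =
        (1/2) *\<^sub>R (lie_deriv M ?X (int_prod ?Y ?\<gamma>) q + lie_deriv M ?X (int_prod ?Z ?\<beta>) q)"
      unfolding lie_deriv_zero[OF q X] by (simp only: add_0)
    have 2: "int_prod ?Z (form_part (dorfman M e\<^sub>1 e\<^sub>2)) q =
        lie_deriv M ?X (int_prod ?Z ?\<beta>) q - int_prod (br ?X ?Z) ?\<beta> q - int_prod ?Z (int_prod ?Y (ext_deriv M ?\<alpha>)) q"
      unfolding int_prod_lie_deriv[OF S_open q X Z \<beta>, symmetric]
      using form_part_dorfman[OF a b q] by (simp add: int_prod_def fun_eq_iff)
    have 3: "int_prod ?Y (form_part (dorfman M e\<^sub>1 e\<^sub>3)) q =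
        lie_deriv M ?X (int_prod ?Y ?\<gamma>) q - int_prod (br ?X ?Y) ?\<gamma> q - int_prod ?Y (int_prod ?Z (ext_deriv M ?\<alpha>)) q"
      unfolding int_prod_lie_deriv[OF S_open q X Y \<gamma>, symmetric]
      using form_part_dorfman[OF a c q] by (simp add: int_prod_def fun_eq_iff)
    show ?thesis
      unfolding 1 plus_fun_apply pair vf_part_dorfman 2 3
        int_prod_swap[where Y="vf_part e\<^sub>2" and Z="vf_part e\<^sub>3",
          OF FM_ext_deriv[OF S_open \<alpha>] q VF_tan[OF Y q] VF_tan[OF Z q]]
      by (simp add: scaleR_fun_def fun_eq_iff field_simps)
  next
    case False
    note z = secD(3)[OF _ False]
    have 0: "pairing e e' q = 0" if "e q = 0" "e' q = 0" for e e' :: "'p \<Rightarrow> 'p tvec \<times> 'p form"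
      using that unfolding pair
      by (simp add: int_prod_def on_sections_def anchor_def form_part_def scaleR_fun_def fun_eq_iff)
    have "lie_deriv M ?X (pairing e\<^sub>2 e\<^sub>3) q = 0"
      using z[OF a] 0[of e\<^sub>2 e\<^sub>3] z[OF b] z[OF c] by (simp add: lie_deriv_def on_sections_def anchor_def fun_eq_iff)
    then show ?thesis
      using 0[of "dorfman M e\<^sub>1 e\<^sub>2" e\<^sub>3] 0[of e\<^sub>2 "dorfman M e\<^sub>1 e\<^sub>3"]
        z[OF dorfman_section[OF a b]] z[OF c] z[OF b] z[OF dorfman_section[OF a c]] by simp
  qed
qed

section \<open>The axioms of a Leibniz algebroid\<close>

lemma subspace_sections: "subspace (sections M (higher_bundle M n))"
  unfolding subspace_def
proof (intro conjI ballI allI)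
  have "vf_part (0 :: 'p \<Rightarrow> 'p tvec \<times> 'p form) = (\<lambda>_. 0)" "form_part (0 :: 'p \<Rightarrow> 'p tvec \<times> 'p form) = (\<lambda>_. 0)"
    by (simp_all add: fun_eq_iff on_sections_def anchor_def form_part_def)
  then show "0 \<in> sections M (higher_bundle M n)"
    unfolding higher_section_iff using VF_zero FM_zero by (metis zero_fun_apply)
next
  fix x y assume x: "x \<in> sections M (higher_bundle M n)" and y: "y \<in> sections M (higher_bundle M n)"
  show "x + y \<in> sections M (higher_bundle M n)"
    unfolding higher_section_iff vf_part_add form_part_add
    using VF_add[OF secD(1)[OF x] secD(1)[OF y]] FM_add[OF S_open secD(2)[OF x] secD(2)[OF y]]
      secD(3)[OF x] secD(3)[OF y] by simp
next
  fix c :: real and x assume x: "x \<in> sections M (higher_bundle M n)"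
  have "c *\<^sub>R x = fmult (\<lambda>_. c) x" by (simp add: scaleR_fun_def fmult_def)
  then show "c *\<^sub>R x \<in> sections M (higher_bundle M n)"
    using fmult_section[OF x, of "\<lambda>_. c"] C_const[OF S_open] by (simp add: smooth_functions_def)
qed

lemma dorfman_add:
  assumes a: "a \<in> sections M (higher_bundle M n)" and b: "b \<in> sections M (higher_bundle M n)"
    and c: "c \<in> sections M (higher_bundle M n)"
  shows "dorfman M (a + b) c = dorfman M a c + dorfman M b c"
    and "dorfman M c (a + b) = dorfman M c a + dorfman M c b"
proof -
  note ab = subspace_add[OF subspace_sections a b]
  note X = secD(1)[OF a] and Y = secD(1)[OF b] and Z = secD(1)[OF c]
  note \<alpha> = secD(2)[OF a] and \<beta> = secD(2)[OF b] and \<gamma> = secD(2)[OF c]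
  have out: "dorfman M x y q = 0" if "x \<in> sections M (higher_bundle M n)" "y \<in> sections M (higher_bundle M n)" "q \<notin> S"
    for x y q using secD(3)[OF dorfman_section[OF that(1,2)] that(3)] .
  show "dorfman M (a + b) c = dorfman M a c + dorfman M b c"
  proof
    fix q
    show "dorfman M (a + b) c q = (dorfman M a c + dorfman M b c) q"
    proof (cases "q \<in> S")
      case q: True
      show ?thesis
      proof (rule section_eqI)
        show "vf_part (dorfman M (a + b) c) q = vf_part (dorfman M a c + dorfman M b c) q"
          unfolding vf_part_add vf_part_dorfman by (rule br_add_left[OF S_open q Z X Y])
        have "int_prod (vf_part c) (ext_deriv M (form_part a + form_part b)) q =
            int_prod (vf_part c) (ext_deriv M (form_part a)) q + int_prod (vf_part c) (ext_deriv M (form_part b)) q"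
          using ext_deriv_add[OF S_open q \<alpha> \<beta>] by (simp add: int_prod_def fun_eq_iff)
        then show "form_part (dorfman M (a + b) c) q = form_part (dorfman M a c + dorfman M b c) q"
          unfolding form_part_add plus_fun_apply form_part_dorfman[OF ab c q] form_part_dorfman[OF a c q]
            form_part_dorfman[OF b c q] vf_part_add lie_deriv_add_field[OF S_open q X Y \<gamma>]
          by (simp add: fun_eq_iff)
      qed
    qed (simp add: out[OF ab c] out[OF a c] out[OF b c])
  qed
  show "dorfman M c (a + b) = dorfman M c a + dorfman M c b"
  proof
    fix q
    show "dorfman M c (a + b) q = (dorfman M c a + dorfman M c b) q"
    proof (cases "q \<in> S")
      case q: True
      show ?thesis
      proof (rule section_eqI)
        show "vf_part (dorfman M c (a + b)) q = vf_part (dorfman M c a + dorfman M c b) q"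
          unfolding vf_part_add vf_part_dorfman by (rule br_add_right[OF S_open q Z X Y])
        have "int_prod (\<lambda>r. vf_part a r + vf_part b r) (ext_deriv M (form_part c)) q =
            int_prod (vf_part a) (ext_deriv M (form_part c)) q + int_prod (vf_part b) (ext_deriv M (form_part c)) q"
          by (rule int_prod_add_field[OF FM_ext_deriv[OF S_open \<gamma>] q, where A="vf_part a" and B="vf_part b"])
            (rule VF_tan[OF X q] VF_tan[OF Y q] refl)+
        then show "form_part (dorfman M c (a + b)) q = form_part (dorfman M c a + dorfman M c b) q"
          unfolding form_part_add plus_fun_apply form_part_dorfman[OF c ab q] form_part_dorfman[OF c a q]
            form_part_dorfman[OF c b q] vf_part_add lie_deriv_add[OF S_open q Z \<alpha> \<beta>]
          by (simp add: fun_eq_iff)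
      qed
    qed (simp add: out[OF c ab] out[OF c a] out[OF c b])
  qed
qed

text \<open>A real scalar is a constant function, whose derivatives vanish, so the rules for
  \<open>fmult\<close> lose their correction terms.\<close>

lemma dorfman_scaleR:
  assumes a: "a \<in> sections M (higher_bundle M n)" and b: "b \<in> sections M (higher_bundle M n)"
  shows "dorfman M (r *\<^sub>R a) b = r *\<^sub>R dorfman M a b" and "dorfman M a (r *\<^sub>R b) = r *\<^sub>R dorfman M a b"
proof -
  have f: "(\<lambda>_. r) \<in> smooth_functions M" using C_const[OF S_open] by (simp add: smooth_functions_def)
  have sc: "r *\<^sub>R x = fmult (\<lambda>_. r) x" for x :: "'p \<Rightarrow> 'p tvec \<times> 'p form"
    by (simp add: scaleR_fun_def fmult_def)
  have v: "fmult (vf_apply (vf_part x) (\<lambda>_. r)) y q = 0"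
    if "x \<in> sections M (higher_bundle M n)" "y \<in> sections M (higher_bundle M n)" for x y q
    using tan_const[OF VF_tan[OF secD(1)[OF that(1)]], of q r] secD(3)[OF that(2), of q]
    by (cases "q \<in> S") (simp_all add: fmult_def vf_apply_def)
  have d: "ext_deriv M (zero_form (\<lambda>_. r)) q vs = 0" for q vs
  proof (cases "set vs \<subseteq> T q \<and> length vs = 1")
    case True
    then obtain v where "vs = [v]" "v \<in> T q" by (cases vs) auto
    then show ?thesis using ext_deriv_zero_form(3) tan_const by simp
  next
    case False
    then show ?thesis using ext_deriv_zero_form(1,2) by blast
  qed
  have w: "form_section (\<lambda>p. wedge (ext_deriv M (zero_form (\<lambda>_. r)) p) (\<eta> p)) q = 0" for \<eta> q
    by (simp add: form_section_def wedge_def d zero_prod_def fun_eq_iff)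
  show "dorfman M a (r *\<^sub>R b) = r *\<^sub>R dorfman M a b"
    unfolding sc dorfman_fmult_right[OF a b f] using v[OF a b] by (intro ext) simp
  show "dorfman M (r *\<^sub>R a) b = r *\<^sub>R dorfman M a b"
    unfolding sc dorfman_fmult_left[OF a b f] using v[OF b a] w by (intro ext) simp
qed

lemma dorfman_leibniz_algebroid: "leibniz_algebroid M (higher_bundle M n) (dorfman M) anchor"
  unfolding leibniz_algebroid_def leibniz_algebra_def
proof (intro conjI ballI allI)
  show "vector_bundle M (higher_bundle M n)" by (rule higher_bundle_vector_bundle)
  show "bundle_morphism M (higher_bundle M n) (tangent_bundle M) anchor" by (rule anchor_morphism)
  show "subspace (sections M (higher_bundle M n))" by (rule subspace_sections)
  fix a b assume a: "a \<in> sections M (higher_bundle M n)" and b: "b \<in> sections M (higher_bundle M n)"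
  show "dorfman M a b \<in> sections M (higher_bundle M n)" by (rule dorfman_section[OF a b])
  show "dorfman M (r *\<^sub>R a) b = r *\<^sub>R dorfman M a b" for r by (rule dorfman_scaleR(1)[OF a b])
  show "dorfman M a (r *\<^sub>R b) = r *\<^sub>R dorfman M a b" for r by (rule dorfman_scaleR(2)[OF a b])
  show "on_sections anchor (dorfman M a b) p = lie_bracket M (on_sections anchor a) (on_sections anchor b) p" for p
    by (simp add: vf_part_dorfman)
  show "dorfman M a (fmult f b) p = (fmult f (dorfman M a b) + fmult (vf_apply (on_sections anchor a) f) b) p"
    if "f \<in> smooth_functions M" for f p
    by (simp only: dorfman_fmult_right[OF a b that])
  fix c assume c: "c \<in> sections M (higher_bundle M n)"
  show "dorfman M (a + b) c = dorfman M a c + dorfman M b c" by (rule dorfman_add(1)[OF a b c])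
  show "dorfman M a (b + c) = dorfman M a b + dorfman M a c" by (rule dorfman_add(2)[OF b c a])
  show "dorfman M a (dorfman M b c) = dorfman M (dorfman M a b) c + dorfman M b (dorfman M a c)"
    by (rule dorfman_leibniz[OF a b c])
qed

end

theorem theorem2p5:
  fixes M :: "'p manifold" and m n :: nat
  assumes "smooth_manifold M" and "mdim M = m"
  shows
    "(\<forall>e\<^sub>1\<in>sections M (higher_bundle M n). \<forall>e\<^sub>2\<in>sections M (higher_bundle M n).
        \<forall>f\<in>smooth_functions M.
          dorfman M e\<^sub>1 (fmult f e\<^sub>2) =
            fmult f (dorfman M e\<^sub>1 e\<^sub>2) + fmult (vf_apply (on_sections anchor e\<^sub>1) f) e\<^sub>2 \<and>
          dorfman M (fmult f e\<^sub>1) e\<^sub>2 =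
            fmult f (dorfman M e\<^sub>1 e\<^sub>2) - fmult (vf_apply (on_sections anchor e\<^sub>2) f) e\<^sub>1
            + form_section (\<lambda>p. wedge (ext_deriv M (zero_form f) p) ((2 *\<^sub>R pairing e\<^sub>1 e\<^sub>2) p))) \<and>
     (\<forall>e\<^sub>1\<in>sections M (higher_bundle M n). \<forall>e\<^sub>2\<in>sections M (higher_bundle M n).
        \<forall>e\<^sub>3\<in>sections M (higher_bundle M n).
          dorfman M e\<^sub>1 (dorfman M e\<^sub>2 e\<^sub>3) =
            dorfman M (dorfman M e\<^sub>1 e\<^sub>2) e\<^sub>3 + dorfman M e\<^sub>2 (dorfman M e\<^sub>1 e\<^sub>3)) \<and>
     leibniz_algebroid M (higher_bundle M n) (dorfman M) anchor \<and>
     (\<forall>e\<^sub>1\<in>sections M (higher_bundle M n). \<forall>e\<^sub>2\<in>sections M (higher_bundle M n).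
        \<forall>e\<^sub>3\<in>sections M (higher_bundle M n).
          lie_deriv M (on_sections anchor e\<^sub>1) (pairing e\<^sub>2 e\<^sub>3) =
            pairing (dorfman M e\<^sub>1 e\<^sub>2) e\<^sub>3 + pairing e\<^sub>2 (dorfman M e\<^sub>1 e\<^sub>3))"
proof -
  interpret smooth_mfd M by (rule smooth_mfd.intro) (rule assms(1))
  show ?thesis
    using dorfman_fmult_right dorfman_fmult_left dorfman_leibniz dorfman_leibniz_algebroid lie_deriv_pairing
    by (intro conjI ballI)
qed

end
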